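(* Let $\Gamma$ be a finite quiver without oriented cycles, $t\in\Gamma_0$, $d>0$ an integer, and suppose $V^t_d\ne0$. Let $m,n,l=m+n$, $s_i$, $u_i$, $V_i$, $W_i$ be as defined in the context. For each $1\le i\le m$ let $\beta^*_{i,j}$, $1\le j\le\dim W_i$, be the new arrows (in $\Gamma_1^*$) going from $t$ to $s_i$, and for each $m+1\le i\le l$ let $\beta_{i,j}$, $1\le j\le\dim W_i$, be the old arrows (in $\Gamma_1$) going from $t$ to $u_{i-m}$. Choose positive integers $n_i$, $1\le i\le l$, satisfying $1\le n_i\le\dim V_i$ and $$\sum_{i=1}^l(n_i-1)\dim W_i<\dim V^t_d\le\sum_{i=1}^l n_i\dim W_i,$$ and set $c=\dim V^t_d-\sum_{i=1}^l(n_i-1)\dim W_i$. Write $c$ as a sum of nonnegative integers $c=c_1+c_2+\cdots+c_l$ with $0\le c_i\le\dim W_i$. Then for a general choice of $\sum_{i=1}^l n_i$ elements $F_{i,k}$, $1\le i\le l$, $1\le k\le n_i$, where $F_{i,k}\in V^{s_i}_{d-1}$ for $1\le i\le m$ and $F_{i,k}\in V^{u_{i-m}}_d$ for $m+1\le i\le l$, the following $\dim V^t_d$ elements form a basis for $V^t_d$: - $F_{i,k}\beta^*_{i,j}$ for $1\le i\le m$, $1\le k\le n_i-1$, $1\le j\le\dim W_i$; - $F_{i,n_i}\beta^*_{i,j}$ for $1\le i\le m$, $1\le j\le c_i$; - $F_{i,k}\beta_{i,j}$ for $m+1\le i\le l$, $1\le k\le n_i-1$, $1\le j\le\dim W_i$;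 - $F_{i,n_i}\beta_{i,j}$ for $m+1\le i\le l$, $1\le j\le c_i$. (If the number on the right in an inequality giving the range of $j$ or $k$ is less than $1$, there are no such $j$ or $k$.)
   Context: $k$ is a fixed algebraically closed field and $\dim=\dim_k$ (the letter $k$ is also used as an integer index in $F_{i,k}$). $\Gamma=(\Gamma_0,\Gamma_1)$ is a finite quiver (vertices $\Gamma_0$, arrows $\Gamma_1$) without oriented cycles; $s(\gamma)$ and $e(\gamma)$ are the starting and end points of $\gamma\in\Gamma_1$. $\bar\Gamma$ is the quiver with the same vertices and with arrows $\Gamma_1\cup\Gamma_1^*$ (disjoint union), where for each $\gamma:t\to v$ in $\Gamma_1$ there is exactly one arrow $\gamma^*:v\to t$ in $\Gamma_1^*$. Arrows in $\Gamma_1$ are called old, arrows in $\Gamma_1^*$ new. In the path algebra $k\bar\Gamma$ a product $pq$ of paths means "first $q$, then $p$" (so paths starting at a fixed vertex span a left ideal). $k\bar\Gamma$ is graded by giving trivial paths and arrows of $\Gamma_1$ degree $0$ and arrows of $\Gamma_1^*$ degree $1$. Fix functions $a,b:\Gamma_1\to k$ with $a(\gamma)\ne0$, $b(\gamma)\ne0$ for all $\gamma$. Let $m_t=\sum_{\gamma\in\Gamma_1,\,s(\gamma)=t}a(\gamma)\gamma^*\gamma-\sum_{\gamma\in\Gamma_1,\,e(\gamma)=t}b(\gamma)\gamma\gamma^*$ and let $J$ be the two-sided ideal of $k\bar\Gamma$ generated by $\sum_{t\in\Gamma_0}m_t$. The $(a,b)$-preprojective algebra is the graded algebra $\mathcal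 P_k(\Gamma)_{a,b}=k\bar\Gamma/J$. For $t\in\Gamma_0$ and an integer $d\ge0$, $V^t_d$ is the (finite dimensional) $k$-span in $\mathcal P_k(\Gamma)_{a,b}$ of the images of all paths of $\bar\Gamma$ of degree $d$ starting at $t$. Arrows of $\bar\Gamma$ also denote their images in $\mathcal P_k(\Gamma)_{a,b}$, and the products $F\beta$, $F\beta^*$ are taken in $\mathcal P_k(\Gamma)_{a,b}$. Fix $t$ and $d$. Let $s_1,\dots,s_m$ be the distinct vertices having arrows in $\Gamma_1$ from them to $t$, and $u_1,\dots,u_n$ the distinct vertices with arrows in $\Gamma_1$ going from $t$ to them; $l=m+n$. For $1\le i\le m$, $V_i=V^{s_i}_{d-1}$ and $W_i$ is the $k$-vector space with basis the arrows in $\Gamma_1^*$ going from $t$ to $s_i$. For $m+1\le i\le l$, $V_i=V^{u_{i-m}}_d$ and $W_i$ is the $k$-vector space with basis the arrows in $\Gamma_1$ going from $t$ to $u_{i-m}$. "For a general choice of elements $F_{i,k}$" means: there is a dense Zariski open subset of the affine space $\prod_{i=1}^l V_i^{n_i}$ such that the conclusion holds whenever the tuple $(F_{i,k})$ belongs to it. *)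

theory Defs
  imports
    "HOL-Analysis.Abstract_Topology"
    "HOL-Algebra.QuotRing"
    "Graph_Theory.Arc_Walk"
    "Jordan_Normal_Form.VS_Connect"
begin

section \<open>The double quiver and its path algebra\<close>

text \<open>A quiver is a finite directed multigraph with loops allowed, i.e. a \<^locale>\<open>fin_digraph\<close>.
  In the double quiver, \<^term>\<open>Inl \<gamma>\<close> is the old arrow \<open>\<gamma>\<close> and
  \<^term>\<open>Inr \<gamma>\<close> is the new arrow \<open>\<gamma>\<^sup>*\<close>.\<close>

definition double_quiver :: "('v, 'e) pre_digraph \<Rightarrow> ('v, 'e + 'e) pre_digraph" where
  "double_quiver \<Gamma> =
     \<lparr> verts = verts \<Gamma>, arcs = arcs \<Gamma> <+> arcs \<Gamma>,
       tail = case_sum (tail \<Gamma>) (head \<Gamma>), head = case_sum (head \<Gamma>) (tail \<Gamma>) \<rparr>"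

definition acyclic_quiver :: "('v, 'e) pre_digraph \<Rightarrow> bool" where
  "acyclic_quiver \<Gamma> \<longleftrightarrow> (\<nexists>p. pre_digraph.cycle \<Gamma> p)"

text \<open>A path is given by its starting vertex and the list of its arrows in the order in which they
  are traversed; \<^term>\<open>(v, [])\<close> is the trivial path at \<open>v\<close>.\<close>

type_synonym ('v, 'e) qpath = "'v \<times> 'e list"

definition qpaths :: "('v, 'e) pre_digraph \<Rightarrow> ('v, 'e) qpath set" where
  "qpaths Q = {(v, es). \<exists>w. pre_digraph.awalk Q v es w}"

definition path_end :: "('v, 'e) pre_digraph \<Rightarrow> ('v, 'e) qpath \<Rightarrow> 'v" where
  "path_end Q p = pre_digraph.awlast Q (fst p) (snd p)"

text \<open>The product \<open>p q\<close> of paths means ``first \<open>q\<close>, then \<open>p\<close>'', and is \<open>0\<close> if \<open>p\<close> does not start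
  where \<open>q\<close> ends. Elements of the path algebra are finitely supported functions on paths.\<close>

definition path_algebra ::
    "('v, 'e) pre_digraph \<Rightarrow> ('k::field, ('v, 'e) qpath \<Rightarrow> 'k) module" where
  "path_algebra Q =
     \<lparr> carrier = {f. finite {p. f p \<noteq> 0} \<and> {p. f p \<noteq> 0} \<subseteq> qpaths Q},
       mult = (\<lambda>f g r. \<Sum>(p, q) \<in> {(p, q). p \<in> qpaths Q \<and> q \<in> qpaths Q \<and>
                             fst p = path_end Q q \<and> r = (fst q, snd q @ snd p)}. f p * g q),
       one = (\<lambda>p. if p \<in> (\<lambda>v. (v, [])) ` verts Q then 1 else 0),
       zero = (\<lambda>p. 0),
       add = (\<lambda>f g p. f p + g p),
       smult = (\<lambda>c f p. c * f p) \<rparr>"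

definition path_elt :: "('v, 'e) qpath \<Rightarrow> ('v, 'e) qpath \<Rightarrow> 'k::field" where
  "path_elt p = (\<lambda>q. if q = p then 1 else 0)"

definition arrow_elt :: "('v, 'e) pre_digraph \<Rightarrow> 'e \<Rightarrow> ('v, 'e) qpath \<Rightarrow> 'k::field" where
  "arrow_elt Q x = path_elt (tail Q x, [x])"

definition path_degree :: "('v, 'e + 'e) qpath \<Rightarrow> nat" where
  "path_degree p = length (filter (\<lambda>x. \<not> isl x) (snd p))"

section \<open>The $(a,b)$-preprojective algebra\<close>

definition mesh_relation ::
    "('v, 'e) pre_digraph \<Rightarrow> ('e \<Rightarrow> 'k) \<Rightarrow> ('e \<Rightarrow> 'k) \<Rightarrow> 'v \<Rightarrow> ('v, 'e + 'e) qpath \<Rightarrow> 'k::field" where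
  "mesh_relation \<Gamma> a b t =
     (let Q = double_quiver \<Gamma>; A = path_algebra Q;
          old = (\<lambda>\<gamma>. arrow_elt Q (Inl \<gamma>)); new = (\<lambda>\<gamma>. arrow_elt Q (Inr \<gamma>))
      in (\<Oplus>\<^bsub>A\<^esub> \<gamma> \<in> {\<gamma> \<in> arcs \<Gamma>. tail \<Gamma> \<gamma> = t}. a \<gamma> \<odot>\<^bsub>A\<^esub> (new \<gamma> \<otimes>\<^bsub>A\<^esub> old \<gamma>))
         \<ominus>\<^bsub>A\<^esub> (\<Oplus>\<^bsub>A\<^esub> \<gamma> \<in> {\<gamma> \<in> arcs \<Gamma>. head \<Gamma> \<gamma> = t}. b \<gamma> \<odot>\<^bsub>A\<^esub> (old \<gamma> \<otimes>\<^bsub>A\<^esub> new \<gamma>)))"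

definition preproj_ideal ::
    "('v, 'e) pre_digraph \<Rightarrow> ('e \<Rightarrow> 'k) \<Rightarrow> ('e \<Rightarrow> 'k) \<Rightarrow> (('v, 'e + 'e) qpath \<Rightarrow> 'k::field) set" where
  "preproj_ideal \<Gamma> a b =
     (let A = path_algebra (double_quiver \<Gamma>)
      in Idl\<^bsub>A\<^esub> {\<Oplus>\<^bsub>A\<^esub> t \<in> verts \<Gamma>. mesh_relation \<Gamma> a b t})"

definition quotient_algebra :: "('k, 'a) module \<Rightarrow> 'a set \<Rightarrow> ('k, 'a set) module" where
  "quotient_algebra A I =
     ring.extend (A Quot I) \<lparr> smult = (\<lambda>c X. \<Union>x\<in>X. I +>\<^bsub>A\<^esub> (c \<odot>\<^bsub>A\<^esub> x)) \<rparr>"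

definition preproj_algebra ::
    "('v, 'e) pre_digraph \<Rightarrow> ('e \<Rightarrow> 'k) \<Rightarrow> ('e \<Rightarrow> 'k)
       \<Rightarrow> ('k::field, (('v, 'e + 'e) qpath \<Rightarrow> 'k) set) module" where
  "preproj_algebra \<Gamma> a b =
     quotient_algebra (path_algebra (double_quiver \<Gamma>)) (preproj_ideal \<Gamma> a b)"

definition preproj_class ::
    "('v, 'e) pre_digraph \<Rightarrow> ('e \<Rightarrow> 'k) \<Rightarrow> ('e \<Rightarrow> 'k)
       \<Rightarrow> (('v, 'e + 'e) qpath \<Rightarrow> 'k::field) \<Rightarrow> (('v, 'e + 'e) qpath \<Rightarrow> 'k) set" where
  "preproj_class \<Gamma> a b f =
     preproj_ideal \<Gamma> a b +>\<^bsub>path_algebra (double_quiver \<Gamma>)\<^esub> f"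

definition preproj_arrow ::
    "('v, 'e) pre_digraph \<Rightarrow> ('e \<Rightarrow> 'k) \<Rightarrow> ('e \<Rightarrow> 'k) \<Rightarrow> 'e + 'e
       \<Rightarrow> (('v, 'e + 'e) qpath \<Rightarrow> 'k::field) set" where
  "preproj_arrow \<Gamma> a b x = preproj_class \<Gamma> a b (arrow_elt (double_quiver \<Gamma>) x)"

text \<open>The space $V^t_d$.\<close>

definition preproj_component ::
    "('v, 'e) pre_digraph \<Rightarrow> ('e \<Rightarrow> 'k) \<Rightarrow> ('e \<Rightarrow> 'k) \<Rightarrow> 'v \<Rightarrow> nat
       \<Rightarrow> (('v, 'e + 'e) qpath \<Rightarrow> 'k::field) set set" where
  "preproj_component \<Gamma> a b t d =
     LinearCombinations.module.span class_ring (preproj_algebra \<Gamma> a b)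
       ((\<lambda>p. preproj_class \<Gamma> a b (path_elt p)) `
          {p \<in> qpaths (double_quiver \<Gamma>). fst p = t \<and> path_degree p = d})"

text \<open>The vector space with basis a set \<open>X\<close> of arrows, realised inside the path algebra.\<close>

definition arrow_space :: "('v, 'e) pre_digraph \<Rightarrow> 'e set \<Rightarrow> (('v, 'e) qpath \<Rightarrow> 'k::field) set" where
  "arrow_space Q X =
     LinearCombinations.module.span class_ring (path_algebra Q) (arrow_elt Q ` X)"

abbreviation subspace_dim :: "('k::field, 'a) module \<Rightarrow> 'a set \<Rightarrow> nat" where
  "subspace_dim M V \<equiv> vectorspace.dim class_ring (M\<lparr>carrier := V\<rparr>)"

abbreviation subspace_basis :: "('k::field, 'a) module \<Rightarrow> 'a set \<Rightarrow> 'a set \<Rightarrow> bool" where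
  "subspace_basis M V B \<equiv> vectorspace.basis class_ring (M\<lparr>carrier := V\<rparr>) B"

section \<open>The Zariski topology on a finite product of vector spaces\<close>

text \<open>Polynomial functions in a given set \<open>C\<close> of coordinate functions.\<close>

inductive_set polynomial_functions :: "('x \<Rightarrow> 'k::field) set \<Rightarrow> ('x \<Rightarrow> 'k) set"
  for C :: "('x \<Rightarrow> 'k) set" where
  const: "(\<lambda>x. c) \<in> polynomial_functions C"
| coord: "f \<in> C \<Longrightarrow> f \<in> polynomial_functions C"
| add: "f \<in> polynomial_functions C \<Longrightarrow> g \<in> polynomial_functions C \<Longrightarrow>
          (\<lambda>x. f x + g x) \<in> polynomial_functions C"
| mult: "f \<in> polynomial_functions C \<Longrightarrow> g \<in> polynomial_functions C \<Longrightarrow>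
          (\<lambda>x. f x * g x) \<in> polynomial_functions C"

definition zariski_closed :: "('x \<Rightarrow> 'k::field) set \<Rightarrow> 'x set \<Rightarrow> 'x set \<Rightarrow> bool" where
  "zariski_closed C X Z \<longleftrightarrow>
     (\<exists>S \<subseteq> polynomial_functions C. Z = {x \<in> X. \<forall>f\<in>S. f x = 0})"

definition zariski_topology :: "('x \<Rightarrow> 'k::field) set \<Rightarrow> 'x set \<Rightarrow> 'x topology" where
  "zariski_topology C X = topology (\<lambda>U. U \<subseteq> X \<and> zariski_closed C X (X - U))"

lemma istopology_zariski: "istopology (\<lambda>U. U \<subseteq> X \<and> zariski_closed C X (X - U))"
  unfolding istopology_def
proof (intro conjI allI impI)
  fix S T assume "S \<subseteq> X \<and> zariski_closed C X (X - S)" "T \<subseteq> X \<and> zariski_closed C X (X - T)"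
  then obtain F G where F: "F \<subseteq> polynomial_functions C" "X - S = {x \<in> X. \<forall>f\<in>F. f x = 0}"
    and G: "G \<subseteq> polynomial_functions C" "X - T = {x \<in> X. \<forall>f\<in>G. f x = 0}" and ST: "S \<subseteq> X"
    unfolding zariski_closed_def by auto
  let ?H = "(\<lambda>(f, g) x. f x * g x) ` (F \<times> G)"
  have "?H \<subseteq> polynomial_functions C"
    using F(1) G(1) by (auto intro!: polynomial_functions.mult)
  moreover have "X - S \<inter> T = {x \<in> X. \<forall>h\<in>?H. h x = 0}"
  proof -
    have "X - S \<inter> T = (X - S) \<union> (X - T)" by blast
    also have "\<dots> = {x \<in> X. (\<forall>f\<in>F. f x = 0) \<or> (\<forall>g\<in>G. g x = 0)}"
      unfolding F(2) G(2) by blast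
    also have "\<dots> = {x \<in> X. \<forall>f\<in>F. \<forall>g\<in>G. f x * g x = 0}"
      unfolding mult_eq_0_iff by blast
    also have "\<dots> = {x \<in> X. \<forall>h\<in>?H. h x = 0}" by (simp add: split_beta)
    finally show ?thesis .
  qed
  ultimately show "zariski_closed C X (X - S \<inter> T)" unfolding zariski_closed_def by blast
  show "S \<inter> T \<subseteq> X" using ST by blast
next
  fix K assume K: "\<forall>U\<in>K. U \<subseteq> X \<and> zariski_closed C X (X - U)"
  let ?S = "{f \<in> polynomial_functions C. \<forall>x\<in>X - \<Union>K. f x = 0}"
  have *: "x \<notin> \<Union>K" if x: "x \<in> X" "\<forall>f\<in>?S. f x = 0" for x
  proof
    assume "x \<in> \<Union>K"
    then obtain U where U: "U \<in> K" "x \<in> U" by blast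
    from K U(1) have "zariski_closed C X (X - U)" by simp
    then obtain S where S: "S \<subseteq> polynomial_functions C"
      "X - U = {x \<in> X. \<forall>f\<in>S. f x = 0}"
      unfolding zariski_closed_def by (elim exE conjE)
    from U(2) have "x \<notin> X - U" by simp
    then have "\<not> (\<forall>f\<in>S. f x = 0)" using x(1) S(2) by simp
    then obtain f where f: "f \<in> S" "f x \<noteq> 0" by blast
    have "f y = 0" if "y \<in> X - \<Union>K" for y
    proof -
      from that U(1) have "y \<in> X - U" by blast
      with S(2) f(1) show ?thesis by simp
    qed
    then have "f \<in> ?S" using f(1) S(1) by (simp add: subset_iff)
    with x(2) f(2) show False by simp
  qed
  have "X - \<Union>K = {x \<in> X. \<forall>f\<in>?S. f x = 0}"
  proof (intro Set.set_eqI iffI)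
    fix x assume "x \<in> {x \<in> X. \<forall>f\<in>?S. f x = 0}"
    then have "x \<in> X" "\<forall>f\<in>?S. f x = 0" by simp_all
    with *[OF this] show "x \<in> X - \<Union>K" by simp
  qed simp
  moreover have "?S \<subseteq> polynomial_functions C" by simp
  ultimately show "zariski_closed C X (X - \<Union>K)" unfolding zariski_closed_def by (intro exI conjI)
  show "\<Union>K \<subseteq> X" using K by blast
qed

lemma openin_zariski:
  "openin (zariski_topology C X) U \<longleftrightarrow> U \<subseteq> X \<and> zariski_closed C X (X - U)"
  unfolding zariski_topology_def topology_inverse'[OF istopology_zariski] ..

lemma topspace_zariski: "topspace (zariski_topology C X) = X"
proof -
  have "zariski_closed C X (X - X)"
    unfolding zariski_closed_def
    by (intro exI[of _ "{\<lambda>_. 1}"]) (auto intro: polynomial_functions.const)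
  then have "openin (zariski_topology C X) X" by (simp add: openin_zariski)
  then show ?thesis
    by (meson openin_subset openin_topspace openin_zariski subset_antisym)
qed

definition linear_forms :: "('k::field, 'a) module \<Rightarrow> 'a set \<Rightarrow> ('a \<Rightarrow> 'k) set" where
  "linear_forms M V =
     {\<phi>. (\<forall>x\<in>V. \<forall>y\<in>V. \<phi> (x \<oplus>\<^bsub>M\<^esub> y) = \<phi> x + \<phi> y) \<and> (\<forall>c. \<forall>x\<in>V. \<phi> (c \<odot>\<^bsub>M\<^esub> x) = c * \<phi> x)}"

text \<open>The affine space \<open>\<Prod>\<^sub>x V\<^sub>x\<close> (\<open>x\<close> ranging over \<open>I\<close>) of a family of subspaces of \<open>M\<close>; its
  polynomial functions are those in the linear forms of the factors, so no bases need
  to be chosen.\<close>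

definition affine_space :: "('k::field, 'a) module \<Rightarrow> 'i set \<Rightarrow> ('i \<Rightarrow> 'a set) \<Rightarrow> ('i \<Rightarrow> 'a) topology"
  where
  "affine_space M I V =
     zariski_topology {\<lambda>F. \<phi> (F x) | x \<phi>. x \<in> I \<and> \<phi> \<in> linear_forms M (V x)} (\<Pi>\<^sub>E x\<in>I. V x)"

definition for_general :: "'x topology \<Rightarrow> ('x \<Rightarrow> bool) \<Rightarrow> bool" where
  "for_general X P \<longleftrightarrow>
     (\<exists>U. openin X U \<and> Abstract_Topology.closure_of X U = topspace X \<and> (\<forall>x\<in>U. P x))"

end

theory Submission
  imports Defs "HOL-Library.Function_Algebras"
begin

text \<open>Modulo the mesh relations, every element of $V^t_d$ is a sum of products $F x$ over the arrows $x$
  leaving $t$, so the theorem is about the map $\bigoplus_i V_i \otimes W_i \to V^t_d$. Its essential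
  property is the following: for all subspaces $W'_i \subseteq W_i$, the restriction
  $\bigoplus_i V_i \otimes W'_i \to V^t_d$ is injective or surjective (irreducible maps between
  preprojective modules are mono or epi). This is proved by moving a slice of the translation quiver
  one vertex at a time, as with reflection functors, under the invariant ``injective with a brick as
  cokernel $C$, or surjective''. When the slice is moved at $v$ and the arrows leaving $v$ have no common
  kernel on $C_v$, a diagram chase preserves injectivity and the brick property. Otherwise the
  projections of $C_v$ onto a line of that kernel are endomorphisms of $C$, so the brick $C$ lives
  at $v$ only; it vanishes after the move and the map is surjective from then on.

  Given this dichotomy, take $F$ with every family $F_{i,1}, \dots, F_{i,n_i}$ independent and with a
  largest possible independent subfamily of the products. If a product were missing, it would satisfy
  a linear relation $\nu$ with the subfamily $S$. Replacing $F$ by $F + \epsilon F'$ and using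
  maximality shows that the relation $\nu$ applied to any $F'$ stays in the span of $S$. Hence, for
  the spaces $W'_i$ spanned by the coefficients of $\nu$, the map above is not surjective. So it is
  injective, and independence of the $F_{i,k}$ gives $\nu = 0$, a contradiction. Nonvanishing of a
  determinant then defines the required dense open set.\<close>

section \<open>The mesh ideal and its one-sided presentations\<close>

text \<open>The \<open>induction\<close> method eta-expands function-valued terms, which makes these simp rules
  unfold the vector space operations on functions.\<close>

declare plus_fun_apply [simp del] zero_fun_apply [simp del] minus_apply [simp del]
  uminus_apply [simp del]

text \<open>The two sides of the algebra have different tasks. Right multiplication by combinations
  of arrows leaving \<open>t\<close> is the map under study; left multiplication moves the end point
  of a path. They commute, so the map can be followed from one end point to the next: a position (v,
  j) stands for the paths of degree j ending at v, an arrow \<open>x\<close> leads from (v, j) to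
  (head of x, j + deg x), and \<open>star x\<close> leads on to (v, j + 1). These are the meshes.
  The obstacle is that injectivity alone does not pass from slice to slice: a kernel may appear at
  (v, j + 1) as soon as a nonzero element of the cokernel at (v, j) is killed by every arrow leaving
  that position. The brick condition is carried along to make this event fatal for the rest of the
  cokernel. Most of the work is done with functions on paths modulo the subspace \<open>JJ\<close>;
  quotients, dimensions and bases return only for the translation to the statement.\<close>

definition fscale :: "'k::field \<Rightarrow> ('p \<Rightarrow> 'k) \<Rightarrow> 'p \<Rightarrow> 'k" where
  "fscale c f = (\<lambda>p. c * f p)"

lemma fscale_apply: "fscale c f p = c * f p"
  by (simp add: fscale_def)

lemmas fun_simps = plus_fun_apply zero_fun_apply minus_apply uminus_apply fscale_apply

interpretation fv: vector_space "fscale :: 'k::field \<Rightarrow> ('p \<Rightarrow> 'k) \<Rightarrow> 'p \<Rightarrow> 'k"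
  by standard (auto simp: fun_eq_iff fun_simps algebra_simps)

lemma sum_fun_apply: "(\<Sum>i\<in>I. f i) x = (\<Sum>i\<in>I. f i x)"
  by (induction I rule: infinite_finite_induct) (auto simp: fun_simps)

definition restr :: "'p set \<Rightarrow> ('p \<Rightarrow> 'k::zero) \<Rightarrow> 'p \<Rightarrow> 'k" where
  "restr S f = (\<lambda>p. if p \<in> S then f p else 0)"

definition star :: "'e + 'e \<Rightarrow> 'e + 'e" where
  "star = case_sum Inr Inl"

definition deg :: "'e + 'e \<Rightarrow> int" where
  "deg x = (if isl x then 0 else 1)"

lemma star_simps [simp]: "star (Inl e) = Inr e" "star (Inr e) = Inl e"
  by (simp_all add: star_def)

lemma star_star [simp]: "star (star x) = x"
  by (cases x) auto

lemma star_inject [simp]: "star x = star y \<longleftrightarrow> x = y"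
  by (metis star_star)

lemma deg_simps [simp]: "deg (Inl e) = 0" "deg (Inr e) = 1"
  by (simp_all add: deg_def)

lemma deg_star: "deg (star x) = 1 - deg x"
  by (cases x) auto

lemma path_degree_Nil [simp]: "path_degree (s, []) = 0"
  by (simp add: path_degree_def)

lemma path_degree_Cons: "int (path_degree (s, x # es)) = deg x + int (path_degree (s', es))"
  by (cases x) (simp_all add: path_degree_def)

lemma path_degree_snoc: "int (path_degree (s, es @ [x])) = int (path_degree (s, es)) + deg x"
  by (cases x) (simp_all add: path_degree_def)

locale preproj = fin_digraph \<Gamma> for \<Gamma> :: "('v, 'e) pre_digraph" +
  fixes a b :: "'e \<Rightarrow> 'k::field"
begin

abbreviation Q :: "('v, 'e + 'e) pre_digraph" where "Q \<equiv> double_quiver \<Gamma>"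

abbreviation wk :: "'v \<Rightarrow> ('e + 'e) list \<Rightarrow> 'v \<Rightarrow> bool" where
  "wk \<equiv> pre_digraph.awalk Q"

lemma Q_simps [simp]:
  "verts Q = verts \<Gamma>" "Inl e \<in> arcs Q \<longleftrightarrow> e \<in> arcs \<Gamma>" "Inr e \<in> arcs Q \<longleftrightarrow> e \<in> arcs \<Gamma>"
  "tail Q (Inl e) = tail \<Gamma> e" "tail Q (Inr e) = head \<Gamma> e"
  "head Q (Inl e) = head \<Gamma> e" "head Q (Inr e) = tail \<Gamma> e"
  by (auto simp: double_quiver_def)

lemma star_arc [simp]: "star x \<in> arcs Q \<longleftrightarrow> x \<in> arcs Q"
  by (cases x) auto

lemma tail_star [simp]: "tail Q (star x) = head Q x"
  by (cases x) auto

lemma head_star [simp]: "head Q (star x) = tail Q x"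
  by (cases x) auto

sublocale Q: fin_digraph Q
proof
  fix e assume "e \<in> arcs Q"
  then show "tail Q e \<in> verts Q" "head Q e \<in> verts Q"
    by (cases e; simp)+
next
  show "finite (verts Q)" by simp
  show "finite (arcs Q)"
    by (simp add: double_quiver_def)
qed

lemma arcs_verts [simp]: "x \<in> arcs Q \<Longrightarrow> head Q x \<in> verts \<Gamma>" "x \<in> arcs Q \<Longrightarrow> tail Q x \<in> verts \<Gamma>"
  using Q.wellformed by auto

lemma wk_Nil [simp]: "wk s [] v \<longleftrightarrow> s = v \<and> s \<in> verts \<Gamma>"
  by (simp add: Q.awalk_Nil_iff)

lemma wk_Cons: "wk s (x # es) w \<longleftrightarrow> x \<in> arcs Q \<and> s = tail Q x \<and> wk (head Q x) es w"
  by (rule Q.awalk_Cons_iff)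

lemma wk_append: "wk s (es @ es') w \<longleftrightarrow> (\<exists>v. wk s es v \<and> wk v es' w)"
  by (auto simp: Q.awalk_append_iff)

lemma wk_snoc: "wk s (es @ [x]) w \<longleftrightarrow> x \<in> arcs Q \<and> wk s es (tail Q x) \<and> w = head Q x"
  by (auto simp: wk_append wk_Cons dest: Q.head_in_verts)

lemma wk_unique: "wk s es v \<Longrightarrow> wk s es w \<Longrightarrow> v = w"
  unfolding Q.awalk_conv by auto

lemma wk_verts: "wk s es v \<Longrightarrow> s \<in> verts \<Gamma>" "wk s es v \<Longrightarrow> v \<in> verts \<Gamma>"
  using Q.awalk_hd_in_verts Q.awalk_last_in_verts by fastforce+

lemma qpaths_iff: "(s, es) \<in> qpaths Q \<longleftrightarrow> (\<exists>v. wk s es v)"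
  by (simp add: qpaths_def)

definition gpaths :: "'v \<Rightarrow> 'v \<Rightarrow> int \<Rightarrow> ('v, 'e + 'e) qpath set" where
  "gpaths s v j = {p. fst p = s \<and> wk s (snd p) v \<and> int (path_degree p) = j}"

definition Gr :: "'v \<Rightarrow> 'v \<Rightarrow> int \<Rightarrow> (('v, 'e + 'e) qpath \<Rightarrow> 'k) set" where
  "Gr s v j = {f. \<forall>p. f p \<noteq> 0 \<longrightarrow> p \<in> gpaths s v j}"

text \<open>Left and right multiplication by an arrow. Since \<open>p q\<close> means ``first \<open>q\<close>, then \<open>p\<close>'',
  left multiplication appends the arrow at the end of the list.\<close>

definition L :: "'e + 'e \<Rightarrow> (('v, 'e + 'e) qpath \<Rightarrow> 'k) \<Rightarrow> ('v, 'e + 'e) qpath \<Rightarrow> 'k" where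
  "L x f = (\<lambda>p. if p \<in> qpaths Q \<and> snd p \<noteq> [] \<and> last (snd p) = x
                then f (fst p, butlast (snd p)) else 0)"

definition R :: "'e + 'e \<Rightarrow> (('v, 'e + 'e) qpath \<Rightarrow> 'k) \<Rightarrow> ('v, 'e + 'e) qpath \<Rightarrow> 'k" where
  "R x f = (\<lambda>p. if p \<in> qpaths Q \<and> snd p \<noteq> [] \<and> hd (snd p) = x
                then f (head Q x, tl (snd p)) else 0)"

text \<open>\<open>cf x\<close> is the coefficient of the word traversing \<open>x\<close> first and
  \<open>star x\<close> second. With the sign built in, the two sums of a mesh relation become one
  sum over all arrows of the double quiver leaving the vertex.\<close>

definition cf :: "'e + 'e \<Rightarrow> 'k" where
  "cf = case_sum a (\<lambda>e. - b e)"

text \<open>The product $p\, m_v\, q$, where \<open>q\<close> is the path \<open>es\<close> from \<open>s\<close> to \<open>v\<close> and \<open>p\<close> is the path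
  \<open>es'\<close> starting at \<open>v\<close>.\<close>

definition mesh_word ::
    "'v \<Rightarrow> ('e + 'e) list \<Rightarrow> 'v \<Rightarrow> ('e + 'e) list \<Rightarrow> ('v, 'e + 'e) qpath \<Rightarrow> 'k" where
  "mesh_word s es v es' =
     (\<Sum>x | x \<in> arcs Q \<and> tail Q x = v. fscale (cf x) (path_elt (s, es @ [x, star x] @ es')))"

text \<open>The ideal $J$, described as a span so that gradings and one-sided decompositions can be read off
  the generators; see \<open>preproj_ideal_eq\<close> below.\<close>

definition JJ :: "(('v, 'e + 'e) qpath \<Rightarrow> 'k) set" where
  "JJ = fv.span {mesh_word s es v es' | s es v es' w. wk s es v \<and> wk v es' w}"

lemma L_linear: "L x (f + g) = L x f + L x g" "L x (fscale c f) = fscale c (L x f)"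
  "L x 0 = 0" "L x (f - g) = L x f - L x g" "L x (- f) = - L x f"
  by (auto simp: L_def fun_eq_iff fun_simps)

lemma L_sum: "L x (\<Sum>i\<in>I. f i) = (\<Sum>i\<in>I. L x (f i))"
  by (induction I rule: infinite_finite_induct) (auto simp: L_linear)

lemma R_linear: "R x (f + g) = R x f + R x g" "R x (fscale c f) = fscale c (R x f)"
  "R x 0 = 0" "R x (f - g) = R x f - R x g" "R x (- f) = - R x f"
  by (auto simp: R_def fun_eq_iff fun_simps)

lemma R_sum: "R x (\<Sum>i\<in>I. f i) = (\<Sum>i\<in>I. R x (f i))"
  by (induction I rule: infinite_finite_induct) (auto simp: R_linear)

text \<open>The operators act at opposite ends of the arrow list. Both sides vanish unless the list
  starts with \<open>y\<close> and ends with \<open>x\<close> at two different positions; a list of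
  one arrow gives 0 even if \<open>x = y\<close>.\<close>

lemma L_R_commute: "L x (R y f) = R y (L x f)"
proof
  fix p :: "('v, 'e + 'e) qpath"
  obtain s es where p: "p = (s, es)" by fastforce
  show "L x (R y f) p = R y (L x f) p"
  proof (cases "\<exists>es'. es = y # es' @ [x]")
    case True
    then obtain es' where "es = y # es' @ [x]" by blast
    moreover have "(\<exists>v. wk s (y # es' @ [x]) v) \<Longrightarrow> (\<exists>v. wk s (y # es') v) \<and> (\<exists>v. wk (head Q y) (es' @ [x]) v)"
      by (auto simp: wk_Cons wk_append)
    ultimately show ?thesis
      by (auto simp: p L_def R_def qpaths_iff)
  next
    case False
    then have "\<not> (es \<noteq> [] \<and> last es = x \<and> butlast es \<noteq> [] \<and> hd (butlast es) = y)"
      by (metis append_butlast_last_id append_Cons list.collapse)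
    moreover have "\<not> (es \<noteq> [] \<and> hd es = y \<and> tl es \<noteq> [] \<and> last (tl es) = x)"
      using False by (metis append_butlast_last_id list.collapse)
    ultimately show ?thesis
      by (auto simp: p L_def R_def)
  qed
qed

lemma L_path_elt: "L x (path_elt (s, es)) = (if \<exists>w. wk s (es @ [x]) w then path_elt (s, es @ [x]) else 0)"
proof
  fix p :: "('v, 'e + 'e) qpath"
  obtain s' es' where "p = (s', es')" by fastforce
  then show "L x (path_elt (s, es)) p = (if \<exists>w. wk s (es @ [x]) w then path_elt (s, es @ [x]) else 0) p"
    by (cases es' rule: rev_cases) (auto simp: L_def path_elt_def qpaths_iff fun_simps)
qed

lemma R_path_elt: "R x (path_elt (s, es)) =
  (if s = head Q x \<and> (\<exists>w. wk (tail Q x) (x # es) w) then path_elt (tail Q x, x # es) else 0)"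
  by (auto simp: R_def path_elt_def qpaths_iff fun_eq_iff fun_simps wk_Cons neq_Nil_conv)

text \<open>All summands of a mesh word end at the same vertex, so a further arrow extends all of
  them or none.\<close>

lemma L_mesh_word:
  assumes "wk s es v" "wk v es' w"
  shows "L x (mesh_word s es v es') = (if x \<in> arcs Q \<and> tail Q x = w then mesh_word s es v (es' @ [x]) else 0)"
proof -
  have "wk s (es @ y # star y # es' @ [x]) u \<longleftrightarrow> x \<in> arcs Q \<and> tail Q x = w \<and> u = head Q x"
    if "y \<in> arcs Q" "tail Q y = v" for y u
    using assms that by (auto simp: wk_append wk_Cons wk_verts dest: wk_unique Q.head_in_verts)
  then show ?thesis
    by (auto simp: mesh_word_def L_sum L_linear L_path_elt intro!: sum.cong)
qed

lemma R_mesh_word: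
  assumes "wk s es v" "wk v es' w"
  shows "R x (mesh_word s es v es') =
    (if x \<in> arcs Q \<and> head Q x = s then mesh_word (tail Q x) (x # es) v es' else 0)"
proof -
  have "(\<exists>u. wk (tail Q x) (x # es @ y # star y # es') u) = (x \<in> arcs Q)"
    if "y \<in> arcs Q" "tail Q y = v" "head Q x = s" for y
    using assms that by (auto simp: wk_append wk_Cons)
  moreover have "\<not> wk u (x # es'') u'" if "x \<notin> arcs Q" for es'' u u'
    using that by (simp add: wk_Cons)
  ultimately show ?thesis
    by (auto simp: mesh_word_def R_sum R_linear R_path_elt intro!: sum.cong sum.neutral)
qed

lemma mesh_word_JJ: "wk s es v \<Longrightarrow> wk v es' w \<Longrightarrow> mesh_word s es v es' \<in> JJ"
  unfolding JJ_def by (intro fv.span_base) blast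

lemma JJ_induct [consumes 1, case_names zero step]:
  assumes "f \<in> JJ" "P 0"
    and "\<And>c s es v es' w g. wk s es v \<Longrightarrow> wk v es' w \<Longrightarrow> g \<in> JJ \<Longrightarrow> P g \<Longrightarrow>
          P (fscale c (mesh_word s es v es') + g)"
  shows "P f"
proof -
  have "f \<in> JJ \<and> P f"
    using assms(1)[unfolded JJ_def]
  proof (induction rule: fv.span_induct_alt)
    case base
    then show ?case using assms(2) by (simp add: JJ_def fv.span_zero)
  next
    case (step c x y)
    then obtain s es v es' w where x: "x = mesh_word s es v es'" "wk s es v" "wk v es' w"
      by blast
    have "fscale c x + y \<in> JJ"
      using step x mesh_word_JJ unfolding JJ_def
      by (metis (no_types, lifting) fv.span_add fv.span_scale)
    then show ?case using assms(3) x step by blast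
  qed
  then show ?thesis ..
qed

lemma JJ_subspace: "fv.subspace JJ"
  by (simp add: JJ_def)

lemmas JJ_zero [simp] = fv.subspace_0[OF JJ_subspace]
  and JJ_add = fv.subspace_add[OF JJ_subspace]
  and JJ_scale = fv.subspace_scale[OF JJ_subspace]
  and JJ_diff = fv.subspace_diff[OF JJ_subspace]
  and JJ_neg = fv.subspace_neg[OF JJ_subspace]
  and JJ_sum = fv.subspace_sum[OF JJ_subspace]

lemma L_JJ: "f \<in> JJ \<Longrightarrow> L x f \<in> JJ"
proof (induction rule: JJ_induct)
  case (step c s es v es' w g)
  have "L x (mesh_word s es v es') \<in> JJ"
    using L_mesh_word[OF step(1,2), of x] mesh_word_JJ[OF step(1), of "es' @ [x]" "head Q x"] step(2)
    by (cases "x \<in> arcs Q \<and> tail Q x = w") (auto simp: wk_Cons)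
  then show ?case using step by (simp add: L_linear JJ_add JJ_scale)
qed (simp add: L_linear)

lemma R_JJ: "f \<in> JJ \<Longrightarrow> R x f \<in> JJ"
proof (induction rule: JJ_induct)
  case (step c s es v es' w g)
  have "R x (mesh_word s es v es') \<in> JJ"
    using R_mesh_word[OF step(1,2), of x] mesh_word_JJ[of "tail Q x" "x # es" v es' w] step(1,2)
    by (auto simp: wk_Cons)
  then show ?case using step by (simp add: R_linear JJ_add JJ_scale)
qed (simp add: R_linear)

lemma restr_linear: "restr S (f + g) = restr S f + restr S g" "restr S (fscale c f) = fscale c (restr S f)"
  "restr S 0 = 0" "restr S (f - g) = restr S f - restr S g"
  by (auto simp: restr_def fun_eq_iff fun_simps)

lemma restr_sum: "restr S (\<Sum>i\<in>I. f i) = (\<Sum>i\<in>I. restr S (f i))"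
  by (auto simp: restr_def fun_eq_iff fun_simps sum_fun_apply)

lemma restr_path_elt: "restr S (path_elt p) = (if p \<in> S then path_elt p else 0)"
  by (auto simp: restr_def path_elt_def fun_eq_iff fun_simps)

text \<open>\<open>JJ\<close> is graded by start, end and degree: exactly one of \<open>x\<close>
  and \<open>star x\<close> is new, so all terms of a mesh word have the same data, and truncation
  keeps the word or kills it.\<close>

lemma restr_JJ: "f \<in> JJ \<Longrightarrow> restr (gpaths s v j) f \<in> JJ"
proof (induction rule: JJ_induct)
  case (step c s' es u es' w g)
  have *: "(s', es @ [x, star x] @ es') \<in> gpaths s v j \<longleftrightarrow>
        s' = s \<and> w = v \<and> j = int (path_degree (s, es)) + 1 + int (path_degree (s, es'))"
    if "x \<in> arcs Q" "tail Q x = u" for x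
  proof -
    have "wk s' (es @ [x, star x] @ es') w' \<longleftrightarrow> w' = w" for w'
      using step(1,2) that by (auto simp: wk_append wk_Cons dest: wk_unique)
    moreover have "int (path_degree (s', es @ [x, star x] @ es')) =
        int (path_degree (s, es)) + 1 + int (path_degree (s, es'))"
      by (cases x) (auto simp: path_degree_def)
    ultimately show ?thesis by (auto simp: gpaths_def)
  qed
  have "restr (gpaths s v j) (mesh_word s' es u es') =
    (if s' = s \<and> w = v \<and> j = int (path_degree (s, es)) + 1 + int (path_degree (s, es'))
     then mesh_word s' es u es' else 0)"
    using * by (auto simp: mesh_word_def restr_sum restr_linear restr_path_elt intro!: sum.cong sum.neutral)
  then show ?case using step mesh_word_JJ[OF step(1,2)] by (auto simp: restr_linear JJ_add JJ_scale)
qed (simp add: restr_linear)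

text \<open>A mesh word whose relation is followed by further arrows has a common last arrow
  \<open>y\<close>, hence is \<open>L y\<close> of a shorter mesh word. The words with the relation
  at the very end are collected in \<open>z\<close>.\<close>

lemma JJ_left:
  assumes "f \<in> JJ"
  shows "\<exists>g z. (\<forall>x. g x \<in> JJ) \<and>
    f = (\<Sum>x\<in>arcs Q. L x (g x)) + (\<Sum>x\<in>arcs Q. fscale (cf x) (L (star x) (L x z)))"
  using assms
proof (induction rule: JJ_induct)
  case zero
  show ?case by (intro exI[of _ "\<lambda>_. 0"] exI[of _ 0]) (simp add: L_linear)
next
  case (step c s es v es' w h)
  from step(4) obtain g z where g: "\<And>x. g x \<in> JJ"
    and h: "h = (\<Sum>x\<in>arcs Q. L x (g x)) + (\<Sum>x\<in>arcs Q. fscale (cf x) (L (star x) (L x z)))"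
    by blast
  show ?case
  proof (cases es' rule: rev_cases)
    case Nil
    have "mesh_word s es v es' = (\<Sum>x | x \<in> arcs Q \<and> tail Q x = v. fscale (cf x) (L (star x) (L x (path_elt (s, es)))))"
      unfolding mesh_word_def using step(1)
      by (intro sum.cong) (auto simp: Nil L_path_elt wk_append wk_Cons)
    \<comment> \<open>Arrows that do not start at \<open>v\<close> contribute 0. Summing over all
      arrows allows one \<open>z\<close> to collect paths with different end points.\<close>
    also have "\<dots> = (\<Sum>x \<in> arcs Q. fscale (cf x) (L (star x) (L x (path_elt (s, es)))))"
      using step(1) by (intro sum.mono_neutral_left)
        (auto simp: L_path_elt wk_append wk_Cons L_linear dest: wk_unique)
    finally have mw: "mesh_word s es v es' = (\<Sum>x \<in> arcs Q. fscale (cf x) (L (star x) (L x (path_elt (s, es)))))" .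
    define z' where "z' = fscale c (path_elt (s, es)) + z"
    have "(\<Sum>x\<in>arcs Q. fscale (cf x) (L (star x) (L x z'))) =
        fscale c (mesh_word s es v es') + (\<Sum>x\<in>arcs Q. fscale (cf x) (L (star x) (L x z)))"
      unfolding mw by (simp add: z'_def L_linear sum.distrib fv.scale_sum_right fv.scale_right_distrib mult.commute)
    then have "fscale c (mesh_word s es v es') + h =
        (\<Sum>x\<in>arcs Q. L x (g x)) + (\<Sum>x\<in>arcs Q. fscale (cf x) (L (star x) (L x z')))"
      by (simp add: h)
    then show ?thesis using g by blast
  next
    case (snoc es'' y)
    have y: "y \<in> arcs Q" "tail Q y = tail Q y" "wk v es'' (tail Q y)"
      using step(2) snoc by (auto simp: wk_snoc)
    have "mesh_word s es v es' = L y (mesh_word s es v es'')"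
      using L_mesh_word[OF step(1) y(3)] y snoc by simp
    also have "\<dots> = (\<Sum>x\<in>arcs Q. if x = y then L x (mesh_word s es v es'') else 0)"
      using y by simp
    also have "\<dots> = (\<Sum>x\<in>arcs Q. L x (if x = y then mesh_word s es v es'' else 0))"
      by (intro sum.cong) (auto simp: L_linear)
    finally have mw: "mesh_word s es v es' =
        (\<Sum>x\<in>arcs Q. L x (if x = y then mesh_word s es v es'' else 0))" .
    define g' where "g' x = fscale c (if x = y then mesh_word s es v es'' else 0) + g x" for x
    have "(\<Sum>x\<in>arcs Q. L x (g' x)) = fscale c (mesh_word s es v es') + (\<Sum>x\<in>arcs Q. L x (g x))"
      unfolding mw fv.scale_sum_right g'_def L_linear sum.distrib ..
    then have "fscale c (mesh_word s es v es') + h =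
        (\<Sum>x\<in>arcs Q. L x (g' x)) + (\<Sum>x\<in>arcs Q. fscale (cf x) (L (star x) (L x z)))"
      by (simp add: h)
    moreover have "\<forall>x. g' x \<in> JJ"
      using g mesh_word_JJ[OF step(1) y(3)] by (simp add: g'_def JJ_add JJ_scale)
    ultimately show ?thesis by blast
  qed
qed

text \<open>Mirror image of \<open>JJ_left\<close>, splitting off the first arrow. Since
  \<open>R\<close> prepends, \<open>R x (R (star x) z)\<close> begins with \<open>x\<close>, and the
  coefficient still belongs to the arrow traversed first.\<close>

lemma JJ_right:
  assumes "f \<in> JJ"
  shows "\<exists>g z. (\<forall>x. g x \<in> JJ) \<and>
    f = (\<Sum>x\<in>arcs Q. R x (g x)) + (\<Sum>x\<in>arcs Q. fscale (cf x) (R x (R (star x) z)))"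
  using assms
proof (induction rule: JJ_induct)
  case zero
  show ?case by (intro exI[of _ "\<lambda>_. 0"] exI[of _ 0]) (simp add: R_linear)
next
  case (step c s es v es' w h)
  from step(4) obtain g z where g: "\<And>x. g x \<in> JJ"
    and h: "h = (\<Sum>x\<in>arcs Q. R x (g x)) + (\<Sum>x\<in>arcs Q. fscale (cf x) (R x (R (star x) z)))"
    by blast
  show ?case
  proof (cases es)
    case Nil
    have "mesh_word s es v es' = (\<Sum>x | x \<in> arcs Q \<and> tail Q x = v. fscale (cf x) (R x (R (star x) (path_elt (v, es')))))"
      unfolding mesh_word_def using step(1,2)
      by (intro sum.cong) (auto simp: Nil R_path_elt wk_Cons)
    also have "\<dots> = (\<Sum>x \<in> arcs Q. fscale (cf x) (R x (R (star x) (path_elt (v, es')))))"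
      using step(1,2) by (intro sum.mono_neutral_left) (auto simp: R_path_elt wk_Cons R_linear)
    finally have mw: "mesh_word s es v es' = (\<Sum>x \<in> arcs Q. fscale (cf x) (R x (R (star x) (path_elt (v, es')))))" .
    define z' where "z' = fscale c (path_elt (v, es')) + z"
    have "(\<Sum>x\<in>arcs Q. fscale (cf x) (R x (R (star x) z'))) =
        fscale c (mesh_word s es v es') + (\<Sum>x\<in>arcs Q. fscale (cf x) (R x (R (star x) z)))"
      unfolding mw by (simp add: z'_def R_linear sum.distrib fv.scale_sum_right fv.scale_right_distrib mult.commute)
    then have "fscale c (mesh_word s es v es') + h =
        (\<Sum>x\<in>arcs Q. R x (g x)) + (\<Sum>x\<in>arcs Q. fscale (cf x) (R x (R (star x) z')))"
      by (simp add: h)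
    then show ?thesis using g by blast
  next
    case (Cons y es'')
    have y: "y \<in> arcs Q" "s = tail Q y" "wk (head Q y) es'' v"
      using step(1) Cons by (auto simp: wk_Cons)
    have "mesh_word s es v es' = R y (mesh_word (head Q y) es'' v es')"
      using R_mesh_word[OF y(3) step(2)] y Cons by simp
    also have "\<dots> = (\<Sum>x\<in>arcs Q. if x = y then R x (mesh_word (head Q y) es'' v es') else 0)"
      using y by simp
    also have "\<dots> = (\<Sum>x\<in>arcs Q. R x (if x = y then mesh_word (head Q y) es'' v es' else 0))"
      by (intro sum.cong) (auto simp: R_linear)
    finally have mw: "mesh_word s es v es' =
        (\<Sum>x\<in>arcs Q. R x (if x = y then mesh_word (head Q y) es'' v es' else 0))" .
    define g' where "g' x = fscale c (if x = y then mesh_word (head Q y) es'' v es' else 0) + g x" for x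
    have "(\<Sum>x\<in>arcs Q. R x (g' x)) = fscale c (mesh_word s es v es') + (\<Sum>x\<in>arcs Q. R x (g x))"
      unfolding mw fv.scale_sum_right g'_def R_linear sum.distrib ..
    then have "fscale c (mesh_word s es v es') + h =
        (\<Sum>x\<in>arcs Q. R x (g' x)) + (\<Sum>x\<in>arcs Q. fscale (cf x) (R x (R (star x) z)))"
      by (simp add: h)
    moreover have "\<forall>x. g' x \<in> JJ"
      using g mesh_word_JJ[OF y(3) step(2)] by (simp add: g'_def JJ_add JJ_scale)
    ultimately show ?thesis by blast
  qed
qed

end

section \<open>Numbering of the vertices and finiteness of the graded pieces\<close>

lemma topological_numbering:
  fixes r :: "('a \<times> 'a) set"
  assumes "finite V" "acyclic r"
  shows "\<exists>f. bij_betw f V {..<card V} \<and> (\<forall>(u, v)\<in>r. u \<in> V \<longrightarrow> v \<in> V \<longrightarrow> f u < f v)"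
  using assms(1)
proof (induction "card V" arbitrary: V)
  case 0
  then show ?case by (auto simp: bij_betw_def)
next
  case (Suc n)
  let ?r = "r \<inter> V \<times> V"
  have "finite ?r" "acyclic ?r"
    using Suc.prems assms(2) by (auto intro: acyclic_subset)
  then have wf: "wf (?r\<inverse>)"
    by (rule finite_acyclic_wf_converse)
  obtain v where "v \<in> V" using Suc.hyps(2) by fastforce
  \<comment> \<open>\<open>m\<close> has no successor inside \<open>V\<close>, so it can receive the
    largest number.\<close>
  from wfE_min[OF wf this] obtain m where m: "m \<in> V" "\<And>v. (v, m) \<in> ?r\<inverse> \<Longrightarrow> v \<notin> V"
    by metis
  have card: "card (V - {m}) = n" using Suc.hyps(2) Suc.prems m(1) by simp
  from Suc.hyps(1)[of "V - {m}"] card Suc.prems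
  obtain f where f: "bij_betw f (V - {m}) {..<n}"
    "\<And>u v. (u, v) \<in> r \<Longrightarrow> u \<in> V - {m} \<Longrightarrow> v \<in> V - {m} \<Longrightarrow> f u < f v"
    by auto
  define g where "g = f(m := n)"
  have "inj_on g V"
    using f(1) by (auto simp: inj_on_def g_def bij_betw_def image_def)
  moreover have "g ` V = insert n (f ` (V - {m}))"
    using m(1) by (auto simp: g_def)
  then have "g ` V = {..<Suc n}"
    using f(1) by (auto simp: bij_betw_def lessThan_Suc)
  ultimately have "bij_betw g V {..<Suc n}" by (simp add: bij_betw_def)
  moreover have "g u < g v" if "(u, v) \<in> r" "u \<in> V" "v \<in> V" for u v
  proof -
    have "u \<noteq> m" using m that by blast
    then show ?thesis
      using f that bij_betw_apply[OF f(1), of u] by (cases "v = m") (auto simp: g_def)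
  qed
  ultimately show ?case using Suc.hyps(2) by auto
qed

locale acyclic_preproj = preproj \<Gamma> a b
  for \<Gamma> :: "('v, 'e) pre_digraph" and a b :: "'e \<Rightarrow> 'k::field" +
  assumes acyclic: "acyclic_quiver \<Gamma>"
    and nonzero_coeffs: "\<And>\<gamma>. \<gamma> \<in> arcs \<Gamma> \<Longrightarrow> a \<gamma> \<noteq> 0 \<and> b \<gamma> \<noteq> 0"
begin

abbreviation nv :: nat where "nv \<equiv> card (verts \<Gamma>)"

lemma ex_numbering:
  "\<exists>f. bij_betw f (verts \<Gamma>) {..<nv} \<and> (\<forall>\<gamma>\<in>arcs \<Gamma>. f (tail \<Gamma> \<gamma>) < f (head \<Gamma> \<gamma>))"
proof -
  let ?r = "(\<lambda>\<gamma>. (tail \<Gamma> \<gamma>, head \<Gamma> \<gamma>)) ` arcs \<Gamma>"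
  have walk: "\<exists>p. awalk u p v \<and> p \<noteq> []" if "(u, v) \<in> ?r\<^sup>+" for u v
    using that
  proof (induction rule: trancl_induct)
    case (base y)
    then obtain \<gamma> where "\<gamma> \<in> arcs \<Gamma>" "u = tail \<Gamma> \<gamma>" "y = head \<Gamma> \<gamma>" by blast
    then have "awalk u [\<gamma>] y" by (simp add: awalk_Cons_iff awalk_Nil_iff)
    then show ?case by blast
  next
    case (step y z)
    then obtain \<gamma> p where "\<gamma> \<in> arcs \<Gamma>" "y = tail \<Gamma> \<gamma>" "z = head \<Gamma> \<gamma>" "awalk u p y" by blast
    then have "awalk u (p @ [\<gamma>]) z" by (auto simp: awalk_append_iff awalk_Cons_iff awalk_Nil_iff)
    then show ?case by blast
  qed
  have "acyclic ?r"
  proof (rule acyclicI, intro allI notI)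
    fix u assume "(u, u) \<in> ?r\<^sup>+"
    then obtain p where "awalk u p u" "p \<noteq> []" using walk by blast
    then have "closed_w p" by (auto simp: closed_w_def)
    then show False using closed_w_imp_cycle acyclic by (auto simp: acyclic_quiver_def)
  qed
  from topological_numbering[OF finite_verts this] show ?thesis by fastforce
qed

definition pos :: "'v \<Rightarrow> nat" where
  "pos v = (if v \<in> verts \<Gamma> then (SOME f. bij_betw f (verts \<Gamma>) {..<nv} \<and>
     (\<forall>\<gamma>\<in>arcs \<Gamma>. f (tail \<Gamma> \<gamma>) < f (head \<Gamma> \<gamma>))) v else 0)"

lemma pos_bij: "bij_betw pos (verts \<Gamma>) {..<nv}"
  and pos_less: "\<gamma> \<in> arcs \<Gamma> \<Longrightarrow> pos (tail \<Gamma> \<gamma>) < pos (head \<Gamma> \<gamma>)"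
proof -
  define f where "f = (SOME f. bij_betw f (verts \<Gamma>) {..<nv} \<and> (\<forall>\<gamma>\<in>arcs \<Gamma>. f (tail \<Gamma> \<gamma>) < f (head \<Gamma> \<gamma>)))"
  have f: "bij_betw f (verts \<Gamma>) {..<nv} \<and> (\<forall>\<gamma>\<in>arcs \<Gamma>. f (tail \<Gamma> \<gamma>) < f (head \<Gamma> \<gamma>))"
    using someI_ex[OF ex_numbering] unfolding f_def .
  have eq: "pos v = f v" if "v \<in> verts \<Gamma>" for v
    using that by (simp add: pos_def f_def)
  show "bij_betw pos (verts \<Gamma>) {..<nv}"
    using f eq by (metis bij_betw_cong)
  show "pos (tail \<Gamma> \<gamma>) < pos (head \<Gamma> \<gamma>)" if "\<gamma> \<in> arcs \<Gamma>"
    using f eq that by simp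
qed

lemma pos_bound: "v \<in> verts \<Gamma> \<Longrightarrow> pos v < nv"
  using pos_bij by (auto simp: bij_betw_def)

lemma no_loop: "x \<in> arcs Q \<Longrightarrow> head Q x \<noteq> tail Q x"
  using pos_less by (cases x) fastforce+

lemma cf_nonzero: "x \<in> arcs Q \<Longrightarrow> cf x \<noteq> 0"
  using nonzero_coeffs by (cases x) (auto simp: cf_def)

text \<open>The quantity \<open>nv\<close> times degree plus \<open>pos\<close> grows by at least 1
  along every arrow: an old arrow raises \<open>pos\<close>, and a new one lowers it by less than
  \<open>nv\<close> while the degree term adds \<open>nv\<close>. Hence only finitely many paths
  have a given degree.\<close>

lemma wk_length: "wk s es v \<Longrightarrow> int (length es) \<le> int nv * int (path_degree (s, es)) + int (pos v) - int (pos s)"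
proof (induction es arbitrary: s)
  case (Cons x es)
  then have x: "x \<in> arcs Q" "s = tail Q x" "wk (head Q x) es v" by (auto simp: wk_Cons)
  have "int (length es) \<le> int nv * int (path_degree (head Q x, es)) + int (pos v) - int (pos (head Q x))"
    using Cons.IH x by blast
  moreover have "int (pos (tail Q x)) + 1 \<le> int nv * deg x + int (pos (head Q x))"
  proof (cases x)
    case (Inl \<gamma>)
    then show ?thesis using x pos_less[of \<gamma>] by simp
  next
    case (Inr \<gamma>)
    then show ?thesis using x pos_bound[of "tail Q x"] by simp
  qed
  ultimately show ?case
    using x(2) path_degree_Cons[of s x es "head Q x"] by (simp add: algebra_simps)
qed simp

lemma finite_gpaths: "finite (gpaths s v j)"
proof -
  have "gpaths s v j \<subseteq> {s} \<times> {es. set es \<subseteq> arcs Q \<and> length es \<le> nat (int nv * j + int (pos v))}"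
  proof
    fix p assume "p \<in> gpaths s v j"
    then have p: "fst p = s" "wk s (snd p) v" "int (path_degree p) = j" by (auto simp: gpaths_def)
    then have "int (length (snd p)) \<le> int nv * j + int (pos v)"
      using wk_length[OF p(2)] by (simp add: path_degree_def)
    moreover have "set (snd p) \<subseteq> arcs Q" using p(2) by auto
    ultimately show "p \<in> {s} \<times> {es. set es \<subseteq> arcs Q \<and> length es \<le> nat (int nv * j + int (pos v))}"
      using p(1) by (cases p) auto
  qed
  then show ?thesis
    by (rule finite_subset) (intro finite_cartesian_product finite_lists_length_le; simp)
qed

lemma Gr_subspace: "fv.subspace (Gr s v j)"
  by (rule fv.subspaceI) (auto simp: Gr_def fun_simps dest: add_nonneg_eq_0_iff; metis add_0)+

lemmas Gr_zero [simp] = fv.subspace_0[OF Gr_subspace]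
  and Gr_add = fv.subspace_add[OF Gr_subspace]
  and Gr_scale = fv.subspace_scale[OF Gr_subspace]
  and Gr_diff = fv.subspace_diff[OF Gr_subspace]
  and Gr_sum = fv.subspace_sum[OF Gr_subspace]

lemma Gr_expand: "f \<in> Gr s v j \<Longrightarrow> f = (\<Sum>p\<in>gpaths s v j. fscale (f p) (path_elt p))"
  using finite_gpaths[of s v j]
  by (auto simp: fun_eq_iff sum_fun_apply fun_simps Gr_def path_elt_def if_distrib[of "\<lambda>x. _ * x"] cong: if_cong)

lemma restr_Gr [simp]: "restr (gpaths s v j) f \<in> Gr s v j"
  by (simp add: Gr_def restr_def)

lemma restr_id: "f \<in> Gr s v j \<Longrightarrow> restr (gpaths s v j) f = f"
  by (auto simp: Gr_def restr_def fun_eq_iff)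

lemma gpaths_snoc:
  "(s', es @ [x]) \<in> gpaths s w j \<longleftrightarrow> x \<in> arcs Q \<and> w = head Q x \<and> (s', es) \<in> gpaths s (tail Q x) (j - deg x)"
  using wk_snoc[of s es x w] path_degree_snoc[of s' es x] by (auto simp: gpaths_def simp del: Q.awalk_append_iff)

lemma gpaths_Cons:
  "(s', x # es) \<in> gpaths s w j \<longleftrightarrow>
     x \<in> arcs Q \<and> s' = s \<and> s = tail Q x \<and> (head Q x, es) \<in> gpaths (head Q x) w (j - deg x)"
  using wk_Cons[of s x es w] path_degree_Cons[of s' x es "head Q x"] by (auto simp: gpaths_def)

lemma gpaths_Nil: "(s', []) \<in> gpaths s w j \<longleftrightarrow> s' = s \<and> w = s \<and> s \<in> verts \<Gamma> \<and> j = 0"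
  by (auto simp: gpaths_def)

lemma gpaths_qpaths: "p \<in> gpaths s w j \<Longrightarrow> p \<in> qpaths Q"
  by (cases p) (auto simp: gpaths_def qpaths_iff)

lemma qpaths_snoc_iff:
  "p \<in> gpaths s (tail Q x) j \<Longrightarrow> x \<in> arcs Q \<Longrightarrow> (fst p, snd p @ [x]) \<in> qpaths Q"
  by (cases p) (auto intro!: gpaths_qpaths[of _ s "head Q x" "j + deg x"] simp: gpaths_snoc)

lemma qpaths_Cons_iff:
  "p \<in> gpaths (head Q x) w j \<Longrightarrow> x \<in> arcs Q \<Longrightarrow> (tail Q x, x # snd p) \<in> qpaths Q"
  by (rule gpaths_qpaths[of _ "tail Q x" w "j + deg x"]) (cases p, auto simp: gpaths_Cons, auto simp: gpaths_def)

lemma L_restr: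
  assumes "x \<in> arcs Q" "j' = j + deg x"
  shows "restr (gpaths s (head Q x) j') (L x f) = L x (restr (gpaths s (tail Q x) j) f)"
proof
  fix p :: "('v, 'e + 'e) qpath"
  obtain s' es where p: "p = (s', es)" by fastforce
  show "restr (gpaths s (head Q x) j') (L x f) p = L x (restr (gpaths s (tail Q x) j) f) p"
  proof (cases es rule: rev_cases)
    case (snoc ys y)
    then show ?thesis using assms by (auto simp: p restr_def L_def gpaths_snoc)
  qed (simp add: p restr_def L_def)
qed

lemma R_restr:
  assumes "x \<in> arcs Q" "j' = j + deg x"
  shows "restr (gpaths (tail Q x) v j') (R x f) = R x (restr (gpaths (head Q x) v j) f)"
proof
  fix p :: "('v, 'e + 'e) qpath"
  obtain s' es where p: "p = (s', es)" by fastforce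
  show "restr (gpaths (tail Q x) v j') (R x f) p = R x (restr (gpaths (head Q x) v j) f) p"
  proof (cases es)
    case (Cons y ys)
    show ?thesis
    proof (cases "y = x \<and> p \<in> qpaths Q")
      case True
      then have "s' = tail Q x" by (auto simp: p Cons qpaths_iff wk_Cons)
      then show ?thesis using True assms by (simp add: p Cons restr_def R_def gpaths_Cons)
    next
      case False
      then have "R x g p = 0" for g by (auto simp: p Cons R_def)
      then show ?thesis by (simp add: restr_def)
    qed
  qed (simp add: p restr_def R_def)
qed

lemma L_Gr:
  assumes "x \<in> arcs Q" "f \<in> Gr s (tail Q x) j" "j' = j + deg x"
  shows "L x f \<in> Gr s (head Q x) j'"
  using L_restr[OF assms(1,3), of s f] restr_Gr[of s "head Q x" j' "L x f"] restr_id[OF assms(2)] by simp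

lemma R_Gr:
  assumes "x \<in> arcs Q" "f \<in> Gr (head Q x) v j" "j' = j + deg x"
  shows "R x f \<in> Gr (tail Q x) v j'"
  using R_restr[OF assms(1,3), of v f] restr_Gr[of "tail Q x" v j' "R x f"] restr_id[OF assms(2)] by simp

section \<open>Generation and exactness at the mesh of a vertex\<close>

abbreviation Out :: "'v \<Rightarrow> ('e + 'e) set" where
  "Out v \<equiv> {x \<in> arcs Q. tail Q x = v}"

lemma L_eval: "(s, es @ [x]) \<in> qpaths Q \<Longrightarrow> L y f (s, es @ [x]) = (if y = x then f (s, es) else 0)"
  by (auto simp: L_def)

lemma R_eval: "(s, x # es) \<in> qpaths Q \<Longrightarrow> R y f (s, x # es) = (if y = x then f (head Q x, es) else 0)"
  by (auto simp: R_def)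

text \<open>A nontrivial path ending at \<open>v\<close> has a last arrow, which is
  \<open>star x\<close> for exactly one \<open>x\<close> leaving \<open>v\<close>; removing it
  changes the degree from j + 1 to j + deg x. The excluded case is that of the trivial path.\<close>

lemma Gr_generated:
  assumes f: "f \<in> Gr s v (j + 1)" and "\<not> (s = v \<and> j + 1 = 0)"
  shows "\<exists>g. (\<forall>x\<in>Out v. g x \<in> Gr s (head Q x) (j + deg x)) \<and> f = (\<Sum>x\<in>Out v. L (star x) (g x))"
proof -
  define g where "g x = (\<lambda>(s', es). if (s', es @ [star x]) \<in> qpaths Q then f (s', es @ [star x]) else 0)" for x
  have "g x \<in> Gr s (head Q x) (j + deg x)" if x: "x \<in> Out v" for x
    unfolding Gr_def
  proof (intro CollectI allI impI)
    fix p assume "g x p \<noteq> 0"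
    moreover obtain s' es where p: "p = (s', es)" by fastforce
    ultimately have "(s', es @ [star x]) \<in> gpaths s v (j + 1)"
      using f by (auto simp: g_def Gr_def split: if_splits)
    then show "p \<in> gpaths s (head Q x) (j + deg x)"
      using x by (simp add: p gpaths_snoc deg_star)
  qed
  moreover have "f p = (\<Sum>x\<in>Out v. L (star x) (g x)) p" for p
  proof -
    obtain s' es where p: "p = (s', es)" by fastforce
    show ?thesis
    proof (cases es rule: rev_cases)
      case Nil
      then have "p \<notin> gpaths s v (j + 1)" using assms(2) by (auto simp: p gpaths_def)
      then have "f p = 0" using f by (cases p) (auto simp: Gr_def)
      then show ?thesis by (simp add: p Nil sum_fun_apply L_def)
    next
      case (snoc es' y)
      show ?thesis
      proof (cases "p \<in> qpaths Q \<and> y \<in> arcs Q \<and> head Q y = v")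
        case True
        have "(\<Sum>x\<in>Out v. L (star x) (g x)) p = (\<Sum>x\<in>Out v. if x = star y then f p else 0)"
          unfolding sum_fun_apply using True
          by (intro sum.cong) (auto simp: p snoc L_eval g_def)
        also have "\<dots> = f p" using True by simp
        finally show ?thesis by simp
      next
        case False
        then have "p \<notin> gpaths s v (j + 1)" using gpaths_qpaths[of p s v "j + 1"] by (auto simp: p snoc gpaths_snoc)
        then have "f p = 0" using f by (cases p) (auto simp: Gr_def)
        moreover have "L (star x) (g x) p = 0" if "x \<in> Out v" for x
          using False that by (auto simp: p snoc L_def)
        ultimately show ?thesis by (simp add: sum_fun_apply)
      qed
    qed
  qed
  ultimately show ?thesis by blast
qed

lemma mesh_relation_JJ:
  assumes "z \<in> Gr s v j"
  shows "(\<Sum>x\<in>Out v. fscale (cf x) (L (star x) (L x z))) \<in> JJ"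
proof -
  have "(\<Sum>x\<in>Out v. fscale (cf x) (L (star x) (L x (path_elt p)))) \<in> JJ" if "p \<in> gpaths s v j" for p
  proof -
    obtain es where p: "p = (s, es)" "wk s es v" using \<open>p \<in> gpaths s v j\<close> by (cases p) (auto simp: gpaths_def)
    have "(\<Sum>x\<in>Out v. fscale (cf x) (L (star x) (L x (path_elt p)))) = mesh_word s es v []"
      unfolding mesh_word_def using p
      by (intro sum.cong) (auto simp: L_path_elt wk_append wk_Cons wk_verts)
    then show ?thesis using mesh_word_JJ[of s es v "[]" v] p by (simp add: wk_verts)
  qed
  then have "(\<Sum>p\<in>gpaths s v j. fscale (z p) (\<Sum>x\<in>Out v. fscale (cf x) (L (star x) (L x (path_elt p))))) \<in> JJ"
    by (rule JJ_sum[OF JJ_scale])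
  also have "(\<Sum>p\<in>gpaths s v j. fscale (z p) (\<Sum>x\<in>Out v. fscale (cf x) (L (star x) (L x (path_elt p)))))
     = (\<Sum>x\<in>Out v. fscale (cf x) (L (star x) (L x (\<Sum>p\<in>gpaths s v j. fscale (z p) (path_elt p)))))"
    unfolding L_sum L_linear fv.scale_sum_right
    by (subst sum.swap) (simp add: mult.commute)
  finally show ?thesis using Gr_expand[OF assms] by simp
qed

text \<open>Exactness of $A_v \to \bigoplus_{x : v \to w} A_w \to A_v$, the mesh at \<open>v\<close>, for $A = P e_s$.\<close>

lemma left_exact:
  assumes f: "\<And>x. x \<in> Out v \<Longrightarrow> f x \<in> Gr s (head Q x) (j + deg x)"
    and sum: "(\<Sum>x\<in>Out v. L (star x) (f x)) \<in> JJ"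
  shows "\<exists>z\<in>Gr s v j. \<forall>x\<in>Out v. f x - fscale (cf x) (L x z) \<in> JJ"
proof -
  obtain g z where g: "\<And>x. g x \<in> JJ" and eq: "(\<Sum>x\<in>Out v. L (star x) (f x)) =
      (\<Sum>x\<in>arcs Q. L x (g x)) + (\<Sum>x\<in>arcs Q. fscale (cf x) (L (star x) (L x z)))"
    using JJ_left[OF sum] by blast
  let ?z = "restr (gpaths s v j) z"
  have "f x - fscale (cf x) (L x ?z) \<in> JJ" if x: "x \<in> Out v" for x
  proof -
    let ?G = "gpaths s (head Q x) (j + deg x)"
    \<comment> \<open>Compare coefficients at the path \<open>p\<close> followed by
      \<open>star x\<close>: in each of the three sums only the term with this last arrow survives.
      Truncating to the right degree afterwards makes \<open>z\<close> homogeneous.\<close>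
    have "f x p = g (star x) p + cf x * L x z p" if p: "p \<in> ?G" for p
    proof -
      obtain es where es: "p = (s, es)" "wk s es (head Q x)" using p by (cases p) (auto simp: gpaths_def)
      have q: "(s, es @ [star x]) \<in> qpaths Q" using qpaths_snoc_iff[of p s "star x"] p es x by simp
      have "(\<Sum>y\<in>Out v. L (star y) (f y)) (s, es @ [star x]) = (\<Sum>y\<in>Out v. if y = x then f y p else 0)"
        unfolding sum_fun_apply using q by (intro sum.cong) (auto simp: L_eval es)
      moreover have "(\<Sum>y\<in>arcs Q. L y (g y)) (s, es @ [star x]) = (\<Sum>y\<in>arcs Q. if y = star x then g y p else 0)"
        unfolding sum_fun_apply using q by (intro sum.cong) (auto simp: L_eval es)
      moreover have "(\<Sum>y\<in>arcs Q. fscale (cf y) (L (star y) (L y z))) (s, es @ [star x]) =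
          (\<Sum>y\<in>arcs Q. if y = x then cf y * L y z p else 0)"
        unfolding sum_fun_apply fscale_apply using q by (intro sum.cong) (auto simp: L_eval es)
      ultimately show ?thesis
        using fun_cong[OF eq, of "(s, es @ [star x])"] x by (simp add: fun_simps)
    qed
    then have "restr ?G (f x) = restr ?G (g (star x)) + fscale (cf x) (restr ?G (L x z))"
      by (auto simp: restr_def fun_simps fun_eq_iff)
    moreover have "restr ?G (L x z) = L x ?z" using x L_restr[of x "j + deg x" j s z] by auto
    ultimately show ?thesis
      using restr_id[OF f[OF x]] restr_JJ[OF g] by simp
  qed
  then show ?thesis by (intro bexI[of _ ?z]) auto
qed

text \<open>Exactness on the right gives \<open>h x\<close> modulo \<open>JJ\<close> as a multiple
  of \<open>R (star x) z\<close>, where \<open>z\<close> is supported on paths from \<open>s\<close>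
  to \<open>v\<close> of degree j - 1. There are no such paths, so the correction vanishes.\<close>

lemma right_exact_initial:
  assumes h: "\<And>x. x \<in> Out s \<Longrightarrow> h x \<in> Gr (head Q x) v (j - deg x)"
    and sum: "(\<Sum>x\<in>Out s. R x (h x)) \<in> JJ" and empty: "gpaths s v (j - 1) = {}"
    and x: "x \<in> Out s"
  shows "h x \<in> JJ"
proof -
  obtain g z where g: "\<And>x. g x \<in> JJ" and eq: "(\<Sum>x\<in>Out s. R x (h x)) =
      (\<Sum>x\<in>arcs Q. R x (g x)) + (\<Sum>x\<in>arcs Q. fscale (cf x) (R x (R (star x) z)))"
    using JJ_right[OF sum] by blast
  let ?G = "gpaths (head Q x) v (j - deg x)"
  have "h x p = g x p + cf x * R (star x) z p" if p: "p \<in> ?G" for p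
  proof -
    obtain es where es: "p = (head Q x, es)" "wk (head Q x) es v" using p by (cases p) (auto simp: gpaths_def)
    have q: "(s, x # es) \<in> qpaths Q" using qpaths_Cons_iff[of p x] p es x by auto
    have "(\<Sum>y\<in>Out s. R y (h y)) (s, x # es) = (\<Sum>y\<in>Out s. if y = x then h y p else 0)"
      unfolding sum_fun_apply using q by (intro sum.cong) (auto simp: R_eval es)
    moreover have "(\<Sum>y\<in>arcs Q. R y (g y)) (s, x # es) = (\<Sum>y\<in>arcs Q. if y = x then g y p else 0)"
      unfolding sum_fun_apply using q by (intro sum.cong) (auto simp: R_eval es)
    moreover have "(\<Sum>y\<in>arcs Q. fscale (cf y) (R y (R (star y) z))) (s, x # es) =
        (\<Sum>y\<in>arcs Q. if y = x then cf y * R (star y) z p else 0)"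
      unfolding sum_fun_apply fscale_apply using q by (intro sum.cong) (auto simp: R_eval es)
    ultimately show ?thesis
      using fun_cong[OF eq, of "(s, x # es)"] x by (simp add: fun_simps)
  qed
  then have "restr ?G (h x) = restr ?G (g x) + fscale (cf x) (restr ?G (R (star x) z))"
    by (auto simp: restr_def fun_simps fun_eq_iff)
  moreover have "restr ?G (R (star x) z) = R (star x) (restr (gpaths s v (j - 1)) z)"
    using x R_restr[of "star x" "j - deg x" "j - 1" v z] by (auto simp: deg_star)
  moreover have "restr (gpaths s v (j - 1)) z = 0" by (simp add: empty restr_def fun_eq_iff fun_simps)
  ultimately show ?thesis
    using restr_id[OF h[OF x]] restr_JJ[OF g] by (simp add: R_linear)
qed

end

section \<open>Injective or surjective\<close>

lemma functional_exists:
  fixes S :: "('p \<Rightarrow> 'k::field) set"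
  assumes S: "fv.subspace S" and z: "z \<notin> S"
  shows "\<exists>\<xi>. (\<forall>x y. \<xi> (x + y) = \<xi> x + \<xi> y) \<and> (\<forall>c x. \<xi> (fscale c x) = c * \<xi> x) \<and> \<xi> z = (1::'k) \<and> (\<forall>x\<in>S. \<xi> x = 0)"
proof -
  interpret fk: vector_space_pair "fscale :: 'k \<Rightarrow> ('p \<Rightarrow> 'k) \<Rightarrow> 'p \<Rightarrow> 'k" "(*) :: 'k \<Rightarrow> 'k \<Rightarrow> 'k"
    by unfold_locales (simp_all add: algebra_simps)
  obtain C where C: "C \<subseteq> S" "fv.independent C" "S \<subseteq> fv.span C"
    using fv.maximal_independent_subset by blast
  have "z \<notin> fv.span C" using C(1) S z fv.span_minimal by blast
  then have "fv.independent (insert z C)" "z \<notin> C"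
    using C(2) fv.independent_insertI fv.span_base by blast+
  then obtain \<xi> where \<xi>: "Vector_Spaces.linear fscale (*) \<xi>" "\<And>x. x \<in> insert z C \<Longrightarrow> \<xi> x = (if x = z then 1 else 0)"
    using fk.linear_independent_extend[of "insert z C" "\<lambda>x. if x = z then 1 else 0"] by blast
  interpret \<xi>: Vector_Spaces.linear fscale "(*)" \<xi> by (rule \<xi>(1))
  have "\<xi> x = 0" if "x \<in> S" for x
  proof (rule fk.linear_eq_0_on_span[OF \<xi>(1)])
    show "x \<in> fv.span C" using C(3) that by blast
    show "\<xi> y = 0" if "y \<in> C" for y using \<xi>(2)[of y] that \<open>z \<notin> C\<close> by auto
  qed
  moreover have "\<xi> z = 1" using \<xi>(2)[of z] by simp
  ultimately show ?thesis using \<xi>.add \<xi>.scale by (intro exI[of _ \<xi>]) simp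
qed

text \<open>\<open>A\<close> indexes a basis of the sum of the subspaces W'_i: the vector
  \<open>w \<alpha>\<close> is a combination of arrows from \<open>t\<close> to
  \<open>nd \<alpha>\<close>, all of degree \<open>dg \<alpha>\<close>. Fixing a basis turns the
  tensor products into one copy of V_i for each basis vector.\<close>

locale mesh_map = acyclic_preproj \<Gamma> a b
  for \<Gamma> :: "('v, 'e) pre_digraph" and a b :: "'e \<Rightarrow> 'k::field" +
  fixes t :: 'v and A :: "'c set" and nd :: "'c \<Rightarrow> 'v" and dg :: "'c \<Rightarrow> int"
    and w :: "'c \<Rightarrow> 'e + 'e \<Rightarrow> 'k"
  assumes t: "t \<in> verts \<Gamma>" and fin: "finite A"
    and w_support: "\<And>\<alpha> x. \<alpha> \<in> A \<Longrightarrow> w \<alpha> x \<noteq> 0 \<Longrightarrow>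
      x \<in> arcs Q \<and> tail Q x = t \<and> head Q x = nd \<alpha> \<and> deg x = dg \<alpha>"
    and w_indep: "\<And>c. (\<forall>x. (\<Sum>\<alpha>\<in>A. c \<alpha> * w \<alpha> x) = 0) \<Longrightarrow> \<forall>\<alpha>\<in>A. c \<alpha> = 0"
begin

text \<open>Right multiplication of each \<open>y \<alpha>\<close> by the vector
  \<open>w \<alpha>\<close>, summed over \<open>\<alpha>\<close>. The shift by
  \<open>dg \<alpha>\<close> in \<open>Ys\<close> below makes this map preserve degrees.\<close>

definition fm :: "('c \<Rightarrow> ('v, 'e + 'e) qpath \<Rightarrow> 'k) \<Rightarrow> ('v, 'e + 'e) qpath \<Rightarrow> 'k" where
  "fm y = (\<Sum>\<alpha>\<in>A. \<Sum>x\<in>arcs Q. fscale (w \<alpha> x) (R x (y \<alpha>)))"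

definition Ys :: "'v \<Rightarrow> int \<Rightarrow> ('c \<Rightarrow> ('v, 'e + 'e) qpath \<Rightarrow> 'k) set" where
  "Ys v j = {y. \<forall>\<alpha>\<in>A. y \<alpha> \<in> Gr (nd \<alpha>) v (j - dg \<alpha>)}"

text \<open>The image of \<open>fm\<close> enlarged by \<open>JJ\<close>, and not cut down to
  \<open>Gr t v j\<close>. Membership of a representative reads as being zero in the
  cokernel.\<close>

definition B :: "'v \<Rightarrow> int \<Rightarrow> (('v, 'e + 'e) qpath \<Rightarrow> 'k) set" where
  "B v j = {z. \<exists>y\<in>Ys v j. z - fm y \<in> JJ}"

lemma fm_add: "fm (\<lambda>\<alpha>. y \<alpha> + y' \<alpha>) = fm y + fm y'"
  by (simp add: fm_def R_linear fv.scale_right_distrib sum.distrib)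

lemma fm_scale: "fm (\<lambda>\<alpha>. fscale c (y \<alpha>)) = fscale c (fm y)"
  by (simp add: fm_def R_linear fv.scale_sum_right mult.commute)

lemma fm_diff: "fm (\<lambda>\<alpha>. y \<alpha> - y' \<alpha>) = fm y - fm y'"
  by (simp add: fm_def R_linear fv.scale_right_diff_distrib sum_subtractf)

lemma fm_zero: "fm (\<lambda>\<alpha>. 0) = 0"
  by (simp add: fm_def R_linear)

lemma fm_sum: "fm (\<lambda>\<alpha>. \<Sum>i\<in>I. y i \<alpha>) = (\<Sum>i\<in>I. fm (y i))"
  by (induction I rule: infinite_finite_induct) (simp_all add: fm_zero fm_add)

lemma fm_cong: "(\<And>\<alpha>. \<alpha> \<in> A \<Longrightarrow> y \<alpha> = y' \<alpha>) \<Longrightarrow> fm y = fm y'"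
  by (simp add: fm_def)

lemma L_fm: "L x (fm y) = fm (\<lambda>\<alpha>. L x (y \<alpha>))"
  by (simp add: fm_def L_sum L_linear L_R_commute)

lemma fm_Gr: "y \<in> Ys v j \<Longrightarrow> fm y \<in> Gr t v j"
  unfolding fm_def
proof (intro Gr_sum)
  fix \<alpha> x assume y: "y \<in> Ys v j" and \<alpha>: "\<alpha> \<in> A"
  show "fscale (w \<alpha> x) (R x (y \<alpha>)) \<in> Gr t v j"
  proof (cases "w \<alpha> x = 0")
    case False
    then have x: "x \<in> arcs Q" "tail Q x = t" "head Q x = nd \<alpha>" "deg x = dg \<alpha>"
      using w_support[OF \<alpha>] by auto
    then have "R x (y \<alpha>) \<in> Gr (tail Q x) v j"
      using y \<alpha> by (intro R_Gr[of x _ v "j - dg \<alpha>"]) (auto simp: Ys_def)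
    then show ?thesis using x Gr_scale by blast
  qed simp
qed

lemma Ys_add: "y \<in> Ys v j \<Longrightarrow> y' \<in> Ys v j \<Longrightarrow> (\<lambda>\<alpha>. y \<alpha> + y' \<alpha>) \<in> Ys v j"
  and Ys_diff: "y \<in> Ys v j \<Longrightarrow> y' \<in> Ys v j \<Longrightarrow> (\<lambda>\<alpha>. y \<alpha> - y' \<alpha>) \<in> Ys v j"
  and Ys_scale: "y \<in> Ys v j \<Longrightarrow> (\<lambda>\<alpha>. fscale c (y \<alpha>)) \<in> Ys v j"
  and Ys_zero: "(\<lambda>\<alpha>. 0) \<in> Ys v j"
  by (auto simp: Ys_def Gr_add Gr_diff Gr_scale)

lemma B_subspace: "fv.subspace (B v j)"
proof (rule fv.subspaceI)
  show "0 \<in> B v j" unfolding B_def using Ys_zero by (auto intro!: bexI[of _ "\<lambda>_. 0"] simp: fm_zero)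
next
  fix z z' assume "z \<in> B v j" "z' \<in> B v j"
  then obtain y y' where y: "y \<in> Ys v j" "y' \<in> Ys v j" "z - fm y \<in> JJ" "z' - fm y' \<in> JJ"
    by (auto simp: B_def)
  have "z + z' - fm (\<lambda>\<alpha>. y \<alpha> + y' \<alpha>) \<in> JJ"
    using JJ_add[OF y(3,4)] by (simp add: fm_add algebra_simps)
  then show "z + z' \<in> B v j" using Ys_add[OF y(1,2)] by (auto simp: B_def)
next
  fix c z assume "z \<in> B v j"
  then obtain y where y: "y \<in> Ys v j" "z - fm y \<in> JJ" by (auto simp: B_def)
  have "fscale c z - fm (\<lambda>\<alpha>. fscale c (y \<alpha>)) \<in> JJ"
    using JJ_scale[OF y(2)] by (simp add: fm_scale fv.scale_right_diff_distrib)
  then show "fscale c z \<in> B v j" using Ys_scale[OF y(1)] by (auto simp: B_def)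
qed

lemmas B_zero [simp] = fv.subspace_0[OF B_subspace]
  and B_add = fv.subspace_add[OF B_subspace]
  and B_scale = fv.subspace_scale[OF B_subspace]
  and B_diff = fv.subspace_diff[OF B_subspace]
  and B_neg = fv.subspace_neg[OF B_subspace]
  and B_sum = fv.subspace_sum[OF B_subspace]

lemma JJ_B: "z \<in> JJ \<Longrightarrow> z \<in> B v j"
  unfolding B_def using Ys_zero by (auto intro!: bexI[of _ "\<lambda>_. 0"] simp: fm_zero)

lemma fm_B: "y \<in> Ys v j \<Longrightarrow> fm y \<in> B v j"
  unfolding B_def by (rule CollectI) (rule bexI[of _ y], simp_all)

lemma B_trans: "z - z' \<in> B v j \<Longrightarrow> z' - z'' \<in> B v j \<Longrightarrow> z - z'' \<in> B v j"
  using B_add[of "z - z'" v j "z' - z''"] by simp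

lemma B_sym: "z - z' \<in> B v j \<Longrightarrow> z' - z \<in> B v j"
  using B_neg[of "z - z'" v j] by simp

lemma L_Ys:
  assumes "x \<in> arcs Q" "y \<in> Ys (tail Q x) j" "j' = j + deg x"
  shows "(\<lambda>\<alpha>. L x (y \<alpha>)) \<in> Ys (head Q x) j'"
  using assms by (auto simp: Ys_def intro!: L_Gr)

lemma L_B:
  assumes "x \<in> arcs Q" "z \<in> B (tail Q x) j" "j' = j + deg x"
  shows "L x z \<in> B (head Q x) j'"
proof -
  obtain y where y: "y \<in> Ys (tail Q x) j" "z - fm y \<in> JJ" using assms(2) by (auto simp: B_def)
  have "L x z - fm (\<lambda>\<alpha>. L x (y \<alpha>)) \<in> JJ"
    using L_JJ[OF y(2), of x] by (simp add: L_linear L_fm)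
  then show ?thesis using L_Ys[OF assms(1) y(1) assms(3)] by (auto simp: B_def)
qed

definition mono :: "('v \<Rightarrow> int) \<Rightarrow> bool" where
  "mono j \<longleftrightarrow> (\<forall>v\<in>verts \<Gamma>. \<forall>y\<in>Ys v (j v). fm y \<in> JJ \<longrightarrow> (\<forall>\<alpha>\<in>A. y \<alpha> \<in> JJ))"

definition epi :: "('v \<Rightarrow> int) \<Rightarrow> bool" where
  "epi j \<longleftrightarrow> (\<forall>v\<in>verts \<Gamma>. Gr t v (j v) \<subseteq> B v (j v))"

text \<open>Endomorphisms of the representation $C_v = \mathit{Gr}\,t\,v\,(j\,v) / B\,v\,(j\,v)$ of the slice
  \<open>j\<close>, given by maps on representatives that are linear only modulo \<open>B\<close>.\<close>

definition endo :: "('v \<Rightarrow> int) \<Rightarrow>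
    ('v \<Rightarrow> (('v, 'e + 'e) qpath \<Rightarrow> 'k) \<Rightarrow> ('v, 'e + 'e) qpath \<Rightarrow> 'k) \<Rightarrow> bool" where
  "endo j \<theta> \<longleftrightarrow> (\<forall>v\<in>verts \<Gamma>.
     (\<forall>z\<in>Gr t v (j v). \<theta> v z \<in> Gr t v (j v)) \<and>
     (\<forall>z\<in>Gr t v (j v). \<forall>z'\<in>Gr t v (j v). \<theta> v (z + z') - (\<theta> v z + \<theta> v z') \<in> B v (j v)) \<and>
     (\<forall>c. \<forall>z\<in>Gr t v (j v). \<theta> v (fscale c z) - fscale c (\<theta> v z) \<in> B v (j v)) \<and>
     (\<forall>z\<in>Gr t v (j v). z \<in> B v (j v) \<longrightarrow> \<theta> v z \<in> B v (j v))) \<and>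
     (\<forall>x\<in>arcs Q. j (head Q x) = j (tail Q x) + deg x \<longrightarrow>
        (\<forall>z\<in>Gr t (tail Q x) (j (tail Q x)).
           \<theta> (head Q x) (L x z) - L x (\<theta> (tail Q x) z) \<in> B (head Q x) (j (head Q x))))"

text \<open>Only scalars act as endomorphisms of the cokernel. The zero representation is included,
  since all its endomorphisms agree modulo \<open>B\<close>.\<close>

definition brick :: "('v \<Rightarrow> int) \<Rightarrow> bool" where
  "brick j \<longleftrightarrow> (\<forall>\<theta>. endo j \<theta> \<longrightarrow>
     (\<exists>c. \<forall>v\<in>verts \<Gamma>. \<forall>z\<in>Gr t v (j v). \<theta> v z - fscale c z \<in> B v (j v)))"

text \<open>\<open>\<theta>\<close> is additive only up to \<open>B\<close>, so the errors of the
  single additions are collected; the empty sum uses that \<open>\<theta>\<close> preserves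
  \<open>B\<close>.\<close>

lemma endo_sum:
  assumes \<theta>: "endo j \<theta>" and v: "v \<in> verts \<Gamma>" and z: "\<And>i. i \<in> I \<Longrightarrow> z i \<in> Gr t v (j v)"
  shows "\<theta> v (\<Sum>i\<in>I. z i) - (\<Sum>i\<in>I. \<theta> v (z i)) \<in> B v (j v)"
  using z
proof (induction I rule: infinite_finite_induct)
  case (insert i I)
  have "\<theta> v (z i + (\<Sum>i\<in>I. z i)) - (\<theta> v (z i) + \<theta> v (\<Sum>i\<in>I. z i)) \<in> B v (j v)"
    using \<theta> v insert.prems Gr_sum[of I z t v "j v"] unfolding endo_def by auto
  moreover have "\<theta> v (\<Sum>i\<in>I. z i) - (\<Sum>i\<in>I. \<theta> v (z i)) \<in> B v (j v)"
    using insert by simp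
  ultimately have "\<theta> v (z i + (\<Sum>i\<in>I. z i)) - (\<theta> v (z i) + \<theta> v (\<Sum>i\<in>I. z i)) +
      (\<theta> v (\<Sum>i\<in>I. z i) - (\<Sum>i\<in>I. \<theta> v (z i))) \<in> B v (j v)"
    by (rule B_add)
  then show ?case using insert.hyps by (simp add: algebra_simps)
qed (use \<theta> v in \<open>auto simp: endo_def\<close>)

text \<open>\<open>Gr_generated\<close> for every component. The assumption \<open>gen\<close> says
  that the trivial path at \<open>nd \<alpha>\<close>, which would not be generated by earlier
  paths, does not occur at this position.\<close>

lemma Ys_generated:
  assumes y: "y \<in> Ys v (i + 1)" and gen: "\<And>\<alpha>. \<alpha> \<in> A \<Longrightarrow> \<not> (nd \<alpha> = v \<and> i + 1 = dg \<alpha>)"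
  shows "\<exists>Y. (\<forall>x\<in>Out v. Y x \<in> Ys (head Q x) (i + deg x)) \<and>
    (\<forall>\<alpha>\<in>A. y \<alpha> = (\<Sum>x\<in>Out v. L (star x) (Y x \<alpha>)))"
proof -
  have "\<exists>g. (\<forall>x\<in>Out v. g x \<in> Gr (nd \<alpha>) (head Q x) (i - dg \<alpha> + deg x)) \<and>
      y \<alpha> = (\<Sum>x\<in>Out v. L (star x) (g x))" if \<alpha>: "\<alpha> \<in> A" for \<alpha>
  proof (rule Gr_generated)
    have eq: "i - dg \<alpha> + 1 = i + 1 - dg \<alpha>" by simp
    show "y \<alpha> \<in> Gr (nd \<alpha>) v (i - dg \<alpha> + 1)" unfolding eq using y \<alpha> by (simp add: Ys_def)
    show "\<not> (nd \<alpha> = v \<and> i - dg \<alpha> + 1 = 0)" unfolding eq using gen[OF \<alpha>] by (metis eq_iff_diff_eq_0)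
  qed
  then have "\<forall>\<alpha>\<in>A. \<exists>g. (\<forall>x\<in>Out v. g x \<in> Gr (nd \<alpha>) (head Q x) (i - dg \<alpha> + deg x)) \<and>
      y \<alpha> = (\<Sum>x\<in>Out v. L (star x) (g x))"
    by blast
  from bchoice[OF this] obtain g where g: "\<And>\<alpha>. \<alpha> \<in> A \<Longrightarrow> (\<forall>x\<in>Out v. g \<alpha> x \<in> Gr (nd \<alpha>) (head Q x) (i - dg \<alpha> + deg x)) \<and>
      y \<alpha> = (\<Sum>x\<in>Out v. L (star x) (g \<alpha> x))"
    by blast
  have "(\<lambda>\<alpha>. g \<alpha> x) \<in> Ys (head Q x) (i + deg x)" if x: "x \<in> Out v" for x
  proof -
    have eq: "i + deg x - dg \<alpha> = i - dg \<alpha> + deg x" for \<alpha> by simp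
    show ?thesis unfolding Ys_def mem_Collect_eq eq using g x by blast
  qed
  then show ?thesis using g by (intro exI[of _ "\<lambda>x \<alpha>. g \<alpha> x"]) simp
qed

lemma fm_generated:
  assumes "\<forall>\<alpha>\<in>A. y \<alpha> = (\<Sum>x\<in>Out v. L (star x) (Y x \<alpha>))"
  shows "fm y = (\<Sum>x\<in>Out v. L (star x) (fm (Y x)))"
  unfolding L_fm fm_sum[symmetric] by (rule fm_cong) (use assms in auto)

text \<open>Moving the slice \<open>j\<close> at the vertex \<open>v\<close>, all of whose arrows in the slice are outgoing. The
  assumption \<open>gen\<close> excludes degrees in which the source of the map acquires a new generator.\<close>

context
  fixes j :: "'v \<Rightarrow> int" and v :: 'v and i :: int
  assumes v: "v \<in> verts \<Gamma>" and i: "j v = i" and out: "\<And>x. x \<in> Out v \<Longrightarrow> j (head Q x) = i + deg x"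
    and gen: "\<And>\<alpha>. \<alpha> \<in> A \<Longrightarrow> \<not> (nd \<alpha> = v \<and> i + 1 = dg \<alpha>)" and gen_t: "\<not> (t = v \<and> i + 1 = 0)"
begin

lemma head_ne: "x \<in> Out v \<Longrightarrow> head Q x \<noteq> v"
  using no_loop by auto

lemma head_verts: "x \<in> Out v \<Longrightarrow> head Q x \<in> verts \<Gamma>"
  by auto

lemma L_star_B: "x \<in> Out v \<Longrightarrow> z \<in> B (head Q x) (i + deg x) \<Longrightarrow> L (star x) z \<in> B v (i + 1)"
  using L_B[of "star x" z "i + deg x" "i + 1"] by (auto simp: deg_star)

lemma L_star_Gr: "x \<in> Out v \<Longrightarrow> z \<in> Gr t (head Q x) (i + deg x) \<Longrightarrow> L (star x) z \<in> Gr t v (i + 1)"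
  using L_Gr[of "star x" z t "i + deg x" "i + 1"] by (auto simp: deg_star)

lemma L_Out_Gr: "x \<in> Out v \<Longrightarrow> z \<in> Gr t v i \<Longrightarrow> L x z \<in> Gr t (head Q x) (i + deg x)"
  using L_Gr[of x z t i] by auto

text \<open>Everything at (v, i + 1) comes from the neighbours of \<open>v\<close>, so it suffices
  that the cokernel vanishes away from \<open>v\<close>. Its value at (v, i) is left free, and this
  is what the non-injective case requires.\<close>

lemma epi_next:
  assumes "\<And>w. w \<in> verts \<Gamma> \<Longrightarrow> w \<noteq> v \<Longrightarrow> Gr t w (j w) \<subseteq> B w (j w)"
  shows "epi (j(v := i + 1))"
proof -
  have "z \<in> B v (i + 1)" if z: "z \<in> Gr t v (i + 1)" for z
  proof -
    obtain g where g: "\<forall>x\<in>Out v. g x \<in> Gr t (head Q x) (i + deg x)" "z = (\<Sum>x\<in>Out v. L (star x) (g x))"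
      using Gr_generated[OF z gen_t] by blast
    have "g x \<in> B (head Q x) (i + deg x)" if "x \<in> Out v" for x
      using assms[OF head_verts[OF that] head_ne[OF that]] g(1) that out[OF that] by auto
    then show ?thesis unfolding g(2) by (intro B_sum L_star_B)
  qed
  then show ?thesis using assms by (auto simp: epi_def)
qed

text \<open>\<open>inj\<close> says that the arrows leaving \<open>v\<close> embed C_v jointly into
  the cokernels at the neighbours. For injectivity, a kernel element is written through the
  neighbours and corrected by an element coming from (v, i). For the brick property, an endomorphism
  after the move is carried back to one before the move and is a scalar there.\<close>

lemma injective_step:
  assumes inj: "\<And>z. z \<in> Gr t v i \<Longrightarrow> (\<And>x. x \<in> Out v \<Longrightarrow> L x z \<in> B (head Q x) (i + deg x)) \<Longrightarrow> z \<in> B v i"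
  shows "mono j \<Longrightarrow> mono (j(v := i + 1))" "brick j \<Longrightarrow> brick (j(v := i + 1))"
proof -
  assume mono: "mono j"
  have "\<forall>\<alpha>\<in>A. y \<alpha> \<in> JJ" if y: "y \<in> Ys v (i + 1)" and fmy: "fm y \<in> JJ" for y
  proof -
    obtain Y where Y: "\<forall>x\<in>Out v. Y x \<in> Ys (head Q x) (i + deg x)"
      and yY: "\<forall>\<alpha>\<in>A. y \<alpha> = (\<Sum>x\<in>Out v. L (star x) (Y x \<alpha>))"
      using Ys_generated[OF y gen] by blast
    have "\<exists>z\<in>Gr t v i. \<forall>x\<in>Out v. fm (Y x) - fscale (cf x) (L x z) \<in> JJ"
      using left_exact[of v "\<lambda>x. fm (Y x)" t i] fmy fm_Gr Y unfolding fm_generated[OF yY] by blast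
    then obtain z where z: "z \<in> Gr t v i" "\<And>x. x \<in> Out v \<Longrightarrow> fm (Y x) - fscale (cf x) (L x z) \<in> JJ"
      by blast
    have "L x z \<in> B (head Q x) (i + deg x)" if x: "x \<in> Out v" for x
    proof -
      have "fscale (cf x) (L x z) \<in> B (head Q x) (i + deg x)"
        using B_diff[OF fm_B JJ_B[OF z(2)[OF x]]] Y x by fastforce
      from B_scale[OF this, of "inverse (cf x)"] show ?thesis
        using cf_nonzero[of x] x by simp
    qed
    then have "z \<in> B v i" using inj z(1) by blast
    then obtain y0 where y0: "y0 \<in> Ys v i" "z - fm y0 \<in> JJ" by (auto simp: B_def)
    \<comment> \<open>Both families have the same image at the neighbour, so they agree by
      injectivity there. Applying \<open>L (star x)\<close> and summing over \<open>x\<close> turns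
      the second family into a mesh relation, which is 0.\<close>
    have *: "Y x \<alpha> - fscale (cf x) (L x (y0 \<alpha>)) \<in> JJ" if x: "x \<in> Out v" and \<alpha>: "\<alpha> \<in> A" for x \<alpha>
    proof -
      let ?u = "\<lambda>\<alpha>. Y x \<alpha> - fscale (cf x) (L x (y0 \<alpha>))"
      have "?u \<in> Ys (head Q x) (j (head Q x))"
        using L_Ys[of x y0 i "i + deg x"] x Y y0 out[OF x] by (intro Ys_diff Ys_scale) auto
      moreover have "fm ?u = fm (Y x) - fscale (cf x) (L x z) + fscale (cf x) (L x (z - fm y0))"
        by (simp add: fm_diff fm_scale L_fm L_linear fv.scale_right_diff_distrib)
      then have "fm ?u \<in> JJ" using z(2)[OF x] y0(2) by (auto intro!: JJ_add JJ_scale L_JJ)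
      ultimately show ?thesis
        using mono head_verts[OF x] \<alpha> unfolding mono_def by blast
    qed
    show ?thesis
    proof
      fix \<alpha> assume \<alpha>: "\<alpha> \<in> A"
      have "(\<Sum>x\<in>Out v. L (star x) (Y x \<alpha> - fscale (cf x) (L x (y0 \<alpha>)))) \<in> JJ"
        using * \<alpha> by (intro JJ_sum L_JJ)
      moreover have "(\<Sum>x\<in>Out v. fscale (cf x) (L (star x) (L x (y0 \<alpha>)))) \<in> JJ"
        using y0(1) \<alpha> by (intro mesh_relation_JJ) (auto simp: Ys_def)
      ultimately have "(\<Sum>x\<in>Out v. L (star x) (Y x \<alpha> - fscale (cf x) (L x (y0 \<alpha>)))) +
        (\<Sum>x\<in>Out v. fscale (cf x) (L (star x) (L x (y0 \<alpha>)))) \<in> JJ"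
        by (rule JJ_add)
      then show "y \<alpha> \<in> JJ"
        using yY \<alpha> by (simp add: L_linear sum_subtractf)
    qed
  qed
  then show "mono (j(v := i + 1))" using mono unfolding mono_def by auto
next
  assume brick: "brick j"
  show "brick (j(v := i + 1))"
    unfolding brick_def
  proof (intro allI impI)
    fix \<theta> assume \<theta>: "endo (j(v := i + 1)) \<theta>"
    have \<theta>v: "\<And>z. z \<in> Gr t v (i + 1) \<Longrightarrow> z \<in> B v (i + 1) \<Longrightarrow> \<theta> v z \<in> B v (i + 1)"
      "\<And>z z'. z \<in> Gr t v (i + 1) \<Longrightarrow> z' \<in> Gr t v (i + 1) \<Longrightarrow> \<theta> v (z + z') - (\<theta> v z + \<theta> v z') \<in> B v (i + 1)"
      "\<And>c z. z \<in> Gr t v (i + 1) \<Longrightarrow> \<theta> v (fscale c z) - fscale c (\<theta> v z) \<in> B v (i + 1)"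
      using \<theta> v unfolding endo_def by (auto split: if_splits)
    have \<theta>h: "\<And>z. z \<in> Gr t (head Q x) (i + deg x) \<Longrightarrow> \<theta> (head Q x) z \<in> Gr t (head Q x) (i + deg x)"
      "\<And>z z'. z \<in> Gr t (head Q x) (i + deg x) \<Longrightarrow> z' \<in> Gr t (head Q x) (i + deg x) \<Longrightarrow>
        \<theta> (head Q x) (z + z') - (\<theta> (head Q x) z + \<theta> (head Q x) z') \<in> B (head Q x) (i + deg x)"
      "\<And>c z. z \<in> Gr t (head Q x) (i + deg x) \<Longrightarrow>
        \<theta> (head Q x) (fscale c z) - fscale c (\<theta> (head Q x) z) \<in> B (head Q x) (i + deg x)"
      "\<And>z. z \<in> Gr t (head Q x) (i + deg x) \<Longrightarrow> z \<in> B (head Q x) (i + deg x) \<Longrightarrow>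
        \<theta> (head Q x) z \<in> B (head Q x) (i + deg x)"
      if x: "x \<in> Out v" for x
      using \<theta> head_verts[OF x] head_ne[OF x] out[OF x] unfolding endo_def by auto
    have \<theta>L: "\<theta> v (L (star x) z) - L (star x) (\<theta> (head Q x) z) \<in> B v (i + 1)"
      if x: "x \<in> Out v" "z \<in> Gr t (head Q x) (i + deg x)" for x z
    proof -
      have "star x \<in> arcs Q" "head Q (star x) = v" "tail Q (star x) = head Q x" using x by auto
      then show ?thesis
        using \<theta> head_ne[OF x(1)] out[OF x(1)] x(2) unfolding endo_def by (fastforce simp: deg_star)
    qed
    \<comment> \<open>\<open>\<theta>\<close> has to be defined on C_v. Applying it to the mesh
      relation of \<open>z\<close> shows that the elements
      \<open>\<theta> (head Q x) (L x z)\<close> again satisfy the relation at (v, i + 1), up to the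
      image of \<open>fm\<close>. That part is spread over the neighbours as \<open>Y\<close> and
      subtracted; exactness then provides a common preimage \<open>z'\<close>.\<close>
    have ex: "\<exists>z'\<in>Gr t v i. \<forall>x\<in>Out v. L x z' - \<theta> (head Q x) (L x z) \<in> B (head Q x) (i + deg x)"
      if z: "z \<in> Gr t v i" for z
    proof -
      let ?S = "\<Sum>x\<in>Out v. fscale (cf x) (L (star x) (L x z))"
      have LL: "L (star x) (L x z) \<in> Gr t v (i + 1)" if "x \<in> Out v" for x
        using L_star_Gr[OF that L_Out_Gr[OF that z]] .
      have "?S \<in> Gr t v (i + 1)" using LL by (intro Gr_sum Gr_scale)
      then have "\<theta> v ?S \<in> B v (i + 1)" by (intro \<theta>v JJ_B mesh_relation_JJ[OF z])
      moreover have "\<theta> v ?S - (\<Sum>x\<in>Out v. \<theta> v (fscale (cf x) (L (star x) (L x z)))) \<in> B v (i + 1)"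
        using endo_sum[OF \<theta> v, of "Out v" "\<lambda>x. fscale (cf x) (L (star x) (L x z))"] LL
        by (simp add: Gr_scale)
      ultimately have 1: "(\<Sum>x\<in>Out v. \<theta> v (fscale (cf x) (L (star x) (L x z)))) \<in> B v (i + 1)"
        using B_diff by fastforce
      have "\<theta> v (fscale (cf x) (L (star x) (L x z))) - L (star x) (fscale (cf x) (\<theta> (head Q x) (L x z))) \<in> B v (i + 1)"
        if x: "x \<in> Out v" for x
      proof -
        have "fscale (cf x) (\<theta> v (L (star x) (L x z)) - L (star x) (\<theta> (head Q x) (L x z))) \<in> B v (i + 1)"
          using \<theta>L[OF x L_Out_Gr[OF x z]] by (rule B_scale)
        from B_add[OF \<theta>v(3)[OF LL[OF x], of "cf x"] this] show ?thesis
          by (simp add: L_linear fv.scale_right_diff_distrib)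
      qed
      then have "(\<Sum>x\<in>Out v. \<theta> v (fscale (cf x) (L (star x) (L x z))) -
          L (star x) (fscale (cf x) (\<theta> (head Q x) (L x z)))) \<in> B v (i + 1)"
        by (rule B_sum)
      from B_diff[OF 1 this] have "(\<Sum>x\<in>Out v. L (star x) (fscale (cf x) (\<theta> (head Q x) (L x z)))) \<in> B v (i + 1)"
        by (simp add: sum_subtractf)
      then obtain y where y: "y \<in> Ys v (i + 1)"
        "(\<Sum>x\<in>Out v. L (star x) (fscale (cf x) (\<theta> (head Q x) (L x z)))) - fm y \<in> JJ"
        by (auto simp: B_def)
      obtain Y where Y: "\<forall>x\<in>Out v. Y x \<in> Ys (head Q x) (i + deg x)"
        and yY: "\<forall>\<alpha>\<in>A. y \<alpha> = (\<Sum>x\<in>Out v. L (star x) (Y x \<alpha>))"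
        using Ys_generated[OF y(1) gen] by blast
      let ?f = "\<lambda>x. fscale (cf x) (\<theta> (head Q x) (L x z)) - fm (Y x)"
      have "\<exists>z'\<in>Gr t v i. \<forall>x\<in>Out v. ?f x - fscale (cf x) (L x z') \<in> JJ"
      proof (rule left_exact)
        show "?f x \<in> Gr t (head Q x) (i + deg x)" if "x \<in> Out v" for x
          using that Y by (intro Gr_diff Gr_scale \<theta>h fm_Gr L_Out_Gr z) auto
        show "(\<Sum>x\<in>Out v. L (star x) (?f x)) \<in> JJ"
          using y(2) unfolding fm_generated[OF yY] by (simp add: L_linear sum_subtractf)
      qed
      then obtain z' where z': "z' \<in> Gr t v i" "\<And>x. x \<in> Out v \<Longrightarrow> ?f x - fscale (cf x) (L x z') \<in> JJ"
        by blast
      have "L x z' - \<theta> (head Q x) (L x z) \<in> B (head Q x) (i + deg x)" if x: "x \<in> Out v" for x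
      proof -
        have "?f x - fscale (cf x) (L x z') + fm (Y x) \<in> B (head Q x) (i + deg x)"
          using z'(2)[OF x] Y x by (intro B_add JJ_B fm_B) auto
        then have "fscale (- inverse (cf x)) (?f x - fscale (cf x) (L x z') + fm (Y x)) \<in> B (head Q x) (i + deg x)"
          by (rule B_scale)
        moreover have "fscale (- inverse (cf x)) (?f x - fscale (cf x) (L x z') + fm (Y x)) =
            L x z' - \<theta> (head Q x) (L x z)"
          using cf_nonzero[of x] x by (auto simp: fun_eq_iff fun_simps field_simps)
        ultimately show ?thesis by simp
      qed
      then show ?thesis using z'(1) by blast
    qed
    define lift where "lift z = (SOME z'. z' \<in> Gr t v i \<and> (\<forall>x\<in>Out v. L x z' - \<theta> (head Q x) (L x z) \<in> B (head Q x) (i + deg x)))" for z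
    have lift: "lift z \<in> Gr t v i" "\<And>x. x \<in> Out v \<Longrightarrow> L x (lift z) - \<theta> (head Q x) (L x z) \<in> B (head Q x) (i + deg x)"
      if "z \<in> Gr t v i" for z
      using someI_ex[OF ex[OF that, unfolded Bex_def]] unfolding lift_def by blast+
    \<comment> \<open>\<open>lift\<close> is an arbitrary choice, but by \<open>inj\<close> its
      value is unique modulo \<open>B\<close>. This is the source of its additivity, homogeneity and
      compatibility with \<open>B\<close>.\<close>
    have uniq: "lift z - z' \<in> B v i"
      if "z \<in> Gr t v i" "z' \<in> Gr t v i" "\<And>x. x \<in> Out v \<Longrightarrow> \<theta> (head Q x) (L x z) - L x z' \<in> B (head Q x) (i + deg x)" for z z'
      using lift[OF that(1)] that by (intro inj) (auto intro!: Gr_diff B_trans[OF lift(2)] simp: L_linear)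
    have "endo j (\<theta>(v := lift))"
      unfolding endo_def
    proof (intro conjI ballI allI impI)
      fix w z assume w: "w \<in> verts \<Gamma>" and z: "z \<in> Gr t w (j w)"
      show "(\<theta>(v := lift)) w z \<in> Gr t w (j w)"
        using z w \<theta> lift(1) i unfolding endo_def by auto
      show "(\<theta>(v := lift)) w (z + z') - ((\<theta>(v := lift)) w z + (\<theta>(v := lift)) w z') \<in> B w (j w)"
        if z': "z' \<in> Gr t w (j w)" for z'
      proof (cases "w = v")
        case True
        have zz: "z \<in> Gr t v i" "z' \<in> Gr t v i" using z z' True i by auto
        have "lift (z + z') - (lift z + lift z') \<in> B v i"
        proof (rule uniq)
          fix x assume x: "x \<in> Out v"
          let ?B = "B (head Q x) (i + deg x)"
          have "\<theta> (head Q x) (L x (z + z')) - (\<theta> (head Q x) (L x z) + \<theta> (head Q x) (L x z')) \<in> ?B"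
            using \<theta>h(2)[OF x L_Out_Gr[OF x zz(1)] L_Out_Gr[OF x zz(2)]] by (simp add: L_linear)
          from B_diff[OF B_diff[OF this lift(2)[OF zz(1) x]] lift(2)[OF zz(2) x]]
          show "\<theta> (head Q x) (L x (z + z')) - L x (lift z + lift z') \<in> ?B"
            by (simp add: L_linear algebra_simps)
        qed (use zz lift(1) in \<open>auto intro!: Gr_add\<close>)
        then show ?thesis using True i by simp
      next
        case False
        then show ?thesis using \<theta> w z z' unfolding endo_def by auto
      qed
      show "(\<theta>(v := lift)) w (fscale c z) - fscale c ((\<theta>(v := lift)) w z) \<in> B w (j w)" for c
      proof (cases "w = v")
        case True
        have zz: "z \<in> Gr t v i" using z True i by auto
        have "lift (fscale c z) - fscale c (lift z) \<in> B v i"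
        proof (rule uniq)
          fix x assume x: "x \<in> Out v"
          let ?B = "B (head Q x) (i + deg x)"
          have "\<theta> (head Q x) (L x (fscale c z)) - fscale c (\<theta> (head Q x) (L x z)) \<in> ?B"
            using \<theta>h(3)[OF x L_Out_Gr[OF x zz]] by (simp add: L_linear)
          from B_diff[OF this B_scale[OF lift(2)[OF zz x], of c]]
          show "\<theta> (head Q x) (L x (fscale c z)) - L x (fscale c (lift z)) \<in> ?B"
            by (simp add: L_linear fv.scale_right_diff_distrib)
        qed (use zz lift(1) in \<open>auto intro!: Gr_scale\<close>)
        then show ?thesis using True i by simp
      next
        case False
        then show ?thesis using \<theta> w z unfolding endo_def by auto
      qed
      show "(\<theta>(v := lift)) w z \<in> B w (j w)" if zB: "z \<in> B w (j w)"
      proof (cases "w = v")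
        case True
        have zz: "z \<in> Gr t v i" "z \<in> B v i" using z zB True i by auto
        have "lift z - 0 \<in> B v i"
        proof (rule uniq)
          fix x assume x: "x \<in> Out v"
          have "L x z \<in> B (head Q x) (i + deg x)" using L_B[of x z i "i + deg x"] x zz by auto
          then show "\<theta> (head Q x) (L x z) - L x 0 \<in> B (head Q x) (i + deg x)"
            using \<theta>h(4)[OF x L_Out_Gr[OF x zz(1)]] by (simp add: L_linear)
        qed (use zz in auto)
        then show ?thesis using True i by simp
      next
        case False
        then show ?thesis using \<theta> w z zB unfolding endo_def by auto
      qed
    next
      fix x z assume x: "x \<in> arcs Q" "j (head Q x) = j (tail Q x) + deg x" and z: "z \<in> Gr t (tail Q x) (j (tail Q x))"
      consider "tail Q x = v" | "head Q x = v" | "tail Q x \<noteq> v" "head Q x \<noteq> v" by blast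
      then show "(\<theta>(v := lift)) (head Q x) (L x z) - L x ((\<theta>(v := lift)) (tail Q x) z) \<in> B (head Q x) (j (head Q x))"
      proof cases
        case 1
        then have x': "x \<in> Out v" using x by auto
        show ?thesis
          using lift(2)[of z x, THEN B_sym] z 1 i out[OF x'] head_ne[OF x'] x' by simp
      next
        case 2
        \<comment> \<open>No arrow of the slice ends at \<open>v\<close>: applied to
          \<open>star x\<close>, the assumption \<open>out\<close> gives j (tail) + deg x = i + 1
          instead of i.\<close>
        have "star x \<in> Out v" using x 2 by simp
        from out[OF this] show ?thesis using x 2 i by (simp add: deg_star)
      next
        case 3
        then show ?thesis using \<theta> x z unfolding endo_def by auto
      qed
    qed
    then obtain c where c: "\<And>w z. w \<in> verts \<Gamma> \<Longrightarrow> z \<in> Gr t w (j w) \<Longrightarrow> (\<theta>(v := lift)) w z - fscale c z \<in> B w (j w)"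
      using brick unfolding brick_def by blast
    \<comment> \<open>The new C_v is generated by the neighbours, where \<open>\<theta>\<close> was
      not changed, so the same scalar acts on it.\<close>
    have cv: "\<theta> v z - fscale c z \<in> B v (i + 1)" if z: "z \<in> Gr t v (i + 1)" for z
    proof -
      obtain g where g: "\<forall>x\<in>Out v. g x \<in> Gr t (head Q x) (i + deg x)" "z = (\<Sum>x\<in>Out v. L (star x) (g x))"
        using Gr_generated[OF z gen_t] by blast
      have "\<theta> v (L (star x) (g x)) - fscale c (L (star x) (g x)) \<in> B v (i + 1)" if x: "x \<in> Out v" for x
      proof -
        have "\<theta> (head Q x) (g x) - fscale c (g x) \<in> B (head Q x) (i + deg x)"
          using c[of "head Q x" "g x"] head_verts[OF x] head_ne[OF x] out[OF x] g(1) x by auto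
        from L_star_B[OF x this] have "L (star x) (\<theta> (head Q x) (g x)) - fscale c (L (star x) (g x)) \<in> B v (i + 1)"
          by (simp add: L_linear)
        then show ?thesis using \<theta>L[OF x] g(1) x by (blast intro: B_trans)
      qed
      then have "(\<Sum>x\<in>Out v. \<theta> v (L (star x) (g x)) - fscale c (L (star x) (g x))) \<in> B v (i + 1)"
        by (rule B_sum)
      then have "(\<Sum>x\<in>Out v. \<theta> v (L (star x) (g x))) - fscale c z \<in> B v (i + 1)"
        by (simp add: sum_subtractf g(2) fv.scale_sum_right)
      moreover have "\<theta> v z - (\<Sum>x\<in>Out v. \<theta> v (L (star x) (g x))) \<in> B v (i + 1)"
        using endo_sum[OF \<theta> v, of "Out v" "\<lambda>x. L (star x) (g x)"] g(1) L_star_Gr by (simp add: g(2))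
      ultimately show ?thesis by (blast intro: B_trans)
    qed
    show "\<exists>c. \<forall>w\<in>verts \<Gamma>. \<forall>z\<in>Gr t w ((j(v := i + 1)) w). \<theta> w z - fscale c z \<in> B w ((j(v := i + 1)) w)"
    proof (intro exI[of _ c] ballI)
      fix w z assume "w \<in> verts \<Gamma>" "z \<in> Gr t w ((j(v := i + 1)) w)"
      then show "\<theta> w z - fscale c z \<in> B w ((j(v := i + 1)) w)"
        using c[of w z] cv[of z] by (cases "w = v") auto
    qed
  qed
qed

lemma noninjective_step:
  assumes brick: "brick j" and z0: "z0 \<in> Gr t v i" "z0 \<notin> B v i"
    and L0: "\<And>x. x \<in> Out v \<Longrightarrow> L x z0 \<in> B (head Q x) (i + deg x)"
  shows "epi (j(v := i + 1))"
proof (rule epi_next)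
  obtain \<xi> :: "(('v, 'e + 'e) qpath \<Rightarrow> 'k) \<Rightarrow> 'k" where
    \<xi>: "\<And>x y. \<xi> (x + y) = \<xi> x + \<xi> y" "\<And>c x. \<xi> (fscale c x) = c * \<xi> x" "\<xi> z0 = 1" "\<And>x. x \<in> B v i \<Longrightarrow> \<xi> x = 0"
    using functional_exists[OF B_subspace z0(2)] by blast
  \<comment> \<open>An endomorphism of rank one: \<open>\<xi>\<close> descends to C_v because it
    kills \<open>B v i\<close>, the arrows leaving \<open>v\<close> kill \<open>z0\<close>, and no
    arrow of the slice enters \<open>v\<close>.\<close>
  define \<theta> where "\<theta> w z = (if w = v then fscale (\<xi> z) z0 else 0)" for w :: 'v and z
  have "endo j \<theta>"
    unfolding endo_def
  proof (intro conjI ballI allI impI)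
    fix x z assume x: "x \<in> arcs Q" "j (head Q x) = j (tail Q x) + deg x" and z: "z \<in> Gr t (tail Q x) (j (tail Q x))"
    show "\<theta> (head Q x) (L x z) - L x (\<theta> (tail Q x) z) \<in> B (head Q x) (j (head Q x))"
    proof (cases "tail Q x = v")
      case True
      then have x': "x \<in> Out v" using x by auto
      then show ?thesis using L0[OF x'] head_ne[OF x'] out[OF x']
        by (auto simp: \<theta>_def L_linear intro!: B_neg B_scale)
    next
      case False
      have "head Q x \<noteq> v"
      proof
        assume h: "head Q x = v"
        then have "star x \<in> Out v" using x by simp
        from out[OF this] show False using x h i by (simp add: deg_star)
      qed
      then show ?thesis using False by (simp add: \<theta>_def L_linear)
    qed
  qed (use z0(1) i \<xi> in \<open>auto simp: \<theta>_def Gr_scale fv.scale_left_distrib\<close>)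
  then obtain c where c: "\<And>w z. w \<in> verts \<Gamma> \<Longrightarrow> z \<in> Gr t w (j w) \<Longrightarrow> \<theta> w z - fscale c z \<in> B w (j w)"
    using brick unfolding brick_def by blast
  have cz: "fscale (1 - c) z0 \<in> B v i"
    using c[OF v, of z0] z0(1) i \<xi> by (simp add: \<theta>_def fv.scale_left_diff_distrib)
  \<comment> \<open>At \<open>z0\<close> the map is the identity, which fixes the scalar. Elsewhere
    it is 0, so the scalar 1 annihilates C_w for every other vertex w.\<close>
  have "c = 1"
  proof (rule ccontr)
    assume "c \<noteq> 1"
    then show False using z0(2) B_scale[OF cz, of "inverse (1 - c)"] by simp
  qed
  then show "Gr t w (j w) \<subseteq> B w (j w)" if "w \<in> verts \<Gamma>" "w \<noteq> v" for w
    using c[OF that(1)] that(2) B_neg by (force simp: \<theta>_def)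
qed

lemma step:
  assumes "mono j \<and> brick j \<or> epi j"
  shows "mono (j(v := i + 1)) \<and> brick (j(v := i + 1)) \<or> epi (j(v := i + 1))"
proof (cases "epi j")
  case True
  then show ?thesis using epi_next unfolding epi_def by blast
next
  case False
  then show ?thesis using assms injective_step noninjective_step by blast
qed

end
end

context preproj
begin

text \<open>\<open>Gr\<close> with the end point left free. Modulo \<open>JJ\<close> this is the
  component V^s_j of the statement, whereas the slices treat one end point at a time.\<close>

definition GT :: "'v \<Rightarrow> int \<Rightarrow> (('v, 'e + 'e) qpath \<Rightarrow> 'k) set" where
  "GT s j = {f. \<forall>p. f p \<noteq> 0 \<longrightarrow> fst p = s \<and> p \<in> qpaths Q \<and> int (path_degree p) = j}"

lemma GT_subspace: "fv.subspace (GT s j)"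
  by (rule fv.subspaceI) (auto simp: GT_def fun_simps, (metis add_0)+)

lemma Gr_GT: "f \<in> Gr s v j \<Longrightarrow> f \<in> GT s j"
  by (auto simp: Gr_def GT_def gpaths_def qpaths_def)

lemma GT_decompose: "f \<in> GT s j \<Longrightarrow> f = (\<Sum>v\<in>verts \<Gamma>. restr (gpaths s v j) f)"
proof
  fix p assume f: "f \<in> GT s j"
  show "f p = (\<Sum>v\<in>verts \<Gamma>. restr (gpaths s v j) f) p"
  proof (cases "f p = 0")
    case True
    then show ?thesis by (simp add: sum_fun_apply restr_def)
  next
    case False
    then have p: "fst p = s" "p \<in> qpaths Q" "int (path_degree p) = j"
      using f unfolding GT_def by blast+
    then obtain u where u: "p \<in> gpaths s u j"
      using qpaths_iff[of "fst p" "snd p"] by (auto simp: gpaths_def)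
    then have "p \<in> gpaths s v j \<longleftrightarrow> v = u" for v
      using wk_unique by (auto simp: gpaths_def)
    moreover have "u \<in> verts \<Gamma>" using u wk_verts by (auto simp: gpaths_def)
    ultimately show ?thesis by (simp add: sum_fun_apply restr_def)
  qed
qed

end

section \<open>Sweeping through the slices in the order of the numbering\<close>

context mesh_map
begin

text \<open>In row \<open>q\<close> the vertices pass from degree q to q + 1 in increasing order of
  \<open>pos\<close>. The arrows of the next vertex then all leave it: old ones lead to larger
  positions, still in degree q, new ones to smaller positions, already in degree q + 1. The value 0
  off the vertex set makes the end of a row equal, as a function, to the beginning of the
  next.\<close>

definition slice :: "int \<Rightarrow> nat \<Rightarrow> 'v \<Rightarrow> int" where
  "slice q r v = (if v \<in> verts \<Gamma> then if pos v < r then q + 1 else q else 0)"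

lemma slice_wrap: "slice q nv = slice (q + 1) 0"
  using pos_bound by (auto simp: slice_def fun_eq_iff)

lemma w_nonzero: "\<alpha> \<in> A \<Longrightarrow> \<exists>x. w \<alpha> x \<noteq> 0"
proof (rule ccontr)
  assume \<alpha>: "\<alpha> \<in> A" and "\<nexists>x. w \<alpha> x \<noteq> 0"
  then have "(\<Sum>\<alpha>'\<in>A. (if \<alpha>' = \<alpha> then 1 else 0) * w \<alpha>' x) = 0" for x
    by (intro sum.neutral) auto
  from w_indep[rule_format, OF this \<alpha>] show False by simp
qed

lemma slice_step:
  assumes r: "r < nv" and q: "q \<ge> 0" "q = 0 \<Longrightarrow> pos t \<le> r"
    and P: "mono (slice q r) \<and> brick (slice q r) \<or> epi (slice q r)"
  shows "mono (slice q (Suc r)) \<and> brick (slice q (Suc r)) \<or> epi (slice q (Suc r))"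
proof -
  obtain v where v: "v \<in> verts \<Gamma>" "pos v = r"
    using pos_bij r by (metis bij_betw_def imageE lessThan_iff)
  have inj: "u = v" if "u \<in> verts \<Gamma>" "pos u = r" for u
    using pos_bij v that by (auto simp: bij_betw_def inj_on_def)
  have eq: "slice q (Suc r) = (slice q r)(v := q + 1)"
  proof
    fix u show "slice q (Suc r) u = ((slice q r)(v := q + 1)) u"
    proof (cases "u = v")
      case False
      then have "u \<in> verts \<Gamma> \<Longrightarrow> pos u \<noteq> r" using inj by blast
      then show ?thesis using False by (simp add: slice_def less_Suc_eq)
    qed (simp add: v slice_def)
  qed
  show ?thesis unfolding eq
  proof (rule step)
    show "v \<in> verts \<Gamma>" by (rule v)
    show "slice q r v = q" using v by (simp add: slice_def)
    show "slice q r (head Q x) = q + deg x" if "x \<in> Out v" for x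
      using that v pos_less by (cases x) (fastforce simp: slice_def)+
    \<comment> \<open>A generator in degree q + 1 > 0 forces q = 0 and
      \<open>dg \<alpha> = 1\<close>. Then a new arrow leads from \<open>t\<close> to
      \<open>v\<close>, so \<open>v\<close> precedes \<open>t\<close> in the numbering, against
      \<open>pos t\<close> at most \<open>r\<close>.\<close>
    show "\<not> (nd \<alpha> = v \<and> q + 1 = dg \<alpha>)" if \<alpha>: "\<alpha> \<in> A" for \<alpha>
    proof
      assume *: "nd \<alpha> = v \<and> q + 1 = dg \<alpha>"
      obtain x where "w \<alpha> x \<noteq> 0" using w_nonzero[OF \<alpha>] by blast
      then have x: "x \<in> arcs Q" "tail Q x = t" "head Q x = v" "deg x = q + 1"
        using w_support[OF \<alpha>] * by auto
      then show False using q v pos_less by (cases x) fastforce+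
    qed
    show "\<not> (t = v \<and> q + 1 = 0)" using q by simp
  qed (rule P)
qed

lemma gpaths_zero:
  assumes "p \<in> gpaths t v 0"
  shows "pos t \<le> pos v" "v = t \<Longrightarrow> p = (t, [])"
proof -
  obtain es where es: "p = (t, es)" "wk t es v" "path_degree (t, es) = 0"
    using assms by (cases p) (auto simp: gpaths_def)
  have "int (length es) \<le> int (pos v) - int (pos t)"
    using wk_length[OF es(2)] es(3) by simp
  then show "pos t \<le> pos v" "v = t \<Longrightarrow> p = (t, [])" using es(1) by auto
qed

lemma gpaths_negative: "j < 0 \<Longrightarrow> gpaths s v j = {}"
  by (auto simp: gpaths_def)

text \<open>From \<open>t\<close> no path leads to a position one degree below this slice: its
  degree would be negative, or 0 at a vertex before \<open>t\<close>. Hence a relation splits into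
  one relation for each arrow, and independence of the \<open>w \<alpha>\<close> splits these
  further.\<close>

lemma slice_start_mono: "mono (slice 0 (pos t))"
  unfolding mono_def
proof (intro ballI impI)
  fix v y \<beta> assume v: "v \<in> verts \<Gamma>" and y: "y \<in> Ys v (slice 0 (pos t) v)" and fmy: "fm y \<in> JJ"
    and \<beta>: "\<beta> \<in> A"
  let ?j = "slice 0 (pos t) v"
  define h where "h x = (\<Sum>\<alpha>\<in>A. fscale (w \<alpha> x) (y \<alpha>))" for x
  have "fm y = (\<Sum>x\<in>arcs Q. R x (h x))"
    unfolding fm_def h_def R_sum R_linear by (rule sum.swap)
  also have "\<dots> = (\<Sum>x\<in>Out t. R x (h x))"
  proof (rule sum.mono_neutral_right)
    show "\<forall>x\<in>arcs Q - Out t. R x (h x) = 0"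
    proof
      fix x assume "x \<in> arcs Q - Out t"
      then have "h x = 0" unfolding h_def using w_support by (intro sum.neutral) (auto simp: fun_simps)
      then show "R x (h x) = 0" by (simp add: R_linear)
    qed
  qed auto
  finally have sum: "(\<Sum>x\<in>Out t. R x (h x)) \<in> JJ" using fmy by simp
  have hJ: "h x \<in> JJ" for x
  proof (cases "x \<in> Out t")
    case True
    show ?thesis
    proof (rule right_exact_initial[OF _ sum _ True])
      fix x assume "x \<in> Out t"
      show "h x \<in> Gr (head Q x) v (?j - deg x)"
        unfolding h_def
      proof (rule Gr_sum)
        fix \<alpha> assume \<alpha>: "\<alpha> \<in> A"
        show "fscale (w \<alpha> x) (y \<alpha>) \<in> Gr (head Q x) v (?j - deg x)"
        proof (cases "w \<alpha> x = 0")
          case False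
          then show ?thesis using w_support[OF \<alpha> False] y \<alpha> by (auto simp: Ys_def intro: Gr_scale)
        qed simp
      qed
    next
      show "gpaths t v (?j - 1) = {}"
      proof (cases "pos v < pos t")
        case True
        then show ?thesis using gpaths_zero(1)[of _ v] v by (auto simp: slice_def)
      next
        case False
        then show ?thesis by (simp add: gpaths_negative slice_def)
      qed
    qed
  next
    case False
    then have "h x = 0" unfolding h_def using w_support by (intro sum.neutral) (auto simp: fun_simps)
    then show ?thesis by simp
  qed
  \<comment> \<open>A functional that kills \<open>JJ\<close> turns the vectors \<open>h x\<close>
    into scalar relations among the \<open>w \<alpha>\<close>, to which \<open>w_indep\<close>
    applies.\<close>
  show "y \<beta> \<in> JJ"
  proof (rule ccontr)
    assume "y \<beta> \<notin> JJ"
    then obtain \<xi> :: "(('v, 'e + 'e) qpath \<Rightarrow> 'k) \<Rightarrow> 'k" where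
      \<xi>: "\<And>x y. \<xi> (x + y) = \<xi> x + \<xi> y" "\<And>c x. \<xi> (fscale c x) = c * \<xi> x" "\<xi> (y \<beta>) = 1" "\<And>x. x \<in> JJ \<Longrightarrow> \<xi> x = 0"
      using functional_exists[OF JJ_subspace] by blast
    have \<xi>0: "\<xi> 0 = 0" using \<xi>(4)[of 0] by simp
    have "\<xi> (\<Sum>\<alpha>\<in>S. f \<alpha>) = (\<Sum>\<alpha>\<in>S. \<xi> (f \<alpha>))" for S and f :: "'c \<Rightarrow> _"
      by (induction S rule: infinite_finite_induct) (simp_all add: \<xi>0 \<xi>(1))
    then have "(\<Sum>\<alpha>\<in>A. \<xi> (y \<alpha>) * w \<alpha> x) = \<xi> (h x)" for x
      by (simp add: h_def \<xi>(2) mult.commute)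
    then have "(\<Sum>\<alpha>\<in>A. \<xi> (y \<alpha>) * w \<alpha> x) = 0" for x
      using \<xi>(4)[OF hJ[of x]] by simp
    from w_indep[rule_format, OF this \<beta>] \<xi>(3) show False by simp
  qed
qed

text \<open>In the slice just after \<open>t\<close> has been passed, $C$ is generated by the trivial path at \<open>t\<close>.\<close>

lemma slice_start_brick: "brick (slice 0 (pos t))"
  unfolding brick_def
proof (intro allI impI)
  let ?j = "slice 0 (pos t)"
  let ?e = "path_elt (t, []) :: ('v, 'e + 'e) qpath \<Rightarrow> 'k"
  fix \<theta> assume \<theta>: "endo ?j \<theta>"
  have jt: "?j t = 0" by (simp add: slice_def)
  have "?e \<in> Gr t t 0" using t by (auto simp: Gr_def path_elt_def gpaths_def)
  then have "\<theta> t ?e \<in> Gr t t 0" using \<theta> t jt unfolding endo_def by metis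
  \<comment> \<open>The trivial path is the only path of degree 0 from \<open>t\<close> to itself,
    so \<open>\<theta>\<close> can only rescale it.\<close>
  then have "\<theta> t ?e p = 0" if "p \<noteq> (t, [])" for p
    using gpaths_zero(2)[of p t] that unfolding Gr_def by blast
  then obtain c where c: "\<theta> t ?e = fscale c ?e"
    by (auto simp: fun_eq_iff fun_simps path_elt_def intro!: that[of "\<theta> t ?e (t, [])"])
  have elt: "path_elt p \<in> Gr t v i" if "p \<in> gpaths t v i" for p v i
    using that by (auto simp: Gr_def path_elt_def)
  have tail_slice: "?j (tail Q x) = ?j (head Q x) - deg x"
    \<comment> \<open>A path from \<open>t\<close> to the slice stays on the slice: one step back
      and off the slice would be a position of negative degree, or of degree 0 before
      \<open>t\<close>, which no path from \<open>t\<close> reaches.\<close>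
    if x: "x \<in> arcs Q" and p: "p \<in> gpaths t (tail Q x) (?j (head Q x) - deg x)" for x p
  proof (cases x)
    case (Inl \<gamma>)
    then have less: "pos (tail Q x) < pos (head Q x)" using x pos_less by simp
    show ?thesis
    proof (cases "pos (head Q x) < pos t")
      case True
      then show ?thesis using less x Inl by (simp add: slice_def)
    next
      case False
      then have "p \<in> gpaths t (tail Q x) 0" using p x Inl by (simp add: slice_def)
      from gpaths_zero(1)[OF this] show ?thesis using False x Inl by (simp add: slice_def)
    qed
  next
    case (Inr \<gamma>)
    show ?thesis
    proof (cases "pos (head Q x) < pos t")
      case True
      then have "p \<in> gpaths t (tail Q x) 0" using p x Inr by (simp add: slice_def)
      from gpaths_zero(1)[OF this] show ?thesis using True x Inr by (simp add: slice_def)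
    next
      case False
      then show ?thesis using p gpaths_negative[of "?j (head Q x) - deg x"] Inr by (simp add: slice_def)
    qed
  qed
  have path: "\<theta> v (path_elt (t, es)) - fscale c (path_elt (t, es)) \<in> B v (?j v)"
    if "(t, es) \<in> gpaths t v (?j v)" for v es
    using that
  proof (induction es arbitrary: v rule: rev_induct)
    case Nil
    then have "v = t" by (simp add: gpaths_Nil)
    then show ?case by (simp add: c)
  next
    case (snoc x es)
    then have x: "x \<in> arcs Q" "v = head Q x" and es: "(t, es) \<in> gpaths t (tail Q x) (?j v - deg x)"
      unfolding gpaths_snoc by blast+
    have j: "?j (tail Q x) = ?j v - deg x" using tail_slice x es by simp
    have "\<theta> (tail Q x) (path_elt (t, es)) - fscale c (path_elt (t, es)) \<in> B (tail Q x) (?j (tail Q x))"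
      using snoc.IH[of "tail Q x"] es j by simp
    then have 1: "L x (\<theta> (tail Q x) (path_elt (t, es))) - fscale c (L x (path_elt (t, es))) \<in> B v (?j v)"
      using L_B[OF x(1), of _ "?j (tail Q x)" "?j v"] x j by (simp add: L_linear(2,4)[symmetric])
    have "path_elt (t, es) \<in> Gr t (tail Q x) (?j (tail Q x))" using elt es j by simp
    moreover have "?j (head Q x) = ?j (tail Q x) + deg x" using j x by simp
    ultimately have "\<theta> v (L x (path_elt (t, es))) - L x (\<theta> (tail Q x) (path_elt (t, es))) \<in> B v (?j v)"
      using \<theta> x unfolding endo_def by metis
    from B_trans[OF this 1] have "\<theta> v (L x (path_elt (t, es))) - fscale c (L x (path_elt (t, es))) \<in> B v (?j v)" .
    moreover have "L x (path_elt (t, es)) = path_elt (t, es @ [x])"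
    proof -
      have "wk t (es @ [x]) v" using snoc.prems by (simp add: gpaths_def)
      then show ?thesis unfolding L_path_elt by metis
    qed
    ultimately show ?case by simp
  qed
  have "\<theta> v z - fscale c z \<in> B v (?j v)" if v: "v \<in> verts \<Gamma>" and z: "z \<in> Gr t v (?j v)" for v z
  proof -
    let ?G = "gpaths t v (?j v)"
    let ?f = "\<lambda>p. fscale (z p) (path_elt p)"
    have f: "?f p \<in> Gr t v (?j v)" if "p \<in> ?G" for p using elt[OF that] by (rule Gr_scale)
    have "\<theta> v (?f p) - fscale c (?f p) \<in> B v (?j v)" if p: "p \<in> ?G" for p
    proof -
      have "\<theta> v (?f p) - fscale (z p) (\<theta> v (path_elt p)) \<in> B v (?j v)"
        using \<theta> v elt[OF p] unfolding endo_def by blast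
      moreover have "fscale (z p) (\<theta> v (path_elt p) - fscale c (path_elt p)) \<in> B v (?j v)"
        using path[of "snd p" v] p by (intro B_scale) (cases p, auto simp: gpaths_def)
      then have "fscale (z p) (\<theta> v (path_elt p)) - fscale c (?f p) \<in> B v (?j v)"
        by (simp add: fv.scale_right_diff_distrib mult.commute)
      ultimately show ?thesis by (rule B_trans)
    qed
    then have "(\<Sum>p\<in>?G. \<theta> v (?f p) - fscale c (?f p)) \<in> B v (?j v)" by (rule B_sum)
    then have "(\<Sum>p\<in>?G. \<theta> v (?f p)) - fscale c (\<Sum>p\<in>?G. ?f p) \<in> B v (?j v)"
      by (simp add: sum_subtractf fv.scale_sum_right)
    moreover have "\<theta> v (\<Sum>p\<in>?G. ?f p) - (\<Sum>p\<in>?G. \<theta> v (?f p)) \<in> B v (?j v)"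
      by (rule endo_sum[OF \<theta> v f])
    ultimately have "\<theta> v (\<Sum>p\<in>?G. ?f p) - fscale c (\<Sum>p\<in>?G. ?f p) \<in> B v (?j v)"
      by (blast intro: B_trans)
    then show ?thesis using Gr_expand[OF z] by simp
  qed
  then show "\<exists>c. \<forall>v\<in>verts \<Gamma>. \<forall>z\<in>Gr t v (?j v). \<theta> v z - fscale c z \<in> B v (?j v)" by blast
qed

lemma slice_row:
  assumes "r \<le> r'" "r' \<le> nv" "q \<ge> 0" "q = 0 \<Longrightarrow> pos t \<le> r"
    "mono (slice q r) \<and> brick (slice q r) \<or> epi (slice q r)"
  shows "mono (slice q r') \<and> brick (slice q r') \<or> epi (slice q r')"
  using assms
proof (induction r' rule: dec_induct)
  case (step n)
  then show ?case by (intro slice_step) auto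
qed

text \<open>Row 0 is entered in the middle, at \<open>pos t\<close>; every later row is swept
  completely. The completed row \<open>q\<close> ends in degree q + 1.\<close>

lemma slice_all: "mono (slice (int q + 1) 0) \<and> brick (slice (int q + 1) 0) \<or> epi (slice (int q + 1) 0)"
proof (induction q)
  case 0
  have "mono (slice 0 nv) \<and> brick (slice 0 nv) \<or> epi (slice 0 nv)"
    using slice_row[of "pos t" nv 0] pos_bound[OF t] slice_start_mono slice_start_brick by simp
  then show ?case by (simp add: slice_wrap)
next
  case (Suc q)
  have "mono (slice (int q + 1) nv) \<and> brick (slice (int q + 1) nv) \<or> epi (slice (int q + 1) nv)"
    using slice_row[of 0 nv "int q + 1"] Suc by simp
  then show ?case by (simp add: slice_wrap add.commute)
qed

lemma fm_restr:
  "restr (gpaths t v j) (fm y) = fm (\<lambda>\<alpha>. restr (gpaths (nd \<alpha>) v (j - dg \<alpha>)) (y \<alpha>))"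
proof -
  have "restr (gpaths t v j) (fscale (w \<alpha> x) (R x (y \<alpha>))) =
      fscale (w \<alpha> x) (R x (restr (gpaths (nd \<alpha>) v (j - dg \<alpha>)) (y \<alpha>)))" if \<alpha>: "\<alpha> \<in> A" for \<alpha> x
  proof (cases "w \<alpha> x = 0")
    case False
    then show ?thesis
      using w_support[OF \<alpha> False] R_restr[of x j "j - dg \<alpha>" v "y \<alpha>"] by (auto simp: restr_linear)
  qed (simp add: restr_linear)
  then show ?thesis by (simp add: fm_def restr_sum)
qed

text \<open>On \<open>slice d 0\<close> every vertex has degree \<open>d\<close>, so summing over
  the end points recovers whole components. As the sweep starts in row 0, the first such slice is
  the one with d = 1.\<close>

theorem mono_or_epi:
  assumes d: "d > 0"
  shows "(\<forall>y. (\<forall>\<alpha>\<in>A. y \<alpha> \<in> GT (nd \<alpha>) (d - dg \<alpha>)) \<longrightarrow> fm y \<in> JJ \<longrightarrow> (\<forall>\<alpha>\<in>A. y \<alpha> \<in> JJ)) \<or>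
    (\<forall>z\<in>GT t d. \<exists>y. (\<forall>\<alpha>\<in>A. y \<alpha> \<in> GT (nd \<alpha>) (d - dg \<alpha>)) \<and> z - fm y \<in> JJ)"
proof -
  have "d = int (nat (d - 1)) + 1" using d by simp
  then have "mono (slice d 0) \<or> epi (slice d 0)"
    using slice_all[of "nat (d - 1)"] by auto
  then show ?thesis
  proof
    assume mono: "mono (slice d 0)"
    have "y \<alpha> \<in> JJ" if y: "\<forall>\<alpha>\<in>A. y \<alpha> \<in> GT (nd \<alpha>) (d - dg \<alpha>)" "fm y \<in> JJ" and \<alpha>: "\<alpha> \<in> A" for y \<alpha>
    proof -
      let ?y = "\<lambda>v \<alpha>. restr (gpaths (nd \<alpha>) v (d - dg \<alpha>)) (y \<alpha>)"
      have "?y v \<alpha> \<in> JJ" if v: "v \<in> verts \<Gamma>" for v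
      proof -
        have "?y v \<in> Ys v (slice d 0 v)" using v by (simp add: Ys_def slice_def)
        moreover have "fm (?y v) \<in> JJ" using restr_JJ[OF y(2)] fm_restr by metis
        ultimately show ?thesis using mono v \<alpha> unfolding mono_def by blast
      qed
      then have "(\<Sum>v\<in>verts \<Gamma>. ?y v \<alpha>) \<in> JJ" by (rule JJ_sum)
      then show ?thesis using GT_decompose[of "y \<alpha>"] y(1) \<alpha> by metis
    qed
    then show ?thesis by blast
  next
    assume epi: "epi (slice d 0)"
    have "\<exists>y. (\<forall>\<alpha>\<in>A. y \<alpha> \<in> GT (nd \<alpha>) (d - dg \<alpha>)) \<and> z - fm y \<in> JJ" if z: "z \<in> GT t d" for z
    proof -
      have "\<exists>y\<in>Ys v d. restr (gpaths t v d) z - fm y \<in> JJ" if v: "v \<in> verts \<Gamma>" for v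
      proof -
        have "slice d 0 v = d" using v by (simp add: slice_def)
        then have "Gr t v d \<subseteq> B v d" using epi v unfolding epi_def by metis
        then show ?thesis using restr_Gr[of t v d z] unfolding B_def by blast
      qed
      then have "\<forall>v\<in>verts \<Gamma>. \<exists>y. y \<in> Ys v d \<and> restr (gpaths t v d) z - fm y \<in> JJ" by blast
      from bchoice[OF this] obtain Y where
        Y: "\<And>v. v \<in> verts \<Gamma> \<Longrightarrow> Y v \<in> Ys v d \<and> restr (gpaths t v d) z - fm (Y v) \<in> JJ" by blast
      let ?y = "\<lambda>\<alpha>. \<Sum>v\<in>verts \<Gamma>. Y v \<alpha>"
      have "(\<Sum>v\<in>verts \<Gamma>. restr (gpaths t v d) z - fm (Y v)) \<in> JJ"
        using Y by (intro JJ_sum) auto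
      then have "z - fm ?y \<in> JJ"
        using GT_decompose[OF z] by (simp add: sum_subtractf fm_sum)
      moreover have "?y \<alpha> \<in> GT (nd \<alpha>) (d - dg \<alpha>)" if \<alpha>: "\<alpha> \<in> A" for \<alpha>
      proof (rule fv.subspace_sum[OF GT_subspace])
        fix v assume "v \<in> verts \<Gamma>"
        then have "Y v \<alpha> \<in> Gr (nd \<alpha>) v (d - dg \<alpha>)" using Y \<alpha> unfolding Ys_def by blast
        then show "Y v \<alpha> \<in> GT (nd \<alpha>) (d - dg \<alpha>)" by (rule Gr_GT)
      qed
      ultimately show ?thesis by (intro exI[of _ ?y] conjI ballI)
    qed
    then show ?thesis by blast
  qed
qed

end

section \<open>Independence modulo a subspace\<close>

text \<open>Over a finite field, the product of all X - a increased by 1 would be nonconstant and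
  without roots.\<close>

lemma infinite_alg_closed_field: "infinite (UNIV :: 'k::alg_closed_field set)"
proof
  assume fin: "finite (UNIV :: 'k set)"
  define p where "p = (\<Prod>a\<in>(UNIV :: 'k set). [:- a, 1:]) + 1"
  have deg: "degree (\<Prod>a\<in>(UNIV :: 'k set). [:- a, 1:]) = card (UNIV :: 'k set)"
    by (subst degree_prod_eq_sum_degree) auto
  moreover have "card (UNIV :: 'k set) > 0" using fin by (simp add: card_gt_0_iff)
  ultimately have "degree p > 0" by (simp add: p_def degree_add_eq_left)
  then obtain x where "poly p x = 0" using alg_closed_imp_poly_has_root by blast
  moreover have "poly p x = 1" using fin by (simp add: p_def poly_prod prod_zero_iff)
  ultimately show False by simp
qed

section \<open>Polynomial functions, determinants and independence\<close>

lemma polynomial_functions_sum: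
  "(\<And>i. i \<in> I \<Longrightarrow> f i \<in> polynomial_functions C) \<Longrightarrow> (\<lambda>x. \<Sum>i\<in>I. f i x) \<in> polynomial_functions C"
  by (induction I rule: infinite_finite_induct) (auto intro: polynomial_functions.intros)

lemma polynomial_functions_prod:
  "(\<And>i. i \<in> I \<Longrightarrow> f i \<in> polynomial_functions C) \<Longrightarrow> (\<lambda>x. \<Prod>i\<in>I. f i x) \<in> polynomial_functions C"
  by (induction I rule: infinite_finite_induct) (auto intro: polynomial_functions.intros)

text \<open>On a line, nonvanishing at one point gives nonvanishing outside finitely many
  parameters. Both the perturbation of a family and the density of the open set rest on
  this.\<close>

lemma polynomial_function_on_line:
  assumes "f \<in> polynomial_functions C" and "\<And>g. g \<in> C \<Longrightarrow> \<exists>p q. \<forall>\<epsilon>. g (line \<epsilon>) = p + \<epsilon> * q"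
  shows "\<exists>p. \<forall>\<epsilon>. f (line \<epsilon>) = poly p \<epsilon>"
  using assms(1)
proof induction
  case (const c)
  show ?case by (intro exI[of _ "[:c:]"]) simp
next
  case (coord f)
  then obtain p q where "\<forall>\<epsilon>. f (line \<epsilon>) = p + \<epsilon> * q" using assms(2) by blast
  then show ?case by (intro exI[of _ "[:p, q:]"]) simp
next
  case (add f g)
  then show ?case by (metis poly_add)
next
  case (mult f g)
  then show ?case by (metis poly_mult)
qed

text \<open>Rows and columns use the same enumeration of \<open>S\<close>, so its choice does not
  affect the value. This spares an ordering of index sets made of pairs and triples.\<close>

definition family_det :: "'s set \<Rightarrow> ('s \<Rightarrow> 's \<Rightarrow> 'k::field) \<Rightarrow> 'k" where
  "family_det S E = (let h = (SOME h. bij_betw h {0..<card S} S)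
     in det (mat (card S) (card S) (\<lambda>(i, j). E (h i) (h j))))"

lemma family_enum:
  assumes "finite S"
  obtains h where "bij_betw h {0..<card S} S"
    "\<And>E. family_det S E = det (mat (card S) (card S) (\<lambda>(i, j). E (h i) (h j)))"
  using someI_ex[OF ex_bij_betw_nat_finite[OF assms]] unfolding family_det_def Let_def by blast

lemma family_det_cong:
  fixes E E' :: "'s \<Rightarrow> 's \<Rightarrow> 'k::field"
  assumes "finite S" "\<And>s s'. s \<in> S \<Longrightarrow> s' \<in> S \<Longrightarrow> E s s' = E' s s'"
  shows "family_det S E = family_det S E'"
proof -
  obtain h where h: "bij_betw h {0..<card S} S"
    "\<And>E :: 's \<Rightarrow> 's \<Rightarrow> 'k. family_det S E = det (mat (card S) (card S) (\<lambda>(i, j). E (h i) (h j)))"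
    using family_enum[OF assms(1)] by metis
  have hS: "i < card S \<Longrightarrow> h i \<in> S" for i using h(1) by (auto simp: bij_betw_def)
  show ?thesis unfolding h(2)
    by (intro arg_cong[of _ _ det] eq_matI) (simp_all add: assms(2) hS)
qed

lemma family_det_one:
  fixes E :: "'s \<Rightarrow> 's \<Rightarrow> 'k::field"
  assumes "finite S" "\<And>s s'. s \<in> S \<Longrightarrow> s' \<in> S \<Longrightarrow> E s s' = (if s = s' then 1 else 0)"
  shows "family_det S E = 1"
proof -
  obtain h where h: "bij_betw h {0..<card S} S"
    "family_det S E = det (mat (card S) (card S) (\<lambda>(i, j). E (h i) (h j)))"
    using family_enum[OF assms(1)] by metis
  have "mat (card S) (card S) (\<lambda>(i, j). E (h i) (h j)) = 1\<^sub>m (card S)"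
  proof (rule eq_matI)
    fix i j assume "i < dim_row (1\<^sub>m (card S) :: 'k mat)" "j < dim_col (1\<^sub>m (card S) :: 'k mat)"
    then have ij: "i < card S" "j < card S" by simp_all
    then have "h i \<in> S" "h j \<in> S" "h i = h j \<longleftrightarrow> i = j"
      using h(1) by (auto simp: bij_betw_def inj_on_def)
    then show "mat (card S) (card S) (\<lambda>(i, j). E (h i) (h j)) $$ (i, j) = 1\<^sub>m (card S) $$ (i, j)"
      using assms(2) ij by simp
  qed simp_all
  then show ?thesis using h(2) by simp
qed

lemma family_det_kernel:
  fixes E :: "'s \<Rightarrow> 's \<Rightarrow> 'k::field"
  assumes "finite S" "family_det S E \<noteq> 0" "\<And>s. s \<in> S \<Longrightarrow> (\<Sum>s'\<in>S. E s s' * c s') = 0" "s \<in> S"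
  shows "c s = 0"
proof -
  obtain h where h: "bij_betw h {0..<card S} S"
    "family_det S E = det (mat (card S) (card S) (\<lambda>(i, j). E (h i) (h j)))"
    using family_enum[OF assms(1)] by metis
  let ?n = "card S"
  let ?M = "mat ?n ?n (\<lambda>(i, j). E (h i) (h j))" and ?v = "vec ?n (\<lambda>i. c (h i))"
  have "?M *\<^sub>v ?v = 0\<^sub>v ?n"
  proof (rule eq_vecI)
    fix i assume "i < dim_vec (0\<^sub>v ?n :: 'k vec)"
    then have i: "i < ?n" by simp
    then have "(?M *\<^sub>v ?v) $ i = (\<Sum>j = 0..<?n. E (h i) (h j) * c (h j))"
      by (simp add: scalar_prod_def)
    also have "\<dots> = (\<Sum>s'\<in>S. E (h i) s' * c s')"
      using sum.reindex_bij_betw[OF h(1), of "\<lambda>s'. E (h i) s' * c s'"] by simp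
    also have "\<dots> = 0" using h(1) i by (intro assms(3)) (auto simp: bij_betw_def)
    finally show "(?M *\<^sub>v ?v) $ i = 0\<^sub>v ?n $ i" using i by simp
  qed simp
  then have "?v = 0\<^sub>v ?n"
    using det_0_iff_vec_prod_zero_field[of ?M ?n] assms(2) h(2) by (metis mat_carrier vec_carrier)
  moreover obtain i where "i < ?n" "s = h i" using h(1) assms(4) unfolding bij_betw_def by (metis atLeastLessThan_iff imageE)
  ultimately show ?thesis by (metis index_vec index_zero_vec(1))
qed

lemma family_det_polynomial:
  fixes f :: "'s \<Rightarrow> 's \<Rightarrow> 'x \<Rightarrow> 'k::field"
  assumes "finite S" "\<And>s s'. s \<in> S \<Longrightarrow> s' \<in> S \<Longrightarrow> (\<lambda>x. f s s' x) \<in> polynomial_functions C"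
  shows "(\<lambda>x. family_det S (\<lambda>s s'. f s s' x)) \<in> polynomial_functions C"
proof -
  obtain h where h: "bij_betw h {0..<card S} S"
    "\<And>E :: 's \<Rightarrow> 's \<Rightarrow> 'k. family_det S E = det (mat (card S) (card S) (\<lambda>(i, j). E (h i) (h j)))"
    using family_enum[OF assms(1)] by metis
  let ?n = "card S"
  have "family_det S (\<lambda>s s'. f s s' x) =
      (\<Sum>p \<in> {p. p permutes {0 ..< ?n}}. signof p * (\<Prod>i = 0 ..< ?n. f (h i) (h (p i)) x))" for x
    unfolding h(2) by (subst det_def'[of _ ?n]) (auto intro!: sum.cong prod.cong simp: permutes_in_image)
  moreover have "(\<lambda>x. \<Sum>p \<in> {p. p permutes {0 ..< ?n}}. signof p * (\<Prod>i = 0 ..< ?n. f (h i) (h (p i)) x))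
      \<in> polynomial_functions C"
  proof (intro polynomial_functions_sum polynomial_functions.mult polynomial_functions.const polynomial_functions_prod)
    fix p i assume "p \<in> {p. p permutes {0 ..< ?n}}" "i \<in> {0..<?n}"
    then have "i < ?n" "p i < ?n" using permutes_in_image[of p "{0..<?n}" i] by auto
    then show "f (h i) (h (p i)) \<in> polynomial_functions C"
      using h(1) by (intro assms(2)) (auto simp: bij_betw_def)
  qed
  ultimately show ?thesis by simp
qed

text \<open>Independence in the quotient by \<open>J\<close>, expressed on representatives, and for
  families: a repeated member makes the family dependent.\<close>

definition indep_mod :: "('p \<Rightarrow> 'k::field) set \<Rightarrow> 's set \<Rightarrow> ('s \<Rightarrow> 'p \<Rightarrow> 'k) \<Rightarrow> bool" where
  "indep_mod J S v \<longleftrightarrow> (\<forall>c. (\<Sum>s\<in>S. fscale (c s) (v s)) \<in> J \<longrightarrow> (\<forall>s\<in>S. c s = 0))"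

definition functional_mod :: "('p \<Rightarrow> 'k::field) set \<Rightarrow> (('p \<Rightarrow> 'k) \<Rightarrow> 'k) \<Rightarrow> bool" where
  "functional_mod J \<xi> \<longleftrightarrow> (\<forall>x y. \<xi> (x + y) = \<xi> x + \<xi> y) \<and> (\<forall>c x. \<xi> (fscale c x) = c * \<xi> x) \<and> (\<forall>x\<in>J. \<xi> x = 0)"

lemma functional_mod_sum:
  assumes "functional_mod J \<xi>"
  shows "\<xi> (\<Sum>s\<in>S. f s) = (\<Sum>s\<in>S. \<xi> (f s))"
proof -
  have "\<xi> 0 = 0" using assms unfolding functional_mod_def by (metis fv.scale_zero_left mult_zero_left)
  then show ?thesis using assms
    by (induction S rule: infinite_finite_induct) (simp_all add: functional_mod_def)
qed

text \<open>By independence \<open>v s\<close> lies outside \<open>K\<close>, the span of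
  \<open>J\<close> and the other members, so some functional is 1 on it and 0 on
  \<open>K\<close>.\<close>

lemma dual_family:
  assumes J: "fv.subspace J" and S: "finite S" and v: "indep_mod J S v"
  shows "\<exists>\<xi>. \<forall>s\<in>S. functional_mod J (\<xi> s) \<and> (\<forall>s'\<in>S. \<xi> s (v s') = (if s = s' then 1 else 0))"
proof -
  have "\<exists>\<xi>. functional_mod J \<xi> \<and> (\<forall>s'\<in>S. \<xi> (v s') = (if s = s' then 1 else 0))" if s: "s \<in> S" for s
  proof -
    define K where "K = {x. \<exists>c. x - (\<Sum>s'\<in>S - {s}. fscale (c s') (v s')) \<in> J}"
    have K: "fv.subspace K"
    proof (rule fv.subspaceI)
      show "0 \<in> K" unfolding K_def by (intro CollectI exI[of _ "\<lambda>_. 0"]) (simp add: fv.subspace_0[OF J])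
    next
      fix x y assume "x \<in> K" "y \<in> K"
      then obtain c c' where "x - (\<Sum>s'\<in>S - {s}. fscale (c s') (v s')) \<in> J"
          "y - (\<Sum>s'\<in>S - {s}. fscale (c' s') (v s')) \<in> J" by (auto simp: K_def)
      from fv.subspace_add[OF J this] have "x + y - (\<Sum>s'\<in>S - {s}. fscale (c s' + c' s') (v s')) \<in> J"
        by (simp add: fv.scale_left_distrib sum.distrib algebra_simps)
      then show "x + y \<in> K" unfolding K_def by (intro CollectI exI[of _ "\<lambda>s'. c s' + c' s'"])
    next
      fix e x assume "x \<in> K"
      then obtain c where "x - (\<Sum>s'\<in>S - {s}. fscale (c s') (v s')) \<in> J" by (auto simp: K_def)
      from fv.subspace_scale[OF J this, of e]
      have "fscale e x - (\<Sum>s'\<in>S - {s}. fscale (e * c s') (v s')) \<in> J"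
        by (simp add: fv.scale_right_diff_distrib fv.scale_sum_right)
      then show "fscale e x \<in> K" unfolding K_def by (intro CollectI exI[of _ "\<lambda>s'. e * c s'"])
    qed
    have "v s \<notin> K"
    proof
      assume "v s \<in> K"
      then obtain c where c: "v s - (\<Sum>s'\<in>S - {s}. fscale (c s') (v s')) \<in> J" by (auto simp: K_def)
      have "(\<Sum>s'\<in>S. fscale (if s' = s then 1 else - c s') (v s')) = v s - (\<Sum>s'\<in>S - {s}. fscale (c s') (v s'))"
        using S s by (simp add: sum.remove[of S s] sum_negf)
      then have "(\<Sum>s'\<in>S. fscale (if s' = s then 1 else - c s') (v s')) \<in> J" using c by simp
      from v[unfolded indep_mod_def, rule_format, OF this s] show False by simp
    qed
    from functional_exists[OF K this] obtain \<xi> where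
      \<xi>: "\<And>x y. \<xi> (x + y) = \<xi> x + \<xi> y" "\<And>c x. \<xi> (fscale c x) = c * \<xi> x" "\<xi> (v s) = 1" "\<And>x. x \<in> K \<Longrightarrow> \<xi> x = 0"
      by blast
    have "x \<in> K" if "x \<in> J" for x
      unfolding K_def by (intro CollectI exI[of _ "\<lambda>_. 0"]) (simp add: that)
    moreover have "v s' \<in> K" if "s' \<in> S - {s}" for s'
    proof -
      have "(\<Sum>r\<in>S - {s}. fscale (if r = s' then 1 else 0) (v r)) = (\<Sum>r\<in>S - {s}. if r = s' then v r else 0)"
        by (intro sum.cong) auto
      also have "\<dots> = v s'" using S that by simp
      finally show ?thesis
        unfolding K_def by (intro CollectI exI[of _ "\<lambda>r. if r = s' then 1 else 0"]) (simp add: fv.subspace_0[OF J])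
    qed
    ultimately show ?thesis using \<xi> unfolding functional_mod_def by (intro exI[of _ \<xi>]) auto
  qed
  then have "\<forall>s\<in>S. \<exists>\<xi>. functional_mod J \<xi> \<and> (\<forall>s'\<in>S. \<xi> (v s') = (if s = s' then 1 else 0))" by blast
  from bchoice[OF this] show ?thesis by blast
qed

lemma family_det_indep:
  assumes S: "finite S" and \<xi>: "\<And>s. s \<in> S \<Longrightarrow> functional_mod J (\<xi> s)"
    and det: "family_det S (\<lambda>s s'. \<xi> s (u s')) \<noteq> 0"
  shows "indep_mod J S u"
  unfolding indep_mod_def
proof (intro allI impI ballI)
  fix c s assume c: "(\<Sum>s\<in>S. fscale (c s) (u s)) \<in> J" and s: "s \<in> S"
  show "c s = 0"
  proof (rule family_det_kernel[OF S det _ s])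
    fix s assume s: "s \<in> S"
    have "(\<Sum>s'\<in>S. \<xi> s (u s') * c s') = \<xi> s (\<Sum>s\<in>S. fscale (c s) (u s))"
      unfolding functional_mod_sum[OF \<xi>[OF s]] using \<xi>[OF s]
      by (intro sum.cong) (auto simp: functional_mod_def)
    also have "\<dots> = 0" using c \<xi>[OF s] by (auto simp: functional_mod_def)
    finally show "(\<Sum>s'\<in>S. \<xi> s (u s') * c s') = 0" .
  qed
qed

text \<open>With functionals dual to \<open>p\<close>, the determinant of their values is a
  polynomial in \<epsilon> equal to 1 at 0; only its roots can be exceptional.\<close>

lemma indep_on_line:
  fixes p q :: "'s \<Rightarrow> 'p \<Rightarrow> 'k::field"
  assumes J: "fv.subspace J" and S: "finite S" and p: "indep_mod J S p"
  shows "finite {\<epsilon>. \<not> indep_mod J S (\<lambda>s. p s + fscale \<epsilon> (q s))}"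
proof -
  obtain \<xi> where \<xi>: "\<And>s. s \<in> S \<Longrightarrow> functional_mod J (\<xi> s)"
    "\<And>s s'. s \<in> S \<Longrightarrow> s' \<in> S \<Longrightarrow> \<xi> s (p s') = (if s = s' then 1 else 0)"
    using dual_family[OF assms] by blast
  let ?D = "\<lambda>\<epsilon>. family_det S (\<lambda>s s'. \<xi> s (p s') + \<epsilon> * \<xi> s (q s'))"
  have "?D \<in> polynomial_functions {\<lambda>\<epsilon>. \<epsilon>}"
    by (intro family_det_polynomial S polynomial_functions.add polynomial_functions.mult
      polynomial_functions.const polynomial_functions.coord) auto
  then have "\<exists>P. \<forall>\<epsilon>. ?D \<epsilon> = poly P \<epsilon>"
    by (rule polynomial_function_on_line[where line = "\<lambda>\<epsilon>. \<epsilon>"]) (rule exI[of _ 0], rule exI[of _ 1], simp)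
  then obtain P where P: "\<And>\<epsilon>. ?D \<epsilon> = poly P \<epsilon>" by blast
  have "?D 0 = 1" by (rule family_det_one[OF S]) (simp add: \<xi>)
  then have "P \<noteq> 0" using P[of 0] by auto
  then have "finite {\<epsilon>. poly P \<epsilon> = 0}" by (rule poly_roots_finite)
  moreover have "{\<epsilon>. \<not> indep_mod J S (\<lambda>s. p s + fscale \<epsilon> (q s))} \<subseteq> {\<epsilon>. poly P \<epsilon> = 0}"
  proof
    fix \<epsilon> assume \<epsilon>: "\<epsilon> \<in> {\<epsilon>. \<not> indep_mod J S (\<lambda>s. p s + fscale \<epsilon> (q s))}"
    then have "family_det S (\<lambda>s s'. \<xi> s (p s' + fscale \<epsilon> (q s'))) = 0"
      using family_det_indep[OF S, of J \<xi> "\<lambda>s. p s + fscale \<epsilon> (q s)"] \<xi>(1) by blast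
    moreover have "family_det S (\<lambda>s s'. \<xi> s (p s' + fscale \<epsilon> (q s'))) = ?D \<epsilon>"
      by (rule family_det_cong[OF S]) (use \<xi>(1) in \<open>auto simp: functional_mod_def\<close>)
    ultimately show "\<epsilon> \<in> {\<epsilon>. poly P \<epsilon> = 0}" using P by simp
  qed
  ultimately show ?thesis by (rule rev_finite_subset)
qed

lemma indep_mod_cong: "(\<And>s. s \<in> S \<Longrightarrow> v s = v' s) \<Longrightarrow> indep_mod J S v = indep_mod J S v'"
  by (simp add: indep_mod_def)

section \<open>Independence for a suitable choice of elements\<close>

context preproj
begin

text \<open>Names the summand an arrow belongs to: the arrows of one class span one W_i, and the
  factors multiplied with them lie in \<open>GT (fst i) (d - snd i)\<close>.\<close>

definition cls :: "'e + 'e \<Rightarrow> 'v \<times> int" where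
  "cls x = (head Q x, deg x)"

lemma R_GT:
  assumes "x \<in> arcs Q" "f \<in> GT (head Q x) (d - deg x)"
  shows "R x f \<in> GT (tail Q x) d"
  unfolding GT_def
proof (intro CollectI allI impI)
  fix p assume "R x f p \<noteq> 0"
  then obtain s es where p: "p = (s, x # es)" "p \<in> qpaths Q" "f (head Q x, es) \<noteq> 0"
    by (cases p; cases "snd p") (auto simp: R_def split: if_splits)
  then have "int (path_degree (head Q x, es)) = d - deg x" using assms(2) unfolding GT_def by blast
  then show "fst p = tail Q x \<and> p \<in> qpaths Q \<and> int (path_degree p) = d"
    using p path_degree_Cons[of s x es "head Q x"] by (auto simp: qpaths_iff wk_Cons)
qed

end

context acyclic_preproj
begin

text \<open>\<open>K i\<close> contains the indices k of the F_{i,k}, and \<open>I\<close> the pairs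
  (arrow, k) whose products are wanted. The assumption \<open>small\<close> expresses on
  representatives that fewer than \<open>card I\<close> elements cannot span V^t_d.\<close>

lemma general_independent:
  fixes K :: "'v \<times> int \<Rightarrow> nat set" and F0 :: "'v \<times> int \<Rightarrow> nat \<Rightarrow> ('v, 'e + 'e) qpath \<Rightarrow> 'k"
  assumes inf: "infinite (UNIV :: 'k set)" and t: "t \<in> verts \<Gamma>" and d: "d > 0"
    and I: "I \<subseteq> Out t \<times> UNIV" "finite I" and K: "\<And>x k. (x, k) \<in> I \<Longrightarrow> k \<in> K (cls x)"
    and finK: "\<And>i. finite (K i)"
    and F0: "\<And>i k. i \<in> cls ` Out t \<Longrightarrow> k \<in> K i \<Longrightarrow> F0 i k \<in> GT (fst i) (d - snd i)"
      "\<And>i. i \<in> cls ` Out t \<Longrightarrow> indep_mod JJ (K i) (F0 i)"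
    and small: "\<And>S v. S \<subseteq> I \<Longrightarrow> card S < card I \<Longrightarrow> (\<And>s. s \<in> S \<Longrightarrow> v s \<in> GT t d) \<Longrightarrow>
      \<exists>z\<in>GT t d. \<forall>c. z - (\<Sum>s\<in>S. fscale (c s) (v s)) \<notin> JJ"
  shows "\<exists>F. (\<forall>i\<in>cls ` Out t. \<forall>k\<in>K i. F i k \<in> GT (fst i) (d - snd i)) \<and>
    indep_mod JJ I (\<lambda>(x, k). R x (F (cls x) k))"
proof -
  let ?C = "cls ` Out t"
  define adm where "adm F \<longleftrightarrow> (\<forall>i\<in>?C. \<forall>k\<in>K i. F i k \<in> GT (fst i) (d - snd i))"
    for F :: "'v \<times> int \<Rightarrow> nat \<Rightarrow> ('v, 'e + 'e) qpath \<Rightarrow> 'k"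
  define good where "good F \<longleftrightarrow> adm F \<and> (\<forall>i\<in>?C. indep_mod JJ (K i) (F i))" for F
  define mu where "mu F s = R (fst s) (F (cls (fst s)) (snd s))"
    for F :: "'v \<times> int \<Rightarrow> nat \<Rightarrow> ('v, 'e + 'e) qpath \<Rightarrow> 'k" and s :: "('e + 'e) \<times> nat"
  have finC: "finite ?C" by simp
  have mu_GT: "mu F s \<in> GT t d" if "adm F" "s \<in> I" for F s
  proof -
    have s: "fst s \<in> Out t" "snd s \<in> K (cls (fst s))" using that(2) I(1) K[of "fst s" "snd s"] by auto
    then have "F (cls (fst s)) (snd s) \<in> GT (head Q (fst s)) (d - deg (fst s))"
      using that(1) unfolding adm_def by (auto simp: cls_def)
    then show ?thesis using R_GT[of "fst s"] s unfolding mu_def by auto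
  qed
  \<comment> \<open>The maximum runs over \<open>F\<close> and \<open>S\<close> together, because
    the perturbation below changes \<open>F\<close> while enlarging \<open>S\<close>.\<close>
  have "\<exists>x. (good (fst x) \<and> snd x \<subseteq> I \<and> indep_mod JJ (snd x) (mu (fst x))) \<and>
    (\<forall>y. good (fst y) \<and> snd y \<subseteq> I \<and> indep_mod JJ (snd y) (mu (fst y)) \<longrightarrow> card (snd y) \<le> card (snd x))"
  proof (rule ex_has_greatest_nat[where k = "(F0, {})" and b = "Suc (card I)" and f = "\<lambda>x. card (snd x)"
      and P = "\<lambda>x. good (fst x) \<and> snd x \<subseteq> I \<and> indep_mod JJ (snd x) (mu (fst x))"])
    show "good (fst (F0, {})) \<and> snd (F0, {}) \<subseteq> I \<and> indep_mod JJ (snd (F0, {})) (mu (fst (F0, {})))"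
      using F0 by (simp add: good_def adm_def indep_mod_def)
    show "\<forall>y. good (fst y) \<and> snd y \<subseteq> I \<and> indep_mod JJ (snd y) (mu (fst y)) \<longrightarrow> card (snd y) < Suc (card I)"
      using card_mono[OF I(2)] by (simp add: less_Suc_eq_le)
  qed
  then obtain F S where F: "good F" and S: "S \<subseteq> I" "indep_mod JJ S (mu F)"
    and max: "\<And>F' S'. good F' \<Longrightarrow> S' \<subseteq> I \<Longrightarrow> indep_mod JJ S' (mu F') \<Longrightarrow> card S' \<le> card S"
    by auto
  have finS: "finite S" using S(1) I(2) finite_subset by blast
  have admF: "adm F" and indF: "\<And>i. i \<in> ?C \<Longrightarrow> indep_mod JJ (K i) (F i)" using F by (auto simp: good_def)
  have "S = I"
  proof (rule ccontr)
    assume "S \<noteq> I"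
    then obtain s0 where s0: "s0 \<in> I" "s0 \<notin> S" using S(1) by blast
    have "\<not> indep_mod JJ (insert s0 S) (mu F)"
      using max[OF F, of "insert s0 S"] s0 S(1) finS by auto
    then obtain e where e: "(\<Sum>s\<in>insert s0 S. fscale (e s) (mu F s)) \<in> JJ" "\<exists>s\<in>insert s0 S. e s \<noteq> 0"
      unfolding indep_mod_def by blast
    have e0: "e s0 \<noteq> 0"
    proof
      assume "e s0 = 0"
      then have "(\<Sum>s\<in>S. fscale (e s) (mu F s)) \<in> JJ" using e(1) s0 finS by simp
      then show False using S(2) e(2) \<open>e s0 = 0\<close> unfolding indep_mod_def by blast
    qed
    \<comment> \<open>The relation is normalised to 1 at \<open>s0\<close>. Extending it by 0 allows
      sums over larger index sets, in particular over all arrows for a fixed k.\<close>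
    define \<nu> where "\<nu> s = (if s \<in> insert s0 S then e s / e s0 else 0)" for s
    have \<nu>0: "\<nu> s0 = 1" using e0 by (simp add: \<nu>_def)
    define \<Phi> where "\<Phi> F' = (\<Sum>s\<in>I. fscale (\<nu> s) (mu F' s))" for F'
    have \<Phi>_alt: "\<Phi> F' = mu F' s0 + (\<Sum>s\<in>S. fscale (\<nu> s) (mu F' s))" for F'
    proof -
      have "\<Phi> F' = (\<Sum>s\<in>insert s0 S. fscale (\<nu> s) (mu F' s))"
        unfolding \<Phi>_def using S(1) s0(1) I(2)
        by (intro sum.mono_neutral_right) (auto simp: \<nu>_def)
      then show ?thesis using s0 finS \<nu>0 by simp
    qed
    have \<Phi>F: "\<Phi> F \<in> JJ"
    proof -
      have "\<Phi> F = fscale (inverse (e s0)) (\<Sum>s\<in>insert s0 S. fscale (e s) (mu F s))"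
        unfolding \<Phi>_alt using s0 finS e0
        by (simp add: fv.scale_right_distrib fv.scale_sum_right) (intro sum.cong, auto simp: \<nu>_def field_simps)
      then show ?thesis using JJ_scale[OF e(1)] by simp
    qed
    have mu_lin: "mu (\<lambda>i k. F i k + fscale \<epsilon> (F' i k)) s = mu F s + fscale \<epsilon> (mu F' s)" for F' \<epsilon> s
      by (simp add: mu_def R_linear)
    have A: "\<exists>c. \<Phi> F' - (\<Sum>s\<in>S. fscale (c s) (mu F s)) \<in> JJ" if F': "adm F'" for F'
    proof (rule ccontr)
      assume no: "\<nexists>c. \<Phi> F' - (\<Sum>s\<in>S. fscale (c s) (mu F s)) \<in> JJ"
      \<comment> \<open>As \<Phi> F vanishes modulo \<open>JJ\<close>, the relation applied to F +
        \<epsilon> F' is \<epsilon> times \<Phi> F'. Divided by \<epsilon>, it can replace the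
        product at \<open>s0\<close>; together with the products at \<open>S\<close> it forms the
        family \<open>u\<close> moved in direction \<open>q\<close>, with no motion at
        \<open>s0\<close>.\<close>
      define u where "u s = (if s = s0 then \<Phi> F' else mu F s)" for s
      define q where "q s = (if s = s0 then 0 else mu F' s)" for s
      have indu: "indep_mod JJ (insert s0 S) u"
        unfolding indep_mod_def
      proof (intro allI impI)
        fix c assume "(\<Sum>s\<in>insert s0 S. fscale (c s) (u s)) \<in> JJ"
        moreover have "(\<Sum>s\<in>S. fscale (c s) (u s)) = (\<Sum>s\<in>S. fscale (c s) (mu F s))"
          using s0 by (intro sum.cong) (auto simp: u_def)
        ultimately have c: "fscale (c s0) (\<Phi> F') + (\<Sum>s\<in>S. fscale (c s) (mu F s)) \<in> JJ"
          using s0 finS by (simp add: u_def)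
        have "c s0 = 0"
        proof (rule ccontr)
          assume n0: "c s0 \<noteq> 0"
          have "\<Phi> F' - (\<Sum>s\<in>S. fscale (- inverse (c s0) * c s) (mu F s)) =
            fscale (inverse (c s0)) (fscale (c s0) (\<Phi> F') + (\<Sum>s\<in>S. fscale (c s) (mu F s)))"
            using n0 by (simp add: fv.scale_right_distrib fv.scale_sum_right sum_negf)
          then have "\<Phi> F' - (\<Sum>s\<in>S. fscale (- inverse (c s0) * c s) (mu F s)) \<in> JJ"
            using JJ_scale[OF c, of "inverse (c s0)"] by (simp only:)
          then have "\<exists>c. \<Phi> F' - (\<Sum>s\<in>S. fscale (c s) (mu F s)) \<in> JJ"
            by (rule exI[of _ "\<lambda>s. - inverse (c s0) * c s"])
          then show False using no by (rule notE[rotated])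
        qed
        then show "\<forall>s\<in>insert s0 S. c s = 0" using c S(2) unfolding indep_mod_def by simp
      qed
      \<comment> \<open>The parameter 0 is excluded because of that division; the last union keeps
        the families \<open>F i\<close> independent, as \<open>good\<close> demands.\<close>
      let ?bad = "insert 0 ({\<epsilon>. \<not> indep_mod JJ (insert s0 S) (\<lambda>s. u s + fscale \<epsilon> (q s))} \<union>
        (\<Union>i\<in>?C. {\<epsilon>. \<not> indep_mod JJ (K i) (\<lambda>k. F i k + fscale \<epsilon> (F' i k))}))"
      have "finite ?bad"
      proof (intro finite_insert[THEN iffD2] finite_UnI finite_UN_I finC)
        show "finite {\<epsilon>. \<not> indep_mod JJ (insert s0 S) (\<lambda>s. u s + fscale \<epsilon> (q s))}"
          using finS indu by (intro indep_on_line JJ_subspace) auto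
        show "finite {\<epsilon>. \<not> indep_mod JJ (K i) (\<lambda>k. F i k + fscale \<epsilon> (F' i k))}" if "i \<in> ?C" for i
          by (intro indep_on_line JJ_subspace finK indF that)
      qed
      then obtain \<epsilon> where \<epsilon>: "\<epsilon> \<notin> ?bad" using inf ex_new_if_finite by blast
      define G where "G = (\<lambda>i k. F i k + fscale \<epsilon> (F' i k))"
      have "good G"
        using \<epsilon> admF F' unfolding good_def adm_def G_def
        by (auto intro!: fv.subspace_add[OF GT_subspace] fv.subspace_scale[OF GT_subspace])
      moreover have "indep_mod JJ (insert s0 S) (mu G)"
        unfolding indep_mod_def
      proof (intro allI impI)
        fix c assume c: "(\<Sum>s\<in>insert s0 S. fscale (c s) (mu G s)) \<in> JJ"
        \<comment> \<open>Change of coordinates from the products of \<open>G\<close> to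
          \<open>u + \<epsilon> q\<close>, modulo \<Phi> F: the product at \<open>s0\<close> equals
          \<epsilon> \<Phi> F' minus the \<nu>-combination of the products at
          \<open>S\<close>.\<close>
        define c' where "c' s = (if s = s0 then c s0 * \<epsilon> else c s - c s0 * \<nu> s)" for s
        have 1: "mu G s0 + (\<Sum>s\<in>S. fscale (\<nu> s) (mu G s)) = \<Phi> F + fscale \<epsilon> (\<Phi> F')"
          unfolding \<Phi>_alt[symmetric] unfolding \<Phi>_def G_def mu_lin
          by (simp add: fv.scale_right_distrib sum.distrib fv.scale_sum_right mult.commute)
        have "(\<Sum>s\<in>S. fscale (c' s) (u s + fscale \<epsilon> (q s))) = (\<Sum>s\<in>S. fscale (c s - c s0 * \<nu> s) (mu G s))"
          using s0 by (intro sum.cong) (auto simp: c'_def u_def q_def G_def mu_lin)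
        then have "(\<Sum>s\<in>insert s0 S. fscale (c' s) (u s + fscale \<epsilon> (q s))) =
            fscale (c s0 * \<epsilon>) (\<Phi> F') + (\<Sum>s\<in>S. fscale (c s) (mu G s)) - fscale (c s0) (\<Sum>s\<in>S. fscale (\<nu> s) (mu G s))"
          using s0 finS by (simp add: c'_def u_def q_def fv.scale_left_diff_distrib sum_subtractf fv.scale_sum_right)
        also have "\<dots> = fscale (c s0) (fscale \<epsilon> (\<Phi> F')) + (\<Sum>s\<in>S. fscale (c s) (mu G s)) -
            fscale (c s0) (\<Phi> F + fscale \<epsilon> (\<Phi> F') - mu G s0)"
          unfolding 1[symmetric] by simp
        also have "\<dots> = (\<Sum>s\<in>insert s0 S. fscale (c s) (mu G s)) - fscale (c s0) (\<Phi> F)"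
          using s0 finS by (simp add: fv.scale_right_distrib fv.scale_right_diff_distrib)
        also have "\<dots> \<in> JJ" using c \<Phi>F by (intro JJ_diff JJ_scale)
        finally have "\<forall>s\<in>insert s0 S. c' s = 0" using \<epsilon> unfolding indep_mod_def by blast
        then show "\<forall>s\<in>insert s0 S. c s = 0" using \<epsilon> s0 by (auto simp: c'_def split: if_splits)
      qed
      ultimately have "card (insert s0 S) \<le> card S" using s0 S(1) by (intro max) auto
      then show False using s0 finS by simp
    qed
    \<comment> \<open>The coefficients of \<nu> at a fixed k and a fixed class, as a vector of W_i.
      These vectors span the spaces W'_i.\<close>
    define g where "g i k = (\<lambda>x. if x \<in> Out t \<and> cls x = i then \<nu> (x, k) else 0)" for i k
    define T where "T = {g i k | i k. i \<in> ?C \<and> k \<in> K i}"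
    have "finite T"
    proof -
      have "T = (\<lambda>(i, k). g i k) ` (SIGMA i:?C. K i)" by (auto simp: T_def)
      then show ?thesis using finC finK by simp
    qed
    \<comment> \<open>Choosing the basis among the \<open>g i k\<close> themselves ensures that each
      basis vector lies in a single W_i and remembers an index k.\<close>
    obtain BB where BB: "BB \<subseteq> T" "fv.independent BB" "T \<subseteq> fv.span BB"
      using fv.maximal_independent_subset by blast
    have finBB: "finite BB" using BB(1) \<open>finite T\<close> finite_subset by blast
    have "\<forall>w\<in>BB. \<exists>ik. fst ik \<in> ?C \<and> snd ik \<in> K (fst ik) \<and> w = g (fst ik) (snd ik)"
      using BB(1) unfolding T_def by fastforce
    from bchoice[OF this] obtain ik where ik: "\<And>w. w \<in> BB \<Longrightarrow> fst (ik w) \<in> ?C \<and> snd (ik w) \<in> K (fst (ik w)) \<and> w = g (fst (ik w)) (snd (ik w))"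
      by blast
    define iw where "iw w = fst (ik w)" for w
    have wsupp: "x \<in> Out t \<and> cls x = iw w" if "w \<in> BB" "w x \<noteq> 0" for w x
    proof -
      have "w x = g (iw w) (snd (ik w)) x" using ik[OF that(1)] unfolding iw_def by (intro fun_cong[of w]) blast
      then show ?thesis using that(2) by (auto simp: g_def split: if_splits)
    qed
    interpret M: mesh_map \<Gamma> a b t BB "\<lambda>w. fst (iw w)" "\<lambda>w. snd (iw w)" "\<lambda>w. w"
    proof
      show "t \<in> verts \<Gamma>" "finite BB" by (fact t finBB)+
      show "x \<in> arcs Q \<and> tail Q x = t \<and> head Q x = fst (iw w) \<and> deg x = snd (iw w)"
        if "w \<in> BB" "w x \<noteq> 0" for w x
        using wsupp[OF that] by (auto simp: cls_def prod_eq_iff)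
      show "\<forall>w\<in>BB. c w = 0" if c: "\<forall>x. (\<Sum>w\<in>BB. c w * w x) = 0" for c
      proof -
        have "(\<Sum>w\<in>BB. fscale (c w) w) = 0"
          using c by (auto simp: fun_eq_iff sum_fun_apply fun_simps)
        then show ?thesis using BB(2) finBB by (simp add: fv.dependent_finite) blast
      qed
    qed
    have fm_alt: "M.fm y = (\<Sum>w\<in>BB. \<Sum>x\<in>Out t. fscale (w x) (R x (y w)))" for y
      unfolding M.fm_def
      by (intro sum.cong refl sum.mono_neutral_right) (use wsupp in auto)
    from M.mono_or_epi[OF d] show False
    proof
      assume epi: "\<forall>z\<in>GT t d. \<exists>y. (\<forall>w\<in>BB. y w \<in> GT (fst (iw w)) (d - snd (iw w))) \<and> z - M.fm y \<in> JJ"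
      have "card S < card I" using \<open>S \<noteq> I\<close> S(1) I(2) by (simp add: psubset_card_mono psubset_eq)
      then obtain z where z: "z \<in> GT t d" "\<And>c. z - (\<Sum>s\<in>S. fscale (c s) (mu F s)) \<notin> JJ"
        using small[OF S(1), of "mu F"] mu_GT[OF admF] S(1) by blast
      obtain y where y: "\<forall>w\<in>BB. y w \<in> GT (fst (iw w)) (d - snd (iw w))" "z - M.fm y \<in> JJ"
        using epi z(1) by blast
      have "\<exists>c. (\<Sum>x\<in>Out t. fscale (w x) (R x (y w))) - (\<Sum>s\<in>S. fscale (c s) (mu F s)) \<in> JJ" if w: "w \<in> BB" for w
      proof -
        \<comment> \<open>\<open>y w\<close> is put into the one slot from which \<open>w\<close>
          arose, so \<Phi> F' is exactly the product of \<open>y w\<close> and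
          \<open>w\<close>.\<close>
        define F' where "F' = (\<lambda>i k. if i = iw w \<and> k = snd (ik w) then y w else 0)"
        have "adm F'" unfolding adm_def F'_def using y(1) w fv.subspace_0[OF GT_subspace] by auto
        moreover have "\<Phi> F' = (\<Sum>x\<in>Out t. fscale (w x) (R x (y w)))"
        proof -
          let ?f = "\<lambda>x. (x, snd (ik w))"
          have gw: "w x = (if x \<in> Out t \<and> cls x = iw w then \<nu> (x, snd (ik w)) else 0)" for x
          proof -
            have "w x = g (iw w) (snd (ik w)) x" using ik[OF w] unfolding iw_def by (intro fun_cong[of w]) blast
            then show ?thesis by (simp add: g_def)
          qed
          have "\<Phi> F' = (\<Sum>s\<in>I \<union> ?f ` Out t. fscale (\<nu> s) (mu F' s))"
            unfolding \<Phi>_def using I(2) s0(1) S(1)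
            by (intro sum.mono_neutral_left) (auto simp: \<nu>_def)
          also have "\<dots> = (\<Sum>s\<in>?f ` Out t. fscale (\<nu> s) (mu F' s))"
          proof (intro sum.mono_neutral_right ballI)
            fix s assume "s \<in> I \<union> ?f ` Out t - ?f ` Out t"
            then have "s \<in> I" "snd s \<noteq> snd (ik w)" using I(1) by (auto simp: image_iff)
            then show "fscale (\<nu> s) (mu F' s) = 0" by (simp add: mu_def F'_def R_linear)
          qed (use I(2) in auto)
          also have "\<dots> = (\<Sum>x\<in>Out t. fscale (\<nu> (?f x)) (mu F' (?f x)))"
            by (subst sum.reindex) (auto simp: inj_on_def)
          also have "\<dots> = (\<Sum>x\<in>Out t. fscale (w x) (R x (y w)))"
            by (intro sum.cong refl) (auto simp: gw mu_def F'_def R_linear)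
          finally show ?thesis .
        qed
        ultimately show ?thesis using A[of F'] by metis
      qed
      then have "\<forall>w\<in>BB. \<exists>c. (\<Sum>x\<in>Out t. fscale (w x) (R x (y w))) - (\<Sum>s\<in>S. fscale (c s) (mu F s)) \<in> JJ" by blast
      from bchoice[OF this] obtain c where
        c: "\<And>w. w \<in> BB \<Longrightarrow> (\<Sum>x\<in>Out t. fscale (w x) (R x (y w))) - (\<Sum>s\<in>S. fscale (c w s) (mu F s)) \<in> JJ" by blast
      have "(\<Sum>w\<in>BB. (\<Sum>x\<in>Out t. fscale (w x) (R x (y w))) - (\<Sum>s\<in>S. fscale (c w s) (mu F s))) \<in> JJ"
        using c by (intro JJ_sum)
      moreover have "(\<Sum>w\<in>BB. \<Sum>s\<in>S. fscale (c w s) (mu F s)) = (\<Sum>s\<in>S. fscale (\<Sum>w\<in>BB. c w s) (mu F s))"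
        by (subst sum.swap) (simp add: fv.scale_sum_left)
      ultimately have "M.fm y - (\<Sum>s\<in>S. fscale (\<Sum>w\<in>BB. c w s) (mu F s)) \<in> JJ"
        by (simp add: fm_alt sum_subtractf)
      from JJ_add[OF y(2) this] have "z - (\<Sum>s\<in>S. fscale (\<Sum>w\<in>BB. c w s) (mu F s)) \<in> JJ" by simp
      then show False using z(2)[of "\<lambda>s. \<Sum>w\<in>BB. c w s"] by blast
    next
      assume mono: "\<forall>y. (\<forall>w\<in>BB. y w \<in> GT (fst (iw w)) (d - snd (iw w))) \<longrightarrow> M.fm y \<in> JJ \<longrightarrow> (\<forall>w\<in>BB. y w \<in> JJ)"
      have "\<exists>c. g i k = (\<Sum>w\<in>BB. fscale (c w) w)" if "i \<in> ?C" "k \<in> K i" for i k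
      proof -
        have "g i k \<in> fv.span BB" using BB(3) that unfolding T_def by blast
        then show ?thesis unfolding fv.span_finite[OF finBB] by auto
      qed
      then have "\<forall>ik\<in>(SIGMA i:?C. K i). \<exists>c. g (fst ik) (snd ik) = (\<Sum>w\<in>BB. fscale (c w) w)" by auto
      from bchoice[OF this] obtain c where c: "\<And>i k. i \<in> ?C \<Longrightarrow> k \<in> K i \<Longrightarrow> g i k = (\<Sum>w\<in>BB. fscale (c (i, k) w) w)"
        by fastforce
      \<comment> \<open>\<Phi> F regrouped along the basis: after expanding the coefficient vectors
        \<open>g i k\<close> in \<open>BB\<close>, the factor standing before \<open>w\<close> is
        \<open>y w\<close>.\<close>
      define y where "y w = (\<Sum>k\<in>K (iw w). fscale (c (iw w, k) w) (F (iw w) k))" for w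
      have "y w \<in> GT (fst (iw w)) (d - snd (iw w))" if "w \<in> BB" for w
        unfolding y_def using admF ik[OF that] unfolding adm_def iw_def
        by (intro fv.subspace_sum[OF GT_subspace] fv.subspace_scale[OF GT_subspace]) blast
      moreover have "M.fm y = \<Phi> F"
      proof -
        have \<nu>g: "\<nu> (x, k) = (\<Sum>w\<in>BB. c (cls x, k) w * w x)" if "x \<in> Out t" "k \<in> K (cls x)" for x k
          using fun_cong[OF c[of "cls x" k], of x] that by (simp add: g_def sum_fun_apply fun_simps)
        have "M.fm y = (\<Sum>w\<in>BB. \<Sum>x\<in>Out t. \<Sum>k\<in>K (cls x). fscale (c (cls x, k) w * w x) (R x (F (cls x) k)))"
          unfolding fm_alt
        proof (intro sum.cong refl)
          fix w x assume wx: "w \<in> BB" "x \<in> Out t"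
          show "fscale (w x) (R x (y w)) = (\<Sum>k\<in>K (cls x). fscale (c (cls x, k) w * w x) (R x (F (cls x) k)))"
          proof (cases "w x = 0")
            case False
            then have "cls x = iw w" using wsupp wx by blast
            then show ?thesis by (simp add: y_def R_sum R_linear fv.scale_sum_right mult.commute)
          qed simp
        qed
        also have "\<dots> = (\<Sum>x\<in>Out t. \<Sum>w\<in>BB. \<Sum>k\<in>K (cls x). fscale (c (cls x, k) w * w x) (R x (F (cls x) k)))"
          by (rule sum.swap)
        also have "\<dots> = (\<Sum>x\<in>Out t. \<Sum>k\<in>K (cls x). \<Sum>w\<in>BB. fscale (c (cls x, k) w * w x) (R x (F (cls x) k)))"
          by (intro sum.cong refl sum.swap)
        also have "\<dots> = (\<Sum>x\<in>Out t. \<Sum>k\<in>K (cls x). fscale (\<nu> (x, k)) (R x (F (cls x) k)))"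
          by (intro sum.cong refl) (simp add: \<nu>g fv.scale_sum_left)
        also have "\<dots> = (\<Sum>s\<in>(SIGMA x:Out t. K (cls x)). fscale (\<nu> s) (mu F s))"
          using finK by (simp add: sum.Sigma mu_def split_beta)
        also have "\<dots> = \<Phi> F"
          unfolding \<Phi>_def using I K finK S(1) s0(1)
          by (intro sum.mono_neutral_right) (auto simp: \<nu>_def)
        finally show ?thesis .
      qed
      ultimately have yJJ: "y w \<in> JJ" if "w \<in> BB" for w using mono \<Phi>F that by simp
      have "c (iw w, k) w = 0" if "w \<in> BB" "k \<in> K (iw w)" for w k
      proof -
        have "iw w \<in> ?C" using ik[OF that(1)] by (simp add: iw_def)
        from indF[OF this, unfolded indep_mod_def, rule_format, of "\<lambda>k. c (iw w, k) w"] show ?thesis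
          using yJJ[OF that(1)] that(2) unfolding y_def by blast
      qed
      moreover obtain x0 k0 where xk: "s0 = (x0, k0)" by fastforce
      then have x0: "x0 \<in> Out t" "k0 \<in> K (cls x0)" using s0(1) I(1) K by auto
      ultimately have "c (cls x0, k0) w * w x0 = 0" if "w \<in> BB" for w
        using wsupp[OF that, of x0] that by (cases "w x0 = 0") auto
      then have "(\<Sum>w\<in>BB. c (cls x0, k0) w * w x0) = 0" by (intro sum.neutral) blast
      moreover have "\<nu> (x0, k0) = (\<Sum>w\<in>BB. c (cls x0, k0) w * w x0)"
        using fun_cong[OF c[of "cls x0" k0], of x0] x0 by (simp add: g_def sum_fun_apply fun_simps)
      ultimately show False using \<nu>0 xk by simp
    qed
  qed
  moreover have "mu F = (\<lambda>(x, k). R x (F (cls x) k))" by (auto simp: mu_def)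
  ultimately show ?thesis using admF S(2) unfolding adm_def by (intro exI[of _ F]) simp
qed

end

section \<open>The preprojective algebra as a quotient\<close>

context preproj
begin

abbreviation PA :: "('k, ('v, 'e + 'e) qpath \<Rightarrow> 'k) module" where "PA \<equiv> path_algebra Q"

definition splits :: "('v, 'e + 'e) qpath \<Rightarrow> (('v, 'e + 'e) qpath \<times> ('v, 'e + 'e) qpath) set" where
  "splits r = {(p, q). p \<in> qpaths Q \<and> q \<in> qpaths Q \<and> fst p = path_end Q q \<and> r = (fst q, snd q @ snd p)}"

definition fmult :: "(('v, 'e + 'e) qpath \<Rightarrow> 'k) \<Rightarrow> (('v, 'e + 'e) qpath \<Rightarrow> 'k) \<Rightarrow> ('v, 'e + 'e) qpath \<Rightarrow> 'k" where
  "fmult f g = (\<lambda>r. \<Sum>(p, q)\<in>splits r. f p * g q)"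

definition PC :: "(('v, 'e + 'e) qpath \<Rightarrow> 'k) set" where
  "PC = {f. finite {p. f p \<noteq> 0} \<and> {p. f p \<noteq> 0} \<subseteq> qpaths Q}"

definition unit :: "('v, 'e + 'e) qpath \<Rightarrow> 'k" where
  "unit = (\<Sum>v\<in>verts \<Gamma>. path_elt (v, []))"

lemma PA_simps:
  "carrier PA = PC" "mult PA = fmult" "zero PA = 0" "add PA = (+)" "smult PA = fscale" "one PA = unit"
proof -
  have "unit p = (if p \<in> (\<lambda>v. (v, [])) ` verts Q then 1 else 0)" for p
    unfolding unit_def sum_fun_apply path_elt_def by (cases p) (auto simp: image_iff)
  then have "unit = (\<lambda>p. if p \<in> (\<lambda>v. (v, [])) ` verts Q then 1 else 0)" ..
  then show "one PA = unit" by (simp add: path_algebra_def)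
qed (simp_all add: path_algebra_def PC_def fmult_def splits_def zero_fun_def plus_fun_def fscale_def fun_eq_iff)

lemma PC_subspace: "fv.subspace PC"
proof (rule fv.subspaceI)
  show "0 \<in> PC" by (simp add: PC_def fun_simps)
next
  fix f g assume "f \<in> PC" "g \<in> PC"
  moreover have "{p. (f + g) p \<noteq> 0} \<subseteq> {p. f p \<noteq> 0} \<union> {p. g p \<noteq> 0}" by (auto simp: fun_simps)
  ultimately show "f + g \<in> PC" unfolding PC_def by (blast intro: finite_subset)
next
  fix c f assume "f \<in> PC"
  moreover have "{p. fscale c f p \<noteq> 0} \<subseteq> {p. f p \<noteq> 0}" by (auto simp: fun_simps)
  ultimately show "fscale c f \<in> PC" unfolding PC_def by (blast intro: finite_subset)
qed

lemmas PC_zero [simp] = fv.subspace_0[OF PC_subspace]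
  and PC_add = fv.subspace_add[OF PC_subspace]
  and PC_scale = fv.subspace_scale[OF PC_subspace]
  and PC_neg = fv.subspace_neg[OF PC_subspace]
  and PC_sum = fv.subspace_sum[OF PC_subspace]

lemma path_elt_PC: "p \<in> qpaths Q \<Longrightarrow> path_elt p \<in> PC"
  by (auto simp: PC_def path_elt_def)

lemma PC_expand:
  assumes "f \<in> PC"
  shows "f = (\<Sum>p | f p \<noteq> 0. fscale (f p) (path_elt p))"
proof
  fix q
  have "(\<Sum>p | f p \<noteq> 0. fscale (f p) (path_elt p)) q = (\<Sum>p | f p \<noteq> 0. if p = q then f q else 0)"
    unfolding sum_fun_apply by (intro sum.cong) (auto simp: fun_simps path_elt_def)
  also have "\<dots> = f q" using assms by (simp add: PC_def)
  finally show "f q = (\<Sum>p | f p \<noteq> 0. fscale (f p) (path_elt p)) q" by simp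
qed

lemma PC_induct [consumes 1, case_names zero step]:
  assumes "f \<in> PC" "P 0"
    and "\<And>c p g. p \<in> qpaths Q \<Longrightarrow> g \<in> PC \<Longrightarrow> P g \<Longrightarrow> P (fscale c (path_elt p) + g)"
  shows "P f"
proof -
  have "(\<Sum>p\<in>S. fscale (f p) (path_elt p)) \<in> PC \<and> P (\<Sum>p\<in>S. fscale (f p) (path_elt p))"
    if "finite S" "S \<subseteq> qpaths Q" for S
    using that
  proof (induction S)
    case empty
    show ?case using assms(2) by simp
  next
    case (insert p S)
    then show ?case using assms(3)[of p "\<Sum>p\<in>S. fscale (f p) (path_elt p)" "f p"]
      by (auto intro: PC_add PC_scale path_elt_PC)
  qed
  from this[of "{p. f p \<noteq> 0}"] show ?thesis using assms(1) PC_expand[OF assms(1)] by (simp add: PC_def)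
qed

lemma qpaths_cases:
  assumes "p \<in> qpaths Q"
  obtains s es v where "p = (s, es)" "wk s es v"
  using assms by (auto simp: qpaths_def)

lemma finite_splits: "finite (splits r)"
proof -
  have "splits r \<subseteq> (\<lambda>i. ((path_end Q (fst r, take i (snd r)), drop i (snd r)), (fst r, take i (snd r)))) ` {..length (snd r)}"
  proof
    fix x assume "x \<in> splits r"
    then obtain p q where x: "x = (p, q)" "fst p = path_end Q q" "r = (fst q, snd q @ snd p)"
      by (auto simp: splits_def)
    show "x \<in> (\<lambda>i. ((path_end Q (fst r, take i (snd r)), drop i (snd r)), (fst r, take i (snd r)))) ` {..length (snd r)}"
      by (rule image_eqI[of _ _ "length (snd q)"]) (use x in \<open>auto simp: prod_eq_iff\<close>)
  qed
  then show ?thesis by (rule finite_subset) simp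
qed

lemma fmult_linear:
  "fmult (f + g) h = fmult f h + fmult g h" "fmult f (g + h) = fmult f g + fmult f h"
  "fmult (fscale c f) g = fscale c (fmult f g)" "fmult f (fscale c g) = fscale c (fmult f g)"
  "fmult 0 g = 0" "fmult f 0 = 0"
  by (simp_all add: fmult_def fun_eq_iff fun_simps split_beta algebra_simps sum.distrib sum_distrib_left)

lemma fmult_sum: "fmult (\<Sum>i\<in>I. f i) g = (\<Sum>i\<in>I. fmult (f i) g)" "fmult g (\<Sum>i\<in>I. f i) = (\<Sum>i\<in>I. fmult g (f i))"
  by (induction I rule: infinite_finite_induct) (simp_all add: fmult_linear)

lemma path_end_eq: "wk s es v \<Longrightarrow> path_end Q (s, es) = v"
  by (auto simp: path_end_def)

lemma fmult_path_elt:
  assumes q: "wk s es v" and p: "wk u es' w"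
  shows "fmult (path_elt (u, es')) (path_elt (s, es)) = (if u = v then path_elt (s, es @ es') else 0)"
proof
  fix r
  have "fmult (path_elt (u, es')) (path_elt (s, es)) r =
      (\<Sum>x\<in>splits r. if x = ((u, es'), (s, es)) then 1 else 0)"
    unfolding fmult_def by (intro sum.cong) (auto simp: path_elt_def split: if_splits)
  also have "\<dots> = (if ((u, es'), (s, es)) \<in> splits r then 1 else 0)"
    using finite_splits by simp
  also have "((u, es'), (s, es)) \<in> splits r \<longleftrightarrow> u = v \<and> r = (s, es @ es')"
    using p q path_end_eq[OF q] by (auto simp: splits_def qpaths_iff)
  finally show "fmult (path_elt (u, es')) (path_elt (s, es)) r = (if u = v then path_elt (s, es @ es') else 0) r"
    by (auto simp: path_elt_def fun_simps)
qed

lemma fmult_PC: "f \<in> PC \<Longrightarrow> g \<in> PC \<Longrightarrow> fmult f g \<in> PC"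
proof (induction f rule: PC_induct)
  case (step c p f)
  have "fmult (path_elt p) g \<in> PC"
    using \<open>g \<in> PC\<close>
  proof (induction g rule: PC_induct)
    case (step c q g)
    obtain u es' w s es v where pq: "p = (u, es')" "wk u es' w" "q = (s, es)" "wk s es v"
      using \<open>p \<in> qpaths Q\<close> step(1) by (auto simp: qpaths_def)
    have "wk s (es @ es') w" if "u = v" using pq that by (auto simp: wk_append)
    then have "fmult (path_elt p) (path_elt q) \<in> PC"
      using fmult_path_elt[OF pq(4,2)] pq by (auto intro!: path_elt_PC simp: qpaths_iff)
    then show ?case using step by (simp add: fmult_linear PC_add PC_scale)
  qed (simp add: fmult_linear)
  then show ?case using step by (simp add: fmult_linear PC_add PC_scale)
qed (simp add: fmult_linear)

lemma fmult_assoc: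
  assumes "f \<in> PC" "g \<in> PC" "h \<in> PC"
  shows "fmult (fmult f g) h = fmult f (fmult g h)"
proof -
  have basis: "fmult (fmult (path_elt p) (path_elt q)) (path_elt r) = fmult (path_elt p) (fmult (path_elt q) (path_elt r))"
    if p: "p \<in> qpaths Q" and q: "q \<in> qpaths Q" and r: "r \<in> qpaths Q" for p q r
  proof -
    obtain s es v s' es' v' s'' es'' v'' where pqr: "p = (s, es)" "wk s es v" "q = (s', es')" "wk s' es' v'"
      "r = (s'', es'')" "wk s'' es'' v''" using qpaths_cases[OF p] qpaths_cases[OF q] qpaths_cases[OF r] by metis
    have 1: "wk s' (es' @ es) v" if "s = v'" using pqr that by (auto simp: wk_append)
    have 2: "wk s'' (es'' @ es') v'" if "s' = v''" using pqr that by (auto simp: wk_append)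
    show ?thesis
      using fmult_path_elt[OF pqr(4,2)] fmult_path_elt[OF pqr(6,4)]
        fmult_path_elt[OF pqr(6) 1] fmult_path_elt[OF 2 pqr(2)]
      by (auto simp: pqr fmult_linear)
  qed
  have 1: "fmult (fmult (path_elt p) (path_elt q)) h = fmult (path_elt p) (fmult (path_elt q) h)"
    if "p \<in> qpaths Q" "q \<in> qpaths Q" for p q
    using assms(3) by (induction h rule: PC_induct) (simp_all add: fmult_linear basis that)
  have 2: "fmult (fmult (path_elt p) g) h = fmult (path_elt p) (fmult g h)" if "p \<in> qpaths Q" for p
    using assms(2) by (induction g rule: PC_induct) (simp_all add: fmult_linear 1 that)
  show ?thesis
    using assms(1) by (induction f rule: PC_induct) (simp_all add: fmult_linear 2)
qed

lemma unit_PC: "unit \<in> PC"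
  unfolding unit_def by (intro PC_sum path_elt_PC) (auto simp: qpaths_iff)

lemma fmult_unit: "f \<in> PC \<Longrightarrow> fmult unit f = f" "f \<in> PC \<Longrightarrow> fmult f unit = f"
proof -
  assume f: "f \<in> PC"
  show "fmult unit f = f" using f
  proof (induction f rule: PC_induct)
    case (step c p g)
    obtain s es w where p: "p = (s, es)" "wk s es w" using step(1) by (auto simp: qpaths_def)
    have "fmult unit (path_elt p) = (\<Sum>v\<in>verts \<Gamma>. if v = w then path_elt p else 0)"
      unfolding unit_def fmult_sum
      by (intro sum.cong refl) (simp add: p(1) fmult_path_elt[OF p(2), of _ "[]"])
    also have "\<dots> = path_elt p" using wk_verts(2)[OF p(2)] by simp
    finally show ?case using step by (simp add: fmult_linear)
  qed (simp add: fmult_linear)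
  show "fmult f unit = f" using f
  proof (induction f rule: PC_induct)
    case (step c p g)
    obtain s es w where p: "p = (s, es)" "wk s es w" using step(1) by (auto simp: qpaths_def)
    have "fmult (path_elt p) unit = (\<Sum>v\<in>verts \<Gamma>. if s = v then path_elt p else 0)"
      unfolding unit_def fmult_sum
      by (intro sum.cong refl) (simp add: p(1) fmult_path_elt[OF _ p(2), of _ "[]"])
    also have "\<dots> = path_elt p" using wk_verts(1)[OF p(2)] by simp
    finally show ?case using step by (simp add: fmult_linear)
  qed (simp add: fmult_linear)
qed

lemma ring_PA: "ring PA"
proof (rule ringI)
  show "abelian_group PA"
  proof (rule abelian_groupI)
    show "\<exists>y\<in>carrier PA. y \<oplus>\<^bsub>PA\<^esub> x = \<zero>\<^bsub>PA\<^esub>" if "x \<in> carrier PA" for x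
      using that by (intro bexI[of _ "- x"]) (auto simp: PA_simps PC_neg)
  qed (auto simp: PA_simps PC_add add_ac)
  show "monoid PA"
    by (rule monoidI) (auto simp: PA_simps fmult_PC unit_PC fmult_assoc fmult_unit)
qed (auto simp: PA_simps fmult_linear)

sublocale PA: ring PA by (rule ring_PA)

lemma PA_a_inv: "f \<in> PC \<Longrightarrow> \<ominus>\<^bsub>PA\<^esub> f = - f"
  by (rule PA.minus_equality) (auto simp: PA_simps PC_neg)

lemma PA_finsum: "(\<And>i. i \<in> I \<Longrightarrow> f i \<in> PC) \<Longrightarrow> finite I \<Longrightarrow> (\<Oplus>\<^bsub>PA\<^esub>i\<in>I. f i) = (\<Sum>i\<in>I. f i)"
proof (induction I rule: infinite_finite_induct)
  case (insert i I)
  have "(\<Oplus>\<^bsub>PA\<^esub>i\<in>insert i I. f i) = f i \<oplus>\<^bsub>PA\<^esub> (\<Oplus>\<^bsub>PA\<^esub>i\<in>I. f i)"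
    using insert by (intro PA.finsum_insert) (auto simp: PA_simps)
  then show ?case using insert by (simp add: PA_simps)
qed (simp_all add: PA_simps)

lemma arrow_elt_eq: "arrow_elt Q x = path_elt (tail Q x, [x])"
  by (simp add: arrow_elt_def)

text \<open>Connects the operator \<open>R\<close> of the preceding sections with the product in the
  algebra, and so with the elements of the statement.\<close>

lemma fmult_arrow_right:
  assumes x: "x \<in> arcs Q" and f: "f \<in> PC"
  shows "fmult f (arrow_elt Q x) = R x f"
  using f
proof (induction f rule: PC_induct)
  case (step c p g)
  obtain s es w where p: "p = (s, es)" "wk s es w" using step(1) by (auto simp: qpaths_def)
  have "wk (tail Q x) [x] (head Q x)" using x by (simp add: wk_Cons)
  from fmult_path_elt[OF this p(2)] have "fmult (path_elt p) (arrow_elt Q x) = R x (path_elt p)"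
    using x p by (auto simp: arrow_elt_eq R_path_elt wk_Cons)
  then show ?case using step by (simp add: fmult_linear R_linear)
qed (simp add: fmult_linear R_linear)

lemma mesh_word_PC: "wk s es v \<Longrightarrow> wk v es' w \<Longrightarrow> mesh_word s es v es' \<in> PC"
  unfolding mesh_word_def
proof (intro PC_sum PC_scale path_elt_PC)
  fix x assume "wk s es v" "wk v es' w" "x \<in> {x \<in> arcs Q. tail Q x = v}"
  then have "wk s (es @ [x, star x] @ es') w" by (auto simp: wk_append wk_Cons)
  then show "(s, es @ [x, star x] @ es') \<in> qpaths Q" using qpaths_iff by blast
qed

lemma JJ_PC: "f \<in> JJ \<Longrightarrow> f \<in> PC"
  by (induction rule: JJ_induct) (auto intro: PC_add PC_scale mesh_word_PC)

lemma fmult_mesh_word_left: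
  assumes "wk s es v" "wk v es' w" "wk u es'' u'"
  shows "fmult (path_elt (u, es'')) (mesh_word s es v es') = (if u = w then mesh_word s es v (es' @ es'') else 0)"
proof -
  have "fmult (path_elt (u, es'')) (path_elt (s, es @ [x, star x] @ es')) =
    (if u = w then path_elt (s, es @ [x, star x] @ es' @ es'') else 0)" if "x \<in> arcs Q" "tail Q x = v" for x
  proof -
    have "wk s (es @ [x, star x] @ es') w" using assms that by (auto simp: wk_append wk_Cons)
    from fmult_path_elt[OF this assms(3)] show ?thesis by simp
  qed
  then show ?thesis unfolding mesh_word_def fmult_sum by (auto simp: fmult_linear intro!: sum.cong sum.neutral)
qed

lemma fmult_mesh_word_right:
  assumes "wk s es v" "wk v es' w" "wk u es'' u'"
  shows "fmult (mesh_word s es v es') (path_elt (u, es'')) = (if s = u' then mesh_word u (es'' @ es) v es' else 0)"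
proof -
  have "fmult (path_elt (s, es @ [x, star x] @ es')) (path_elt (u, es'')) =
    (if s = u' then path_elt (u, (es'' @ es) @ [x, star x] @ es') else 0)" if "x \<in> arcs Q" "tail Q x = v" for x
  proof -
    have "wk s (es @ [x, star x] @ es') w" using assms that by (auto simp: wk_append wk_Cons)
    from fmult_path_elt[OF assms(3) this] show ?thesis by simp
  qed
  then show ?thesis unfolding mesh_word_def fmult_sum by (auto simp: fmult_linear intro!: sum.cong sum.neutral)
qed

lemma fmult_JJ: "f \<in> PC \<Longrightarrow> g \<in> JJ \<Longrightarrow> fmult f g \<in> JJ" "f \<in> PC \<Longrightarrow> g \<in> JJ \<Longrightarrow> fmult g f \<in> JJ"
proof -
  assume f: "f \<in> PC" and g: "g \<in> JJ"
  have "fmult (path_elt p) g \<in> JJ \<and> fmult g (path_elt p) \<in> JJ" if pQ: "p \<in> qpaths Q" for p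
    using g
  proof (induction g rule: JJ_induct)
    case (step c s es v es' w g)
    obtain u es'' u' where p: "p = (u, es'')" "wk u es'' u'" using qpaths_cases[OF pQ] .
    have "fmult (path_elt p) (mesh_word s es v es') \<in> JJ"
      using fmult_mesh_word_left[OF step(1,2) p(2)] mesh_word_JJ[OF step(1), of "es' @ es''" u'] step(2) p
      by (auto simp: wk_append)
    moreover have "fmult (mesh_word s es v es') (path_elt p) \<in> JJ"
      using fmult_mesh_word_right[OF step(1,2) p(2)] mesh_word_JJ[OF _ step(2), of u "es'' @ es"] step(1) p
      by (auto simp: wk_append)
    ultimately show ?case using step by (simp add: fmult_linear JJ_add JJ_scale)
  qed (simp add: fmult_linear)
  then have *: "p \<in> qpaths Q \<Longrightarrow> fmult (path_elt p) g \<in> JJ" "p \<in> qpaths Q \<Longrightarrow> fmult g (path_elt p) \<in> JJ" for p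
    by blast+
  show "fmult f g \<in> JJ" using f by (induction f rule: PC_induct) (simp_all add: fmult_linear JJ_add JJ_scale *)
  show "fmult g f \<in> JJ" using f by (induction f rule: PC_induct) (simp_all add: fmult_linear JJ_add JJ_scale *)
qed

lemma ideal_JJ: "ideal JJ PA"
proof (rule idealI[OF ring_PA])
  show "subgroup JJ (add_monoid PA)"
  proof (rule group.subgroupI)
    show "Group.group (add_monoid PA)" by (rule PA.a_group)
    show "inv\<^bsub>add_monoid PA\<^esub> f \<in> JJ" if "f \<in> JJ" for f
      using PA_a_inv[OF JJ_PC[OF that]] JJ_neg[OF that] by (simp add: a_inv_def)
    show "JJ \<noteq> {}" using JJ_zero by blast
  qed (auto simp: PA_simps JJ_PC JJ_add)
qed (auto simp: PA_simps fmult_JJ)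

lemma mesh_relation_eq:
  assumes "v \<in> verts \<Gamma>"
  shows "mesh_relation \<Gamma> a b v = mesh_word v [] v []"
proof -
  have 1: "fmult (arrow_elt Q (Inr \<gamma>)) (arrow_elt Q (Inl \<gamma>)) = (path_elt (v, [Inl \<gamma>, Inr \<gamma>]) :: _ \<Rightarrow> 'k)"
    if "\<gamma> \<in> arcs \<Gamma>" "tail \<Gamma> \<gamma> = v" for \<gamma>
    using that assms fmult_path_elt[of v "[Inl \<gamma>]" "head \<Gamma> \<gamma>" "head \<Gamma> \<gamma>" "[Inr \<gamma>]" v]
    by (simp add: arrow_elt_eq wk_Cons)
  have 2: "fmult (arrow_elt Q (Inl \<gamma>)) (arrow_elt Q (Inr \<gamma>)) = (path_elt (v, [Inr \<gamma>, Inl \<gamma>]) :: _ \<Rightarrow> 'k)"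
    if "\<gamma> \<in> arcs \<Gamma>" "head \<Gamma> \<gamma> = v" for \<gamma>
    using that assms fmult_path_elt[of v "[Inr \<gamma>]" "tail \<Gamma> \<gamma>" "tail \<Gamma> \<gamma>" "[Inl \<gamma>]" v]
    by (simp add: arrow_elt_eq wk_Cons)
  have PC1: "path_elt (v, [Inl \<gamma>, Inr \<gamma>]) \<in> PC" if "\<gamma> \<in> arcs \<Gamma>" "tail \<Gamma> \<gamma> = v" for \<gamma>
  proof -
    have "wk v [Inl \<gamma>, Inr \<gamma>] v" using that assms by (simp add: wk_Cons)
    then show ?thesis using qpaths_iff by (blast intro: path_elt_PC)
  qed
  have PC2: "path_elt (v, [Inr \<gamma>, Inl \<gamma>]) \<in> PC" if "\<gamma> \<in> arcs \<Gamma>" "head \<Gamma> \<gamma> = v" for \<gamma>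
  proof -
    have "wk v [Inr \<gamma>, Inl \<gamma>] v" using that assms by (simp add: wk_Cons)
    then show ?thesis using qpaths_iff by (blast intro: path_elt_PC)
  qed
  let ?S1 = "\<Sum>\<gamma> | \<gamma> \<in> arcs \<Gamma> \<and> tail \<Gamma> \<gamma> = v. fscale (a \<gamma>) (path_elt (v, [Inl \<gamma>, Inr \<gamma>]))"
  let ?S2 = "\<Sum>\<gamma> | \<gamma> \<in> arcs \<Gamma> \<and> head \<Gamma> \<gamma> = v. fscale (b \<gamma>) (path_elt (v, [Inr \<gamma>, Inl \<gamma>]))"
  have f1: "(\<Oplus>\<^bsub>PA\<^esub> \<gamma> \<in> {\<gamma> \<in> arcs \<Gamma>. tail \<Gamma> \<gamma> = v}. a \<gamma> \<odot>\<^bsub>PA\<^esub> (arrow_elt Q (Inr \<gamma>) \<otimes>\<^bsub>PA\<^esub> arrow_elt Q (Inl \<gamma>))) = ?S1"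
    by (subst PA_finsum) (auto simp: PA_simps 1 PC1 PC_scale intro!: sum.cong)
  have f2: "(\<Oplus>\<^bsub>PA\<^esub> \<gamma> \<in> {\<gamma> \<in> arcs \<Gamma>. head \<Gamma> \<gamma> = v}. b \<gamma> \<odot>\<^bsub>PA\<^esub> (arrow_elt Q (Inl \<gamma>) \<otimes>\<^bsub>PA\<^esub> arrow_elt Q (Inr \<gamma>))) = ?S2"
    by (subst PA_finsum) (auto simp: PA_simps 2 PC2 PC_scale intro!: sum.cong)
  have "?S2 \<in> PC" by (intro PC_sum PC_scale PC2) auto
  then have "mesh_relation \<Gamma> a b v = ?S1 - ?S2"
    unfolding mesh_relation_def Let_def f1 f2 a_minus_def by (simp add: PA_a_inv PA_simps)
  also have "\<dots> = mesh_word v [] v []"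
  proof -
    have out: "{x \<in> arcs Q. tail Q x = v} = Inl ` {\<gamma> \<in> arcs \<Gamma>. tail \<Gamma> \<gamma> = v} \<union> Inr ` {\<gamma> \<in> arcs \<Gamma>. head \<Gamma> \<gamma> = v}" (is "_ = ?A \<union> ?B")
    proof (intro Set.set_eqI iffI)
      fix x assume x: "x \<in> {x \<in> arcs Q. tail Q x = v}"
      show "x \<in> ?A \<union> ?B"
      proof (cases x)
        case (Inl \<gamma>)
        then have "\<gamma> \<in> arcs \<Gamma>" "tail \<Gamma> \<gamma> = v" using x by simp_all
        then show ?thesis using Inl by blast
      next
        case (Inr \<gamma>)
        then have "\<gamma> \<in> arcs \<Gamma>" "head \<Gamma> \<gamma> = v" using x by simp_all
        then show ?thesis using Inr by blast
      qed
    qed auto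
    have "mesh_word v [] v [] = (\<Sum>x\<in>?A. fscale (cf x) (path_elt (v, [x, star x]))) +
        (\<Sum>x\<in>?B. fscale (cf x) (path_elt (v, [x, star x])))"
      unfolding mesh_word_def out by (subst sum.union_disjoint) auto
    then show ?thesis
      by (simp add: sum.reindex cf_def sum_negf)
  qed
  finally show ?thesis .
qed

text \<open>The generator is one sum over all vertices. Multiplying it on the right by a path ending
  at \<open>v\<close> leaves only the relation at \<open>v\<close>, and a path starting at
  \<open>v\<close> on the left then yields an arbitrary mesh word.\<close>

lemma preproj_ideal_eq: "preproj_ideal \<Gamma> a b = JJ"
proof -
  define m where "m = (\<Sum>v\<in>verts \<Gamma>. mesh_word v [] v [])"
  have mw: "mesh_word v [] v [] \<in> JJ" if "v \<in> verts \<Gamma>" for v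
    using mesh_word_JJ[of v "[]" v "[]" v] that by simp
  have "(\<Oplus>\<^bsub>PA\<^esub> v \<in> verts \<Gamma>. mesh_relation \<Gamma> a b v) = (\<Oplus>\<^bsub>PA\<^esub> v \<in> verts \<Gamma>. mesh_word v [] v [])"
    by (intro PA.finsum_cong') (auto simp: mesh_relation_eq PA_simps JJ_PC[OF mw])
  also have "\<dots> = m" unfolding m_def by (rule PA_finsum) (auto simp: JJ_PC[OF mw])
  finally have eq: "preproj_ideal \<Gamma> a b = Idl\<^bsub>PA\<^esub> {m}"
    unfolding preproj_ideal_def Let_def by simp
  have mJ: "m \<in> JJ" unfolding m_def by (intro JJ_sum mw)
  have mPC: "m \<in> PC" using JJ_PC[OF mJ] .
  have "Idl\<^bsub>PA\<^esub> {m} \<subseteq> JJ" by (rule PA.genideal_minimal[OF ideal_JJ]) (simp add: mJ)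
  moreover have "JJ \<subseteq> Idl\<^bsub>PA\<^esub> {m}"
  proof
    interpret K: ideal "Idl\<^bsub>PA\<^esub> {m}" PA
      by (rule PA.genideal_ideal) (simp add: PA_simps mPC)
    have mK: "m \<in> Idl\<^bsub>PA\<^esub> {m}" using PA.genideal_self'[of m] mPC by (simp add: PA_simps)
    have K0: "0 \<in> Idl\<^bsub>PA\<^esub> {m}" using K.zero_closed by (simp add: PA_simps)
    have Kadd: "f + g \<in> Idl\<^bsub>PA\<^esub> {m}" if "f \<in> Idl\<^bsub>PA\<^esub> {m}" "g \<in> Idl\<^bsub>PA\<^esub> {m}" for f g
      using K.a_closed[OF that] by (simp add: PA_simps)
    have Kl: "fmult f g \<in> Idl\<^bsub>PA\<^esub> {m}" if "g \<in> Idl\<^bsub>PA\<^esub> {m}" "f \<in> PC" for f g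
      using K.I_l_closed[OF that(1)] that(2) by (simp add: PA_simps)
    have Kr: "fmult g f \<in> Idl\<^bsub>PA\<^esub> {m}" if "g \<in> Idl\<^bsub>PA\<^esub> {m}" "f \<in> PC" for f g
      using K.I_r_closed[OF that(1)] that(2) by (simp add: PA_simps)
    have KPC: "f \<in> PC" if "f \<in> Idl\<^bsub>PA\<^esub> {m}" for f
      using K.a_Hcarr[OF that] by (simp add: PA_simps)
    \<comment> \<open>Ring ideals are not defined with scalars in view; a scalar acts as
      multiplication by that multiple of the unit.\<close>
    have Kscale: "fscale c f \<in> Idl\<^bsub>PA\<^esub> {m}" if "f \<in> Idl\<^bsub>PA\<^esub> {m}" for c f
      using Kl[OF that, of "fscale c unit"] KPC[OF that] unit_PC
      by (simp add: fmult_linear fmult_unit PC_scale)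
    have word: "mesh_word s es v es' \<in> Idl\<^bsub>PA\<^esub> {m}" if es: "wk s es v" "wk v es' w" for s es v es' w
    proof -
      have v: "v \<in> verts \<Gamma>" using wk_verts es by blast
      have "fmult m (path_elt (s, es)) = (\<Sum>u\<in>verts \<Gamma>. if u = v then mesh_word s es v [] else 0)"
        unfolding m_def fmult_sum
      proof (intro sum.cong refl)
        fix u assume "u \<in> verts \<Gamma>"
        then show "fmult (mesh_word u [] u []) (path_elt (s, es)) = (if u = v then mesh_word s es v [] else 0)"
          using fmult_mesh_word_right[of u "[]" u "[]" u s es v] es by auto
      qed
      then have "fmult m (path_elt (s, es)) = mesh_word s es v []" using v by simp
      moreover have "fmult (path_elt (v, es')) (mesh_word s es v []) = mesh_word s es v es'"
        using fmult_mesh_word_left[of s es v "[]" v v es' w] es v by simp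
      ultimately show ?thesis
        using Kl[OF Kr[OF mK, of "path_elt (s, es)"], of "path_elt (v, es')"] es
        by (metis path_elt_PC qpaths_iff)
    qed
    fix f assume "f \<in> JJ"
    then show "f \<in> Idl\<^bsub>PA\<^esub> {m}"
      by (induction rule: JJ_induct) (auto simp: K0 intro: Kadd Kscale word)
  qed
  ultimately show ?thesis using eq by auto
qed

end

section \<open>The quotient algebra and its subspaces of cosets\<close>

context preproj
begin

abbreviation PP :: "('k, (('v, 'e + 'e) qpath \<Rightarrow> 'k) set) module" where "PP \<equiv> preproj_algebra \<Gamma> a b"

abbreviation cl :: "(('v, 'e + 'e) qpath \<Rightarrow> 'k) \<Rightarrow> (('v, 'e + 'e) qpath \<Rightarrow> 'k) set" where
  "cl \<equiv> preproj_class \<Gamma> a b"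

abbreviation sub :: "(('v, 'e + 'e) qpath \<Rightarrow> 'k) set \<Rightarrow> ('k, (('v, 'e + 'e) qpath \<Rightarrow> 'k) set) module" where
  "sub W \<equiv> PP\<lparr>carrier := cl ` W\<rparr>"

lemma cl_coset: "cl f = JJ +>\<^bsub>PA\<^esub> f"
  by (simp add: preproj_class_def preproj_ideal_eq)

lemma cl_eq: "cl f = {g. g - f \<in> JJ}"
proof -
  have "cl f = (\<lambda>h. h + f) ` JJ"
    by (auto simp: cl_coset a_r_coset_def' PA_simps)
  also have "\<dots> = {g. g - f \<in> JJ}" by (auto simp: image_iff) (metis diff_add_cancel)
  finally show ?thesis .
qed

lemma cl_self: "f \<in> cl f"
  by (simp add: cl_eq)

lemma cl_iff: "cl f = cl g \<longleftrightarrow> f - g \<in> JJ"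
proof
  show "cl f = cl g \<Longrightarrow> f - g \<in> JJ" using cl_self[of f] by (auto simp: cl_eq)
next
  assume fg: "f - g \<in> JJ"
  have "h - f \<in> JJ \<longleftrightarrow> h - g \<in> JJ" for h
    using JJ_add[OF _ fg, of "h - f"] JJ_diff[OF _ fg, of "h - g"] by auto
  then show "cl f = cl g" by (simp add: cl_eq)
qed

lemma cl_zero_iff: "cl f = cl 0 \<longleftrightarrow> f \<in> JJ"
  using cl_iff[of f 0] by simp

lemma PP_simps:
  "carrier PP = cl ` PC" "zero PP = cl 0"
  "f \<in> PC \<Longrightarrow> g \<in> PC \<Longrightarrow> cl f \<oplus>\<^bsub>PP\<^esub> cl g = cl (f + g)"
  "f \<in> PC \<Longrightarrow> g \<in> PC \<Longrightarrow> cl f \<otimes>\<^bsub>PP\<^esub> cl g = cl (fmult f g)"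
  "c \<odot>\<^bsub>PP\<^esub> cl f = cl (fscale c f)"
proof -
  interpret JJ: ideal JJ PA by (rule ideal_JJ)
  have P: "PP = ring.extend (PA Quot JJ) \<lparr> smult = (\<lambda>c X. \<Union>x\<in>X. JJ +>\<^bsub>PA\<^esub> (c \<odot>\<^bsub>PA\<^esub> x)) \<rparr>"
    by (simp add: preproj_algebra_def quotient_algebra_def preproj_ideal_eq)
  show "carrier PP = cl ` PC"
    unfolding P by (auto simp: ring.defs FactRing_def A_RCOSETS_def' PA_simps cl_coset)
  have "cl 0 = JJ" by (simp add: cl_eq)
  then show "zero PP = cl 0" unfolding P by (simp add: ring.defs FactRing_def)
  show "cl f \<oplus>\<^bsub>PP\<^esub> cl g = cl (f + g)" if "f \<in> PC" "g \<in> PC"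
    using JJ.a_rcos_sum[of f g] that unfolding P
    by (simp add: ring.defs FactRing_def cl_coset PA_simps)
  show "cl f \<otimes>\<^bsub>PP\<^esub> cl g = cl (fmult f g)" if "f \<in> PC" "g \<in> PC"
    using JJ.rcoset_mult_add[of f g] that unfolding P
    by (simp add: ring.defs FactRing_def cl_coset PA_simps)
  \<comment> \<open>Scalar multiplication of a coset is defined as a union over its elements; all of
    them give the same coset, so the union is that coset.\<close>
  have "cl (fscale c x) = cl (fscale c f)" if "x \<in> cl f" for x
  proof -
    have "x - f \<in> JJ" using that by (simp add: cl_eq)
    then have "fscale c x - fscale c f \<in> JJ"
      unfolding fv.scale_right_diff_distrib[symmetric] by (rule JJ_scale)
    then show ?thesis by (simp only: cl_iff)
  qed
  then have "(\<Union>x\<in>cl f. cl (fscale c x)) = cl (fscale c f)" using cl_self[of f] by blast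
  then show "c \<odot>\<^bsub>PP\<^esub> cl f = cl (fscale c f)"
    unfolding P by (simp add: ring.defs cl_coset[symmetric] PA_simps)
qed

lemma cl_mult_arrow:
  assumes "x \<in> arcs Q" "f \<in> PC"
  shows "cl f \<otimes>\<^bsub>PP\<^esub> preproj_arrow \<Gamma> a b x = cl (R x f)"
proof -
  have "wk (tail Q x) [x] (head Q x)" using assms by (simp add: wk_Cons)
  then have "arrow_elt Q x \<in> PC" unfolding arrow_elt_eq using qpaths_iff by (blast intro: path_elt_PC)
  then show ?thesis
    using assms by (simp add: preproj_arrow_def PP_simps fmult_arrow_right)
qed

lemma vectorspace_sub:
  assumes W: "fv.subspace W" "W \<subseteq> PC"
  shows "vectorspace class_ring (sub W)"
proof (rule vs_criteria)
  note Wc = fv.subspace_0[OF W(1)] fv.subspace_add[OF W(1)] fv.subspace_scale[OF W(1)] fv.subspace_neg[OF W(1)]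
  note PCs = subsetD[OF W(2)]
  show "field (class_ring :: 'k ring)" by (rule class_field)
  show "\<forall>v\<in>carrier (sub W). \<exists>neg_v\<in>carrier (sub W). v \<oplus>\<^bsub>sub W\<^esub> neg_v = \<zero>\<^bsub>sub W\<^esub>"
  proof
    fix v assume "v \<in> carrier (sub W)"
    then obtain f where f: "v = cl f" "f \<in> W" by auto
    show "\<exists>neg_v\<in>carrier (sub W). v \<oplus>\<^bsub>sub W\<^esub> neg_v = \<zero>\<^bsub>sub W\<^esub>"
      using f Wc PCs by (intro bexI[of _ "cl (- f)"]) (auto simp: PP_simps PC_neg)
  qed
qed (auto simp: PP_simps fv.subspace_0[OF W(1)] fv.subspace_add[OF W(1)] fv.subspace_scale[OF W(1)]
    subsetD[OF W(2)] PC_add PC_scale fv.scale_left_distrib fv.scale_right_distrib add_ac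
    intro!: imageI arg_cong[of _ _ cl])

context
  fixes W :: "(('v, 'e + 'e) qpath \<Rightarrow> 'k) set"
  assumes W: "fv.subspace W" "W \<subseteq> PC"
begin

interpretation V: vectorspace class_ring "sub W"
  by (rule vectorspace_sub[OF W])

lemma sub_finsum:
  assumes "finite I" "\<And>i. i \<in> I \<Longrightarrow> g i \<in> W"
  shows "(\<Oplus>\<^bsub>sub W\<^esub>i\<in>I. cl (g i)) = cl (\<Sum>i\<in>I. g i)"
  using assms
proof (induction I)
  case empty
  have "finsum (sub W) (\<lambda>i. cl (g i)) {} = \<zero>\<^bsub>sub W\<^esub>" by (rule V.finsum_empty)
  then show ?case by (simp add: PP_simps)
next
  case (insert i I)
  have "(\<Oplus>\<^bsub>sub W\<^esub>i\<in>insert i I. cl (g i)) = cl (g i) \<oplus>\<^bsub>sub W\<^esub> (\<Oplus>\<^bsub>sub W\<^esub>i\<in>I. cl (g i))"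
    using insert by (intro V.finsum_insert) auto
  also have "\<dots> = cl (g i) \<oplus>\<^bsub>PP\<^esub> cl (\<Sum>i\<in>I. g i)" using insert by simp
  also have "\<dots> = cl (g i + (\<Sum>i\<in>I. g i))"
    using insert W by (intro PP_simps PC_sum) auto
  finally show ?case using insert by simp
qed

lemma sub_lincomb:
  assumes "finite B" "\<And>x. x \<in> B \<Longrightarrow> r x \<in> W \<and> x = cl (r x)"
  shows "V.lincomb c B = cl (\<Sum>x\<in>B. fscale (c x) (r x))"
proof -
  have "V.lincomb c B = (\<Oplus>\<^bsub>sub W\<^esub>x\<in>B. cl (fscale (c x) (r x)))"
    unfolding V.lincomb_def
  proof (rule V.finsum_cong')
    show "(\<lambda>x. cl (fscale (c x) (r x))) \<in> B \<rightarrow> carrier (sub W)"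
      using assms fv.subspace_scale[OF W(1)] by auto
    show "c x \<odot>\<^bsub>sub W\<^esub> x = cl (fscale (c x) (r x))" if "x \<in> B" for x
      using PP_simps(5)[of "c x" "r x"] assms(2)[OF that] by simp
  qed simp
  also have "\<dots> = cl (\<Sum>x\<in>B. fscale (c x) (r x))"
    using assms fv.subspace_scale[OF W(1)] by (intro sub_finsum) auto
  finally show ?thesis .
qed

lemma sub_span:
  assumes S: "finite S" "\<And>s. s \<in> S \<Longrightarrow> v s \<in> W"
  shows "cl (\<Sum>s\<in>S. fscale (c s) (v s)) \<in> V.span ((\<lambda>s. cl (v s)) ` S)"
proof -
  let ?X = "(\<lambda>s. cl (v s)) ` S"
  have X: "?X \<subseteq> carrier (sub W)" using S by auto
  interpret X: submodule class_ring "V.span ?X" "sub W" by (rule V.span_is_submodule[OF X])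
  have "cl (\<Sum>s\<in>S'. fscale (c s) (v s)) \<in> V.span ?X" if "S' \<subseteq> S" for S'
    using finite_subset[OF that S(1)] that
  proof (induction S')
    case empty
    show ?case using X.zero_closed by (simp add: PP_simps)
  next
    case (insert s S')
    have "cl (v s) \<in> V.span ?X" using V.in_own_span[OF X] insert by auto
    then have "c s \<odot>\<^bsub>sub W\<^esub> cl (v s) \<in> V.span ?X" by (intro X.smult_closed) auto
    then have "cl (fscale (c s) (v s)) \<oplus>\<^bsub>sub W\<^esub> cl (\<Sum>s\<in>S'. fscale (c s) (v s)) \<in> V.span ?X"
      using insert by (intro X.m_closed) (auto simp: PP_simps)
    moreover have "cl (fscale (c s) (v s)) \<oplus>\<^bsub>PP\<^esub> cl (\<Sum>s\<in>S'. fscale (c s) (v s)) =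
        cl (fscale (c s) (v s) + (\<Sum>s\<in>S'. fscale (c s) (v s)))"
      using insert W S by (intro PP_simps PC_sum PC_scale) auto
    ultimately show ?case using insert by simp
  qed
  then show ?thesis by blast
qed

lemma sub_fin_dim:
  assumes S: "finite S" "\<And>s. s \<in> S \<Longrightarrow> v s \<in> W" and gen: "\<And>z. z \<in> W \<Longrightarrow> \<exists>c. z - (\<Sum>s\<in>S. fscale (c s) (v s)) \<in> JJ"
  shows "V.gen_set ((\<lambda>s. cl (v s)) ` S)" "V.fin_dim" "V.dim \<le> card S"
proof -
  let ?X = "(\<lambda>s. cl (v s)) ` S"
  have X: "finite ?X" "?X \<subseteq> carrier (sub W)" using S by auto
  have "carrier (sub W) \<subseteq> V.span ?X"
  proof
    fix x assume "x \<in> carrier (sub W)"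
    then obtain z where z: "z \<in> W" "x = cl z" by auto
    obtain c where "z - (\<Sum>s\<in>S. fscale (c s) (v s)) \<in> JJ" using gen z(1) by blast
    then have "x = cl (\<Sum>s\<in>S. fscale (c s) (v s))" using z(2) cl_iff by blast
    then show "x \<in> V.span ?X" using sub_span[OF S] by simp
  qed
  then show gs: "V.gen_set ?X" using V.span_is_subset2[OF X(2)] by blast
  then show "V.fin_dim" unfolding V.fin_dim_def using X by blast
  show "V.dim \<le> card S"
    using V.gen_ge_dim[OF X gs] card_image_le[OF S(1), of "\<lambda>s. cl (v s)"] by simp
qed

text \<open>A basis is a set of vectors while \<open>indep_mod\<close> speaks of a family, so
  injectivity comes first: two equal classes give a relation with coefficients 1 and -1.\<close>

lemma sub_basis:
  assumes fd: "V.fin_dim" and S: "finite S" "\<And>s. s \<in> S \<Longrightarrow> v s \<in> W" "indep_mod JJ S v" and card: "card S = V.dim"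
  shows "inj_on (\<lambda>s. cl (v s)) S" "V.basis ((\<lambda>s. cl (v s)) ` S)"
proof -
  let ?f = "\<lambda>s. cl (v s)"
  show inj: "inj_on ?f S"
  proof (rule inj_onI, rule ccontr)
    fix s s' assume s: "s \<in> S" "s' \<in> S" "cl (v s) = cl (v s')" "s \<noteq> s'"
    define c where "c r = (if r = s then 1 else if r = s' then - 1 else 0 :: 'k)" for r
    have "(\<Sum>r\<in>S. fscale (c r) (v r)) = (\<Sum>r\<in>{s, s'}. fscale (c r) (v r))"
      using S(1) s by (intro sum.mono_neutral_right) (auto simp: c_def)
    also have "\<dots> = v s - v s'" using s(4) by (simp add: c_def)
    also have "\<dots> \<in> JJ" using s(3) by (simp add: cl_iff)
    finally have "c s = 0" using S(3) s(1) unfolding indep_mod_def by blast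
    then show False by (simp add: c_def)
  qed
  have "V.lin_indpt (?f ` S)"
  proof
    assume "V.lin_dep (?f ` S)"
    then obtain B c x where B: "finite B" "B \<subseteq> ?f ` S" "V.lincomb c B = \<zero>\<^bsub>sub W\<^esub>" "x \<in> B" "c x \<noteq> 0"
      unfolding V.lin_dep_def by auto
    define S' where "S' = {s \<in> S. ?f s \<in> B}"
    have B_eq: "B = ?f ` S'" using B(2) by (auto simp: S'_def)
    have inj': "inj_on ?f S'" using inj by (rule inj_on_subset) (auto simp: S'_def)
    define r where "r y = v (the_inv_into S' ?f y)" for y
    have r: "r (?f s) = v s" if "s \<in> S'" for s
      using the_inv_into_f_f[OF inj' that] by (simp add: r_def)
    have "V.lincomb c B = cl (\<Sum>y\<in>B. fscale (c y) (r y))"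
    proof (rule sub_lincomb[OF B(1)])
      fix y assume "y \<in> B"
      then obtain s where s: "s \<in> S'" "y = ?f s" using B_eq by blast
      then have "s \<in> S" by (simp add: S'_def)
      then show "r y \<in> W \<and> y = cl (r y)" using r[OF s(1)] s(2) S(2) by simp
    qed
    also have "(\<Sum>y\<in>B. fscale (c y) (r y)) = (\<Sum>s\<in>S'. fscale (c (?f s)) (v s))"
      unfolding B_eq sum.reindex[OF inj'] using r by (intro sum.cong) auto
    also have "\<dots> = (\<Sum>s\<in>S. fscale (if s \<in> S' then c (?f s) else 0) (v s))"
      using S(1) by (intro sum.mono_neutral_cong_left) (auto simp: S'_def)
    finally have "cl (\<Sum>s\<in>S. fscale (if s \<in> S' then c (?f s) else 0) (v s)) = cl 0"
      using B(3) by (simp add: PP_simps)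
    then have "(\<Sum>s\<in>S. fscale (if s \<in> S' then c (?f s) else 0) (v s)) \<in> JJ"
      by (simp only: cl_zero_iff)
    from S(3)[unfolded indep_mod_def, rule_format, OF this]
    have "s \<in> S \<Longrightarrow> (if s \<in> S' then c (?f s) else 0) = 0" for s .
    from this have "c (?f s) = 0" if "s \<in> S'" for s
      using that by (metis (no_types, lifting) S'_def mem_Collect_eq)
    then show False using B(4,5) by (auto simp: B_eq)
  qed
  then show "V.basis (?f ` S)"
    using fd S(1,2) card card_image[OF inj] by (intro V.dim_li_is_basis) auto
qed

text \<open>Representatives of distinct basis vectors. This supplies the starting families F_{i,1},
  ..., F_{i,n_i}, whose length is at most dim V_i.\<close>

lemma sub_independent:
  assumes fd: "V.fin_dim" and K: "finite K" "card K \<le> V.dim"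
  shows "\<exists>v. (\<forall>k\<in>K. v k \<in> W) \<and> indep_mod JJ K v"
proof -
  obtain \<beta> where \<beta>: "finite \<beta>" "V.basis \<beta>" using V.finite_basis_exists[OF fd] by blast
  have li: "V.lin_indpt \<beta>" and \<beta>W: "\<beta> \<subseteq> cl ` W" using \<beta>(2) unfolding V.basis_def by auto
  have "card K \<le> card \<beta>" using K(2) V.dim_basis[OF \<beta>] by simp
  then obtain h where h: "h ` K \<subseteq> \<beta>" "inj_on h K" using card_le_inj[OF K(1) \<beta>(1)] by blast
  have "\<forall>x\<in>\<beta>. \<exists>f. f \<in> W \<and> x = cl f" using \<beta>W by blast
  from bchoice[OF this] obtain r where r: "\<And>x. x \<in> \<beta> \<Longrightarrow> r x \<in> W \<and> x = cl (r x)" by blast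
  have "indep_mod JJ K (\<lambda>k. r (h k))"
    unfolding indep_mod_def
  proof (intro allI impI ballI)
    fix c k assume c: "(\<Sum>k\<in>K. fscale (c k) (r (h k))) \<in> JJ" and k: "k \<in> K"
    define e where "e x = c (the_inv_into K h x)" for x
    have e: "e (h k) = c k" if "k \<in> K" for k using the_inv_into_f_f[OF h(2) that] by (simp add: e_def)
    have "V.lincomb e (h ` K) = cl (\<Sum>x\<in>h ` K. fscale (e x) (r x))"
      using K(1) r h(1) by (intro sub_lincomb) auto
    also have "(\<Sum>x\<in>h ` K. fscale (e x) (r x)) = (\<Sum>k\<in>K. fscale (c k) (r (h k)))"
      unfolding sum.reindex[OF h(2)] using e by (intro sum.cong) auto
    also have "cl \<dots> = \<zero>\<^bsub>sub W\<^esub>" using c by (simp add: PP_simps cl_zero_iff)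
    finally have "V.lincomb e (h ` K) = \<zero>\<^bsub>sub W\<^esub>" .
    then have "e (h k) = 0" using li h(1) K(1) k unfolding V.lin_dep_def by (auto simp: Pi_def)
    then show "c k = 0" using e k by simp
  qed
  then show ?thesis using r h(1) by (intro exI[of _ "\<lambda>k. r (h k)"]) auto
qed

end
end

section \<open>The components V^t_d as finite dimensional spaces of cosets\<close>

context acyclic_preproj
begin

abbreviation dpaths :: "'v \<Rightarrow> nat \<Rightarrow> ('v, 'e + 'e) qpath set" where
  "dpaths s d \<equiv> {p \<in> qpaths Q. fst p = s \<and> path_degree p = d}"

lemma finite_dpaths: "finite (dpaths s d)"
proof -
  have "dpaths s d \<subseteq> (\<Union>v\<in>verts \<Gamma>. gpaths s v (int d))"
  proof
    fix p assume p: "p \<in> dpaths s d"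
    then have "p \<in> qpaths Q" by simp
    then obtain s' es v where es: "p = (s', es)" "wk s' es v" by (rule qpaths_cases)
    then show "p \<in> (\<Union>v\<in>verts \<Gamma>. gpaths s v (int d))"
      using p wk_verts(2)[OF es(2)] by (intro UN_I[of v]) (auto simp: gpaths_def)
  qed
  then show ?thesis by (rule finite_subset) (simp add: finite_gpaths)
qed

lemma GT_dpaths: "GT s (int d) = {f. \<forall>p. f p \<noteq> 0 \<longrightarrow> p \<in> dpaths s d}"
  by (auto simp: GT_def)

lemma GT_PC: "GT s (int d) \<subseteq> PC"
proof
  fix f assume "f \<in> GT s (int d)"
  then have "{p. f p \<noteq> 0} \<subseteq> dpaths s d" by (auto simp: GT_dpaths)
  then show "f \<in> PC" using finite_subset[OF _ finite_dpaths] by (auto simp: PC_def)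
qed

lemma GT_expand: "f \<in> GT s (int d) \<Longrightarrow> f = (\<Sum>p\<in>dpaths s d. fscale (f p) (path_elt p))"
proof
  fix q assume f: "f \<in> GT s (int d)"
  have "(\<Sum>p\<in>dpaths s d. fscale (f p) (path_elt p)) q = (\<Sum>p\<in>dpaths s d. if p = q then f q else 0)"
    unfolding sum_fun_apply by (intro sum.cong) (auto simp: fun_simps path_elt_def)
  also have "\<dots> = (if q \<in> dpaths s d then f q else 0)" by (rule sum.delta[OF finite_dpaths])
  also have "\<dots> = f q"
  proof -
    have "f q = 0" if "q \<notin> dpaths s d" using f that unfolding GT_dpaths by blast
    then show ?thesis by simp
  qed
  finally show "f q = (\<Sum>p\<in>dpaths s d. fscale (f p) (path_elt p)) q" by simp
qed

lemma path_elt_GT: "p \<in> dpaths s d \<Longrightarrow> path_elt p \<in> GT s (int d)"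
  by (auto simp: GT_dpaths path_elt_def)

lemma preproj_component_eq: "preproj_component \<Gamma> a b s d = cl ` GT s (int d)"
proof -
  have PPsub: "sub PC = PP" by (simp add: PP_simps(1)[symmetric])
  interpret V: vectorspace class_ring PP
    using vectorspace_sub[OF PC_subspace subset_refl] unfolding PPsub .
  let ?X = "(\<lambda>p. cl (path_elt p)) ` dpaths s d"
  have comp: "preproj_component \<Gamma> a b s d = V.span ?X"
    by (simp add: preproj_component_def)
  show ?thesis unfolding comp
  proof
    show "V.span ?X \<subseteq> cl ` GT s (int d)"
    proof
      fix x assume "x \<in> V.span ?X"
      then obtain c B where B: "x = V.lincomb c B" "finite B" "B \<subseteq> ?X" unfolding V.span_def by blast
      have "\<forall>y\<in>B. \<exists>f. f \<in> GT s (int d) \<and> y = cl f" using B(3) path_elt_GT by blast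
      from bchoice[OF this] obtain r where r: "\<And>y. y \<in> B \<Longrightarrow> r y \<in> GT s (int d) \<and> y = cl (r y)" by blast
      have "x = cl (\<Sum>y\<in>B. fscale (c y) (r y))"
        unfolding B(1) using sub_lincomb[OF PC_subspace subset_refl B(2), of r c] r GT_PC[of s d]
        unfolding PPsub by blast
      moreover have "(\<Sum>y\<in>B. fscale (c y) (r y)) \<in> GT s (int d)"
        using r by (intro fv.subspace_sum[OF GT_subspace] fv.subspace_scale[OF GT_subspace]) blast
      ultimately show "x \<in> cl ` GT s (int d)" by blast
    qed
    show "cl ` GT s (int d) \<subseteq> V.span ?X"
    proof
      fix x assume "x \<in> cl ` GT s (int d)"
      then obtain f where f: "f \<in> GT s (int d)" "x = cl f" by blast
      have "cl (\<Sum>p\<in>dpaths s d. fscale (f p) (path_elt p)) \<in> V.span ?X"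
        using sub_span[OF PC_subspace subset_refl finite_dpaths, of s d path_elt f]
        unfolding PPsub by (simp add: path_elt_PC)
      then show "x \<in> V.span ?X" using GT_expand[OF f(1)] f(2) by simp
    qed
  qed
qed

lemma component_fin_dim: "vectorspace.fin_dim class_ring (sub (GT s (int d)))"
proof (rule sub_fin_dim(2)[OF GT_subspace GT_PC finite_dpaths])
  show "path_elt p \<in> GT s (int d)" if "p \<in> dpaths s d" for p using path_elt_GT[OF that] .
  show "\<exists>c. z - (\<Sum>p\<in>dpaths s d. fscale (c p) (path_elt p)) \<in> JJ" if "z \<in> GT s (int d)" for z
    using GT_expand[OF that] by (intro exI[of _ z]) simp
qed

end

section \<open>General elements\<close>

lemma indep_mod_reindex:
  assumes h: "inj_on h I" and v: "indep_mod J (h ` I) v"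
  shows "indep_mod J I (\<lambda>i. v (h i))"
  unfolding indep_mod_def
proof (intro allI impI ballI)
  fix c i assume c: "(\<Sum>i\<in>I. fscale (c i) (v (h i))) \<in> J" and i: "i \<in> I"
  have "(\<Sum>s\<in>h ` I. fscale (c (the_inv_into I h s)) (v s)) = (\<Sum>i\<in>I. fscale (c i) (v (h i)))"
    unfolding sum.reindex[OF h] using the_inv_into_f_f[OF h] by (intro sum.cong) auto
  then have "(\<Sum>s\<in>h ` I. fscale (c (the_inv_into I h s)) (v s)) \<in> J" using c by simp
  from v[unfolded indep_mod_def, rule_format, OF this, of "h i"] show "c i = 0"
    using i the_inv_into_f_f[OF h i] by simp
qed

text \<open>Principal open sets form a base: some defining function of the closed complement is
  nonzero at \<open>y\<close>.\<close>

lemma openin_zariski_basic: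
  assumes "openin (zariski_topology C X) Y" "y \<in> Y"
  shows "\<exists>f\<in>polynomial_functions C. f y \<noteq> 0 \<and> (\<forall>z\<in>X. f z \<noteq> 0 \<longrightarrow> z \<in> Y)"
proof -
  from assms(1) have Y: "Y \<subseteq> X" "zariski_closed C X (X - Y)" by (simp_all add: openin_zariski)
  from Y(2) obtain S where S: "S \<subseteq> polynomial_functions C" "X - Y = {z \<in> X. \<forall>f\<in>S. f z = 0}"
    unfolding zariski_closed_def by (elim exE conjE)
  have mem: "z \<in> X - Y \<longleftrightarrow> z \<in> X \<and> (\<forall>f\<in>S. f z = 0)" for z by (subst S(2)) simp
  obtain f where f: "f \<in> S" "f y \<noteq> 0" using mem[of y] assms(2) Y(1) by blast
  moreover have "z \<in> Y" if "z \<in> X" "f z \<noteq> 0" for z using mem[of z] f(1) that by blast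
  ultimately show ?thesis using S(1) by blast
qed

context acyclic_preproj
begin

text \<open>\<open>T\<close> indexes the products and \<open>E\<close> the factors of the affine
  space. Functionals dual to the products at the tuple \<open>F1\<close> give a determinant
  \<open>D\<close> that is polynomial in the tuple and equals 1 at \<open>F1\<close>. Where
  \<open>D\<close> is nonzero the products are independent, and their number makes them a
  basis.\<close>

lemma for_general_basis:
  fixes T :: "'i set" and E :: "'j set" and x :: "'i \<Rightarrow> 'e + 'e" and e :: "'i \<Rightarrow> 'j"
    and vx :: "'j \<Rightarrow> 'v" and dx :: "'j \<Rightarrow> nat"
  assumes inf: "infinite (UNIV :: 'k set)" and T: "finite T"
    and x: "\<And>\<tau>. \<tau> \<in> T \<Longrightarrow> x \<tau> \<in> Out t \<and> e \<tau> \<in> E \<and> head Q (x \<tau>) = vx (e \<tau>) \<and> int (dx (e \<tau>)) = int d - deg (x \<tau>)"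
    and F1: "\<And>i. i \<in> E \<Longrightarrow> F1 i \<in> GT (vx i) (int (dx i))"
    and indep: "indep_mod JJ T (\<lambda>\<tau>. R (x \<tau>) (F1 (e \<tau>)))"
    and card: "card T = subspace_dim PP (preproj_component \<Gamma> a b t d)"
  shows "for_general (affine_space PP E (\<lambda>i. preproj_component \<Gamma> a b (vx i) (dx i)))
    (\<lambda>F. inj_on (\<lambda>\<tau>. F (e \<tau>) \<otimes>\<^bsub>PP\<^esub> preproj_arrow \<Gamma> a b (x \<tau>)) T \<and>
      subspace_basis PP (preproj_component \<Gamma> a b t d) ((\<lambda>\<tau>. F (e \<tau>) \<otimes>\<^bsub>PP\<^esub> preproj_arrow \<Gamma> a b (x \<tau>)) ` T))"
proof -
  let ?V = "\<lambda>i. cl ` GT (vx i) (int (dx i))"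
  define X where "X = (\<Pi>\<^sub>E i\<in>E. ?V i)"
  define C where "C = {\<lambda>F. \<phi> (F i) | i \<phi>. i \<in> E \<and> \<phi> \<in> linear_forms PP (?V i)}"
  obtain \<xi> where \<xi>: "\<And>\<sigma>. \<sigma> \<in> T \<Longrightarrow> functional_mod JJ (\<xi> \<sigma>)"
    "\<And>\<sigma> \<tau>. \<sigma> \<in> T \<Longrightarrow> \<tau> \<in> T \<Longrightarrow> \<xi> \<sigma> (R (x \<tau>) (F1 (e \<tau>))) = (if \<sigma> = \<tau> then 1 else 0)"
    using dual_family[OF JJ_subspace T indep] by blast
  \<comment> \<open>A linear form on cosets. The chosen representative does not matter, because
    \<open>R y\<close> preserves \<open>JJ\<close> and the functional kills
    \<open>JJ\<close>.\<close>
  define \<phi> where "\<phi> \<sigma> y z = \<xi> \<sigma> (R y (SOME f. f \<in> z))" for \<sigma> y z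
  have \<phi>_cl: "\<phi> \<sigma> y (cl f) = \<xi> \<sigma> (R y f)" if \<sigma>: "\<sigma> \<in> T" for \<sigma> y f
  proof -
    define g where "g = (SOME g. g \<in> cl f)"
    have "g \<in> cl f" unfolding g_def by (rule someI[of _ f]) (rule cl_self)
    then have "R y (g - f) \<in> JJ" by (intro R_JJ) (simp add: cl_eq)
    moreover have "R y g = R y (g - f) + R y f" by (simp add: R_linear)
    ultimately have "\<xi> \<sigma> (R y g) = \<xi> \<sigma> (R y f)"
      using \<xi>(1)[OF \<sigma>] unfolding functional_mod_def by simp
    then show ?thesis by (simp add: \<phi>_def g_def)
  qed
  have \<phi>_linear: "\<phi> \<sigma> y \<in> linear_forms PP (?V i)" if \<sigma>: "\<sigma> \<in> T" for \<sigma> y i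
  proof -
    have "\<phi> \<sigma> y (cl f \<oplus>\<^bsub>PP\<^esub> cl g) = \<phi> \<sigma> y (cl f) + \<phi> \<sigma> y (cl g)"
      if "f \<in> GT (vx i) (int (dx i))" "g \<in> GT (vx i) (int (dx i))" for f g
      using subsetD[OF GT_PC that(1)] subsetD[OF GT_PC that(2)] \<xi>(1)[OF \<sigma>]
      by (simp add: PP_simps \<phi>_cl[OF \<sigma>] R_linear functional_mod_def)
    moreover have "\<phi> \<sigma> y (c \<odot>\<^bsub>PP\<^esub> cl f) = c * \<phi> \<sigma> y (cl f)" for c f
      using \<xi>(1)[OF \<sigma>] by (simp add: PP_simps \<phi>_cl[OF \<sigma>] R_linear functional_mod_def)
    ultimately show ?thesis unfolding linear_forms_def by auto
  qed
  define D where "D F = family_det T (\<lambda>\<sigma> \<tau>. \<phi> \<sigma> (x \<tau>) (F (e \<tau>)))" for F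
  have D_poly: "D \<in> polynomial_functions C"
    unfolding D_def
  proof (intro family_det_polynomial polynomial_functions.coord T)
    show "(\<lambda>F. \<phi> \<sigma> (x \<tau>) (F (e \<tau>))) \<in> C" if "\<sigma> \<in> T" "\<tau> \<in> T" for \<sigma> \<tau>
      unfolding C_def using that x \<phi>_linear by blast
  qed
  define U where "U = {F \<in> X. D F \<noteq> 0}"
  have lift: "\<exists>r. (\<forall>i\<in>E. r i \<in> GT (vx i) (int (dx i)) \<and> F i = cl (r i))" if F: "F \<in> X" for F
  proof -
    have "\<forall>i\<in>E. \<exists>f. f \<in> GT (vx i) (int (dx i)) \<and> F i = cl f" using F by (auto simp: X_def PiE_def Pi_def)
    from bchoice[OF this] show ?thesis .
  qed
  have D_cl: "D F = family_det T (\<lambda>\<sigma> \<tau>. \<xi> \<sigma> (R (x \<tau>) (r (e \<tau>))))" if "\<forall>i\<in>E. F i = cl (r i)" for F r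
    unfolding D_def using that x by (intro family_det_cong[OF T]) (auto simp: \<phi>_cl)
  have basis: "inj_on (\<lambda>\<tau>. F (e \<tau>) \<otimes>\<^bsub>PP\<^esub> preproj_arrow \<Gamma> a b (x \<tau>)) T \<and>
      subspace_basis PP (preproj_component \<Gamma> a b t d) ((\<lambda>\<tau>. F (e \<tau>) \<otimes>\<^bsub>PP\<^esub> preproj_arrow \<Gamma> a b (x \<tau>)) ` T)"
    if F: "F \<in> U" for F
  proof -
    obtain r where r: "\<And>i. i \<in> E \<Longrightarrow> r i \<in> GT (vx i) (int (dx i))" "\<And>i. i \<in> E \<Longrightarrow> F i = cl (r i)"
      using lift[of F] F unfolding U_def by blast
    let ?v = "\<lambda>\<tau>. R (x \<tau>) (r (e \<tau>))"
    have eq: "F (e \<tau>) \<otimes>\<^bsub>PP\<^esub> preproj_arrow \<Gamma> a b (x \<tau>) = cl (?v \<tau>)" if "\<tau> \<in> T" for \<tau>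
      using x[OF that] r cl_mult_arrow[of "x \<tau>" "r (e \<tau>)"] subsetD[OF GT_PC r(1)] by auto
    have "family_det T (\<lambda>\<sigma> \<tau>. \<xi> \<sigma> (?v \<tau>)) \<noteq> 0"
      using F D_cl[of F r] r(2) unfolding U_def by simp
    then have ind: "indep_mod JJ T ?v"
      using family_det_indep[OF T, of JJ \<xi> ?v] \<xi>(1) by blast
    have vGT: "?v \<tau> \<in> GT t (int d)" if "\<tau> \<in> T" for \<tau>
    proof -
      have x\<tau>: "x \<tau> \<in> arcs Q" "tail Q (x \<tau>) = t" "e \<tau> \<in> E" using x[OF that] by auto
      have "r (e \<tau>) \<in> GT (head Q (x \<tau>)) (int d - deg (x \<tau>))" using r(1)[OF x\<tau>(3)] x[OF that] by metis
      from R_GT[OF x\<tau>(1) this] show ?thesis using x\<tau>(2) by simp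
    qed
    have "card T = vectorspace.dim class_ring (sub (GT t (int d)))"
      using card by (simp add: preproj_component_eq)
    from sub_basis[OF GT_subspace GT_PC component_fin_dim T vGT ind this]
    have "inj_on (\<lambda>\<tau>. cl (?v \<tau>)) T" "subspace_basis PP (preproj_component \<Gamma> a b t d) ((\<lambda>\<tau>. cl (?v \<tau>)) ` T)"
      by (simp_all add: preproj_component_eq)
    moreover have "(\<lambda>\<tau>. F (e \<tau>) \<otimes>\<^bsub>PP\<^esub> preproj_arrow \<Gamma> a b (x \<tau>)) ` T = (\<lambda>\<tau>. cl (?v \<tau>)) ` T"
      using eq by (rule image_cong[OF refl])
    ultimately show ?thesis using eq by (simp cong: inj_on_cong)
  qed
  define G1 where "G1 = (\<lambda>i\<in>E. cl (F1 i))"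
  have G1: "G1 \<in> X" unfolding G1_def X_def using F1 by auto
  have D1: "D G1 = 1"
    by (subst D_cl[of G1 F1]) (auto simp: G1_def \<xi>(2) intro!: family_det_one[OF T])
  have openU: "openin (zariski_topology C X) U"
    unfolding openin_zariski
  proof
    show "zariski_closed C X (X - U)"
      unfolding zariski_closed_def using D_poly by (intro exI[of _ "{D}"]) (auto simp: U_def)
  qed (auto simp: U_def)
  have dense: "U \<inter> Y \<noteq> {}" if Y: "openin (zariski_topology C X) Y" "Y \<noteq> {}" for Y
  proof -
    obtain y where y: "y \<in> Y" using Y(2) by blast
    have yX: "y \<in> X" using y Y(1) unfolding openin_zariski by blast
    from openin_zariski_basic[OF Y(1) y]
    obtain f where f: "f \<in> polynomial_functions C" "f y \<noteq> 0" "\<And>z. z \<in> X \<Longrightarrow> f z \<noteq> 0 \<Longrightarrow> z \<in> Y"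
      by blast
    obtain r where r: "\<And>i. i \<in> E \<Longrightarrow> r i \<in> GT (vx i) (int (dx i))" "\<And>i. i \<in> E \<Longrightarrow> y i = cl (r i)"
      using lift[OF yX] by blast
    \<comment> \<open>The line from \<open>y\<close> at \<epsilon> = 0 to \<open>G1\<close> at
      \<epsilon> = 1. The function \<open>f\<close> is nonzero at the first point and
      \<open>D\<close> at the second, so over an infinite field both are nonzero at a common
      parameter.\<close>
    define line where "line \<epsilon> = (\<lambda>i\<in>E. cl (r i + fscale \<epsilon> (F1 i - r i)))" for \<epsilon>
    have line0: "line 0 = y" using yX r(2) by (auto simp: X_def line_def fun_eq_iff PiE_def extensional_def)
    have line1: "line 1 = G1" by (auto simp: line_def G1_def)
    have lineX: "line \<epsilon> \<in> X" for \<epsilon>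
      unfolding line_def X_def using r(1) F1
      by (auto intro!: imageI fv.subspace_add[OF GT_subspace] fv.subspace_scale[OF GT_subspace] fv.subspace_diff[OF GT_subspace])
    have affine: "\<exists>p q. \<forall>\<epsilon>. g (line \<epsilon>) = p + \<epsilon> * q" if gC: "g \<in> C" for g
    proof -
      obtain i \<psi> where g: "g = (\<lambda>F. \<psi> (F i))" "i \<in> E" "\<psi> \<in> linear_forms PP (?V i)" using gC unfolding C_def by blast
      have i: "r i \<in> GT (vx i) (int (dx i))" "F1 i - r i \<in> GT (vx i) (int (dx i))"
        using r(1) F1 g(2) by (auto intro: fv.subspace_diff[OF GT_subspace])
      have "g (line \<epsilon>) = \<psi> (cl (r i)) + \<epsilon> * \<psi> (cl (F1 i - r i))" for \<epsilon>
      proof -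
        have 1: "fscale \<epsilon> (F1 i - r i) \<in> GT (vx i) (int (dx i))" using i(2) by (rule fv.subspace_scale[OF GT_subspace])
        have "g (line \<epsilon>) = \<psi> (cl (r i) \<oplus>\<^bsub>PP\<^esub> cl (fscale \<epsilon> (F1 i - r i)))"
          using g(1,2) subsetD[OF GT_PC i(1)] subsetD[OF GT_PC 1] by (simp add: line_def PP_simps)
        also have "\<dots> = \<psi> (cl (r i)) + \<psi> (cl (fscale \<epsilon> (F1 i - r i)))"
          using g(3) i(1) 1 unfolding linear_forms_def by blast
        also have "\<psi> (cl (fscale \<epsilon> (F1 i - r i))) = \<epsilon> * \<psi> (cl (F1 i - r i))"
          using g(3) i(2) unfolding linear_forms_def by (auto simp: PP_simps(5)[symmetric])
        finally show ?thesis .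
      qed
      then show ?thesis by blast
    qed
    have "\<exists>p. \<forall>\<epsilon>. f (line \<epsilon>) = poly p \<epsilon>" using f(1) affine by (rule polynomial_function_on_line)
    then obtain p where p: "\<And>\<epsilon>. f (line \<epsilon>) = poly p \<epsilon>" by blast
    have "\<exists>q. \<forall>\<epsilon>. D (line \<epsilon>) = poly q \<epsilon>" using D_poly affine by (rule polynomial_function_on_line)
    then obtain q where q: "\<And>\<epsilon>. D (line \<epsilon>) = poly q \<epsilon>" by blast
    have "p \<noteq> 0" using p[of 0] line0 f(2) by auto
    moreover have "q \<noteq> 0" using q[of 1] line1 D1 by auto
    ultimately have "finite {\<epsilon>. poly (p * q) \<epsilon> = 0}" by (intro poly_roots_finite) simp
    then obtain \<epsilon> where "\<epsilon> \<notin> {\<epsilon>. poly (p * q) \<epsilon> = 0}" using inf ex_new_if_finite by blast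
    then have \<epsilon>: "f (line \<epsilon>) \<noteq> 0" "D (line \<epsilon>) \<noteq> 0" using p q by auto
    then have "line \<epsilon> \<in> U \<inter> Y" using f(3) lineX unfolding U_def by blast
    then show ?thesis by blast
  qed
  have space: "affine_space PP E (\<lambda>i. preproj_component \<Gamma> a b (vx i) (dx i)) = zariski_topology C X"
    unfolding affine_space_def preproj_component_eq C_def X_def ..
  have "zariski_topology C X closure_of U = topspace (zariski_topology C X)"
    using dense unfolding dense_intersects_open by blast
  then show ?thesis
    unfolding for_general_def space using openU basis by blast
qed

end

theorem corollary4p3:
  fixes \<Gamma> :: "('v, 'e) pre_digraph"
    and a b :: "'e \<Rightarrow> 'k::alg_closed_field"
    and t :: 'v and d m n l :: nat
    and s u :: "nat \<Rightarrow> 'v"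
    and \<beta> :: "nat \<Rightarrow> nat \<Rightarrow> 'e + 'e"
    and N c :: "nat \<Rightarrow> nat"
    and Q :: "('v, 'e + 'e) pre_digraph"
    and P :: "('k, (('v, 'e + 'e) qpath \<Rightarrow> 'k) set) module"
    and Vtd :: "(('v, 'e + 'e) qpath \<Rightarrow> 'k) set set"
    and V :: "nat \<Rightarrow> (('v, 'e + 'e) qpath \<Rightarrow> 'k) set set"
    and arrows :: "nat \<Rightarrow> ('e + 'e) set"
    and W :: "nat \<Rightarrow> (('v, 'e + 'e) qpath \<Rightarrow> 'k) set"
    and dimW :: "nat \<Rightarrow> nat"
  defines "Q \<equiv> double_quiver \<Gamma>"
    and "P \<equiv> preproj_algebra \<Gamma> a b"
    and "Vtd \<equiv> preproj_component \<Gamma> a b t d"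
    and "V \<equiv> (\<lambda>i. if i \<le> m then preproj_component \<Gamma> a b (s i) (d - 1)
                   else preproj_component \<Gamma> a b (u (i - m)) d)"
    and "arrows \<equiv> (\<lambda>i. if i \<le> m then {x \<in> Inr ` arcs \<Gamma>. tail Q x = t \<and> head Q x = s i}
                        else {x \<in> Inl ` arcs \<Gamma>. tail Q x = t \<and> head Q x = u (i - m)})"
    and "W \<equiv> (\<lambda>i. arrow_space Q (arrows i))"
    and "dimW \<equiv> (\<lambda>i. subspace_dim (path_algebra Q) (W i))"
  assumes quiver: "fin_digraph \<Gamma>" "acyclic_quiver \<Gamma>"
    and ab: "\<And>\<gamma>. \<gamma> \<in> arcs \<Gamma> \<Longrightarrow> a \<gamma> \<noteq> 0 \<and> b \<gamma> \<noteq> 0"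
    and t: "t \<in> verts \<Gamma>"
    and d: "d > 0"
    and nonzero: "Vtd \<noteq> {\<zero>\<^bsub>P\<^esub>}"
    and s: "bij_betw s {1..m} {v. \<exists>\<gamma>\<in>arcs \<Gamma>. tail \<Gamma> \<gamma> = v \<and> head \<Gamma> \<gamma> = t}"
    and u: "bij_betw u {1..n} {v. \<exists>\<gamma>\<in>arcs \<Gamma>. tail \<Gamma> \<gamma> = t \<and> head \<Gamma> \<gamma> = v}"
    and l: "l = m + n"
    and \<beta>: "\<And>i. i \<in> {1..l} \<Longrightarrow> bij_betw (\<beta> i) {1..dimW i} (arrows i)"
    and N: "\<And>i. i \<in> {1..l} \<Longrightarrow> 1 \<le> N i \<and> N i \<le> subspace_dim P (V i)"
    and lower: "(\<Sum>i=1..l. (N i - 1) * dimW i) < subspace_dim P Vtd"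
    and upper: "subspace_dim P Vtd \<le> (\<Sum>i=1..l. N i * dimW i)"
    and c_sum: "subspace_dim P Vtd - (\<Sum>i=1..l. (N i - 1) * dimW i) = (\<Sum>i=1..l. c i)"
    and c_le: "\<And>i. i \<in> {1..l} \<Longrightarrow> c i \<le> dimW i"
  shows "for_general (affine_space P (SIGMA i:{1..l}. {1..N i}) (\<lambda>(i, k). V i))
    (\<lambda>F. let I = {(i, k, j). 1 \<le> i \<and> i \<le> l \<and> 1 \<le> k \<and> k \<le> N i - 1 \<and> 1 \<le> j \<and> j \<le> dimW i}
                 \<union> {(i, k, j). 1 \<le> i \<and> i \<le> l \<and> k = N i \<and> 1 \<le> j \<and> j \<le> c i};
             f = (\<lambda>(i, k, j). F (i, k) \<otimes>\<^bsub>P\<^esub> preproj_arrow \<Gamma> a b (\<beta> i j))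
         in inj_on f I \<and> subspace_basis P Vtd (f ` I))"
proof -
  interpret G: acyclic_preproj \<Gamma> a b
    using quiver ab by (simp add: acyclic_preproj_def acyclic_preproj_axioms_def preproj_def)
  have inf: "infinite (UNIV :: 'k set)" by (rule infinite_alg_closed_field)
  define vx where "vx i = (if i \<le> m then s i else u (i - m))" for i
  define dx where "dx i = (if i \<le> m then d - 1 else d)" for i
  \<comment> \<open>The second entry is 1 for i up to \<open>m\<close> and 0 beyond, the degree of
    the arrows in question; thus \<open>idx i\<close> is the common value of \<open>cls\<close> on
    \<open>arrows i\<close>.\<close>
  define idx where "idx i = (vx i, int d - int (dx i))" for i
  have idx_if: "idx i = (if i \<le> m then (s i, 1) else (u (i - m), 0))" for i
    using d by (auto simp: idx_def vx_def dx_def)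
  have V_eq: "V i = preproj_component \<Gamma> a b (vx i) (dx i)" for i
    by (simp add: V_def vx_def dx_def)
  have idx_inj: "inj_on idx {1..l}"
  proof (rule inj_onI)
    fix i j assume ij: "i \<in> {1..l}" "j \<in> {1..l}" "idx i = idx j"
    show "i = j"
    proof (cases "i \<le> m")
      case True
      then have "j \<le> m" "s i = s j" using ij(3) by (auto simp: idx_if split: if_splits)
      then show ?thesis
        using True ij(1,2) inj_onD[OF bij_betw_imp_inj_on[OF s], of i j] by simp
    next
      case False
      then have j: "\<not> j \<le> m" "u (i - m) = u (j - m)" using ij(3) by (auto simp: idx_if split: if_splits)
      have "i - m \<in> {1..n}" "j - m \<in> {1..n}" using False j(1) ij(1,2) l by auto
      then have "i - m = j - m" using inj_onD[OF bij_betw_imp_inj_on[OF u] j(2)] by blast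
      then show ?thesis using False j(1) by simp
    qed
  qed
  have arrows_iff: "x \<in> arrows i \<longleftrightarrow> x \<in> G.Out t \<and> G.cls x = idx i" for x i
    unfolding arrows_def Q_def by (cases x; cases "i \<le> m") (auto simp: idx_if G.cls_def)
  have s_image: "s ` {1..m} = {v. \<exists>\<gamma>\<in>arcs \<Gamma>. tail \<Gamma> \<gamma> = v \<and> head \<Gamma> \<gamma> = t}"
    and u_image: "u ` {1..n} = {v. \<exists>\<gamma>\<in>arcs \<Gamma>. tail \<Gamma> \<gamma> = t \<and> head \<Gamma> \<gamma> = v}"
    using s u by (simp_all add: bij_betw_def)
  have idx_image: "idx ` {1..l} = G.cls ` G.Out t"
  proof
    show "idx ` {1..l} \<subseteq> G.cls ` G.Out t"
    proof
      fix p assume "p \<in> idx ` {1..l}"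
      then obtain i where i: "i \<in> {1..l}" "p = idx i" by blast
      show "p \<in> G.cls ` G.Out t"
      proof (cases "i \<le> m")
        case True
        then have "s i \<in> s ` {1..m}" using i(1) by simp
        then obtain \<gamma> where "\<gamma> \<in> arcs \<Gamma>" "tail \<Gamma> \<gamma> = s i" "head \<Gamma> \<gamma> = t" unfolding s_image by blast
        then show ?thesis using True i(2) by (intro image_eqI[of _ _ "Inr \<gamma>"]) (auto simp: idx_if G.cls_def)
      next
        case False
        then have "i - m \<in> {1..n}" using i(1) l by auto
        then have "u (i - m) \<in> u ` {1..n}" by (rule imageI)
        then obtain \<gamma> where "\<gamma> \<in> arcs \<Gamma>" "tail \<Gamma> \<gamma> = t" "head \<Gamma> \<gamma> = u (i - m)" unfolding u_image by blast
        then show ?thesis using False i(2) by (intro image_eqI[of _ _ "Inl \<gamma>"]) (auto simp: idx_if G.cls_def)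
      qed
    qed
    show "G.cls ` G.Out t \<subseteq> idx ` {1..l}"
    proof
      fix p assume "p \<in> G.cls ` G.Out t"
      then obtain x where x: "x \<in> G.Out t" "p = G.cls x" by blast
      show "p \<in> idx ` {1..l}"
      proof (cases x)
        case (Inl \<gamma>)
        then have "head \<Gamma> \<gamma> \<in> u ` {1..n}" using x(1) unfolding u_image by auto
        then obtain k where "k \<in> {1..n}" "head \<Gamma> \<gamma> = u k" by blast
        then show ?thesis using x(2) Inl l by (intro image_eqI[of _ _ "m + k"]) (auto simp: idx_if G.cls_def)
      next
        case (Inr \<gamma>)
        then have "tail \<Gamma> \<gamma> \<in> s ` {1..m}" using x(1) unfolding s_image by auto
        then obtain k where "k \<in> {1..m}" "tail \<Gamma> \<gamma> = s k" by blast
        then show ?thesis using x(2) Inr l by (intro image_eqI[of _ _ k]) (auto simp: idx_if G.cls_def)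
      qed
    qed
  qed
  \<comment> \<open>\<open>?I1\<close> contains the factors with k < n_i, used with all arrows, and
    \<open>?I2\<close> the last factor, used with the first c_i arrows only.\<close>
  let ?I1 = "SIGMA i:{1..l}. {1..N i - 1} \<times> {1..dimW i}" and ?I2 = "SIGMA i:{1..l}. {N i} \<times> {1..c i}"
  let ?I = "?I1 \<union> ?I2" and ?E = "SIGMA i:{1..l}. {1..N i}"
  let ?x = "\<lambda>(i, k, j). \<beta> i j" and ?e = "\<lambda>(i, k :: nat, j :: nat). (i :: nat, k)"
  let ?h = "\<lambda>(i, k, j). (\<beta> i j, k)"
  have I: "i \<in> {1..l}" "k \<in> {1..N i}" "j \<in> {1..dimW i}" if "(i, k, j) \<in> ?I" for i k j
    using that N[of i] c_le[of i] by auto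
  have arrow: "\<beta> i j \<in> G.Out t" "G.cls (\<beta> i j) = idx i" if "(i, k, j) \<in> ?I" for i k j
    using bij_betw_apply[OF \<beta>[OF I(1)[OF that]] I(3)[OF that]] arrows_iff by auto
  \<comment> \<open>An arrow determines its class, hence i, and then j because
    \<open>\<beta> i\<close> is injective.\<close>
  have h_inj: "inj_on ?h ?I"
  proof (rule inj_onI)
    fix y z assume yz: "y \<in> ?I" "z \<in> ?I" "?h y = ?h z"
    obtain i k j i' k' j' where eq: "y = (i, k, j)" "z = (i', k', j')" by (metis prod_cases3)
    have y: "(i, k, j) \<in> ?I" and z: "(i', k', j') \<in> ?I" and k: "k = k'" and b: "\<beta> i j = \<beta> i' j'"
      using yz unfolding eq by auto
    have "idx i = idx i'" using arrow(2)[OF y] arrow(2)[OF z] b by simp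
    then have i: "i = i'" using inj_onD[OF idx_inj] I(1)[OF y] I(1)[OF z] by blast
    have "j = j'"
      using inj_onD[OF bij_betw_imp_inj_on[OF \<beta>[OF I(1)[OF y]]], of j j'] b I(3)[OF y] I(3)[OF z] i by simp
    then show "y = z" using eq i k by simp
  qed
  have finI: "finite ?I" by auto
  have card_I: "card ?I = subspace_dim P Vtd"
  proof -
    have "N i \<notin> {1..N i - 1}" if "i \<in> {1..l}" for i using N[OF that] by auto
    then have "?I1 \<inter> ?I2 = {}" by fastforce
    then have "card ?I = card ?I1 + card ?I2" by (intro card_Un_disjoint) auto
    also have "\<dots> = (\<Sum>i=1..l. (N i - 1) * dimW i) + (\<Sum>i=1..l. c i)" by simp
    also have "\<dots> = subspace_dim P Vtd" using lower c_sum by linarith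
    finally show ?thesis .
  qed
  \<comment> \<open>\<open>general_independent\<close> indexes the families by classes; the inverse
    of \<open>idx\<close> recovers the number i and with it n_i.\<close>
  define K where "K p = {1..N (the_inv_into {1..l} idx p)}" for p
  have K_idx: "K (idx i) = {1..N i}" if "i \<in> {1..l}" for i
    using the_inv_into_f_f[OF idx_inj that] by (simp add: K_def)
  have "\<exists>v. (\<forall>k\<in>K p. v k \<in> G.GT (fst p) (int d - snd p)) \<and> indep_mod G.JJ (K p) v"
    if p: "p \<in> G.cls ` G.Out t" for p
  proof -
    obtain i where i: "i \<in> {1..l}" "p = idx i" using p unfolding idx_image[symmetric] by (rule imageE)
    have Kp: "K p = {1..N i}" using K_idx[OF i(1)] i(2) by simp
    have Vi: "V i = G.cl ` G.GT (vx i) (int (dx i))"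
      unfolding V_eq by (rule G.preproj_component_eq)
    have "card (K p) \<le> vectorspace.dim class_ring (G.sub (G.GT (vx i) (int (dx i))))"
      using N[OF i(1)] unfolding Kp Vi P_def by simp
    from G.sub_independent[OF G.GT_subspace G.GT_PC G.component_fin_dim _ this]
    have "\<exists>v. (\<forall>k\<in>K p. v k \<in> G.GT (vx i) (int (dx i))) \<and> indep_mod G.JJ (K p) v"
      unfolding Kp by blast
    moreover have "fst p = vx i" "int d - snd p = int (dx i)" using i(2) by (simp_all add: idx_def)
    ultimately show ?thesis by (simp only:)
  qed
  then have "\<forall>p\<in>G.cls ` G.Out t. \<exists>v. (\<forall>k\<in>K p. v k \<in> G.GT (fst p) (int d - snd p)) \<and> indep_mod G.JJ (K p) v"
    by blast
  from bchoice[OF this] obtain F0 where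
    F0: "\<And>p. p \<in> G.cls ` G.Out t \<Longrightarrow> (\<forall>k\<in>K p. F0 p k \<in> G.GT (fst p) (int d - snd p)) \<and> indep_mod G.JJ (K p) (F0 p)"
    by blast
  have "\<exists>F. (\<forall>p\<in>G.cls ` G.Out t. \<forall>k\<in>K p. F p k \<in> G.GT (fst p) (int d - snd p)) \<and>
    indep_mod G.JJ (?h ` ?I) (\<lambda>(x, k). G.R x (F (G.cls x) k))"
  proof (rule G.general_independent[OF inf t])
    show "0 < int d" using d by simp
    show "?h ` ?I \<subseteq> G.Out t \<times> UNIV" using arrow(1) by fast
    show "finite (?h ` ?I)" using finI by (rule finite_imageI)
    show "k \<in> K (G.cls x)" if xk: "(x, k) \<in> ?h ` ?I" for x k
    proof -
      obtain \<tau> where \<tau>: "\<tau> \<in> ?I" "(x, k) = ?h \<tau>" using xk by (rule imageE)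
      obtain i k' j where eq: "\<tau> = (i, k', j)" by (metis prod_cases3)
      have ij: "(i, k, j) \<in> ?I" "x = \<beta> i j" using \<tau> unfolding eq by simp_all
      show ?thesis using arrow(2)[OF ij(1)] K_idx[OF I(1)[OF ij(1)]] I(2)[OF ij(1)] ij(2) by simp
    qed
    show "finite (K p)" for p by (simp add: K_def)
    show "F0 p k \<in> G.GT (fst p) (int d - snd p)" if "p \<in> G.cls ` G.Out t" "k \<in> K p" for p k
      using F0 that by blast
    show "indep_mod G.JJ (K p) (F0 p)" if "p \<in> G.cls ` G.Out t" for p using F0 that by blast
    \<comment> \<open>Otherwise fewer than \<open>card ?I\<close> elements would span V^t_d,
      although this cardinality is its dimension.\<close>
    show "\<exists>z\<in>G.GT t (int d). \<forall>c. z - (\<Sum>s\<in>S. fscale (c s) (v s)) \<notin> G.JJ"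
      if S: "S \<subseteq> ?h ` ?I" "card S < card (?h ` ?I)" and v: "\<And>s. s \<in> S \<Longrightarrow> v s \<in> G.GT t (int d)" for S v
    proof (rule ccontr)
      assume no: "\<not> ?thesis"
      have "finite S" using S(1) finI finite_subset by blast
      from G.sub_fin_dim(3)[OF G.GT_subspace G.GT_PC this, of v t d] no v
      have "subspace_dim P Vtd \<le> card S" by (auto simp: P_def Vtd_def G.preproj_component_eq)
      then show False using S(2) card_image[OF h_inj] card_I by simp
    qed
  qed
  then obtain F where F: "\<And>p k. p \<in> G.cls ` G.Out t \<Longrightarrow> k \<in> K p \<Longrightarrow> F p k \<in> G.GT (fst p) (int d - snd p)"
    and ind: "indep_mod G.JJ (?h ` ?I) (\<lambda>(x, k). G.R x (F (G.cls x) k))"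
    by blast
  define F1 where "F1 = (\<lambda>(i, k). F (idx i) k)"
  have main: "for_general (affine_space (preproj_algebra \<Gamma> a b) ?E (\<lambda>p. preproj_component \<Gamma> a b (vx (fst p)) (dx (fst p))))
    (\<lambda>F. inj_on (\<lambda>\<tau>. F (?e \<tau>) \<otimes>\<^bsub>preproj_algebra \<Gamma> a b\<^esub> preproj_arrow \<Gamma> a b (?x \<tau>)) ?I \<and>
      subspace_basis (preproj_algebra \<Gamma> a b) (preproj_component \<Gamma> a b t d)
        ((\<lambda>\<tau>. F (?e \<tau>) \<otimes>\<^bsub>preproj_algebra \<Gamma> a b\<^esub> preproj_arrow \<Gamma> a b (?x \<tau>)) ` ?I))"
  proof (rule G.for_general_basis[OF inf finI])
    fix \<tau> assume \<tau>: "\<tau> \<in> ?I"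
    obtain i k j where eq: "\<tau> = (i, k, j)" by (metis prod_cases3)
    then have ijk: "(i, k, j) \<in> ?I" using \<tau> by simp
    have "(head (double_quiver \<Gamma>) (\<beta> i j), deg (\<beta> i j)) = (vx i, int d - int (dx i))"
      using arrow(2)[OF ijk] by (simp add: G.cls_def idx_def)
    then show "?x \<tau> \<in> G.Out t \<and> ?e \<tau> \<in> ?E \<and> head (double_quiver \<Gamma>) (?x \<tau>) = vx (fst (?e \<tau>)) \<and>
        int (dx (fst (?e \<tau>))) = int d - deg (?x \<tau>)"
      using arrow(1)[OF ijk] I(1,2)[OF ijk] eq by simp
  next
    fix p assume "p \<in> ?E"
    then obtain i k where p: "p = (i, k)" "i \<in> {1..l}" "k \<in> {1..N i}" by blast
    then have "F (idx i) k \<in> G.GT (fst (idx i)) (int d - snd (idx i))"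
      using idx_image K_idx by (intro F) auto
    then show "F1 p \<in> G.GT (vx (fst p)) (int (dx (fst p)))" by (simp add: F1_def p(1) idx_def)
  next
    have "indep_mod G.JJ ?I (\<lambda>\<tau>. (\<lambda>(x, k). G.R x (F (G.cls x) k)) (?h \<tau>))"
      by (rule indep_mod_reindex[OF h_inj ind])
    also have "indep_mod G.JJ ?I (\<lambda>\<tau>. (\<lambda>(x, k). G.R x (F (G.cls x) k)) (?h \<tau>)) \<longleftrightarrow>
        indep_mod G.JJ ?I (\<lambda>\<tau>. G.R (?x \<tau>) (F1 (?e \<tau>)))"
    proof (rule indep_mod_cong)
      fix \<tau> assume \<tau>: "\<tau> \<in> ?I"
      obtain i k j where eq: "\<tau> = (i, k, j)" by (metis prod_cases3)
      then have "(i, k, j) \<in> ?I" using \<tau> by simp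
      from arrow(2)[OF this] show "(\<lambda>(x, k). G.R x (F (G.cls x) k)) (?h \<tau>) = G.R (?x \<tau>) (F1 (?e \<tau>))"
        by (simp add: eq F1_def)
    qed
    finally show "indep_mod G.JJ ?I (\<lambda>\<tau>. G.R (?x \<tau>) (F1 (?e \<tau>)))" .
  next
    show "card ?I = subspace_dim (preproj_algebra \<Gamma> a b) (preproj_component \<Gamma> a b t d)"
      using card_I by (simp add: P_def Vtd_def)
  qed
  have I_eq: "{(i, k, j). 1 \<le> i \<and> i \<le> l \<and> 1 \<le> k \<and> k \<le> N i - 1 \<and> 1 \<le> j \<and> j \<le> dimW i}
      \<union> {(i, k, j). 1 \<le> i \<and> i \<le> l \<and> k = N i \<and> 1 \<le> j \<and> j \<le> c i} = ?I"
    by auto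
  have V_fun: "(\<lambda>(i, k). V i) = (\<lambda>p. preproj_component \<Gamma> a b (vx (fst p)) (dx (fst p)))"
    by (auto simp: V_eq)
  have f_eq: "(\<lambda>(i, k, j). F (i, k) \<otimes>\<^bsub>preproj_algebra \<Gamma> a b\<^esub> preproj_arrow \<Gamma> a b (\<beta> i j)) =
      (\<lambda>\<tau>. F (?e \<tau>) \<otimes>\<^bsub>preproj_algebra \<Gamma> a b\<^esub> preproj_arrow \<Gamma> a b (?x \<tau>))" for F
    by auto
  show ?thesis
    unfolding P_def Vtd_def Let_def I_eq V_fun f_eq by (rule main)
qed

end
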